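(* Let $\mathbb{K}$ be an algebraically closed field of characteristic zero. Let $n_0\ge 0$, $n_1,n_2\ge 1$ be integers, let $l_{ij}$ ($i\in\{0,1,2\}$, $1\le j\le n_i$) be positive integers, and let $$X=\left\{T_{01}^{l_{01}}\cdots T_{0n_0}^{l_{0n_0}}+T_{11}^{l_{11}}\cdots T_{1n_1}^{l_{1n_1}}+T_{21}^{l_{21}}\cdots T_{2n_2}^{l_{2n_2}}=0\right\}\subset\mathbb{K}^{n_0+n_1+n_2}$$ be the corresponding trinomial hypersurface (if $n_0=0$, the first monomial is $1$). Then $X$ is not rigid if and only if at least one of the following conditions holds: 1) there exist $i\in\{0,1,2\}$ and $a\in\{1,\ldots,n_i\}$ such that $l_{ia}=1$; 2) $n_0\neq 0$ and there exist $i\neq j$ in $\{0,1,2\}$ and $a\in\{1,\ldots,n_i\}$, $b\in\{1,\ldots,n_j\}$ such that $l_{ia}=l_{jb}=2$ and for all $u\in\{1,\ldots,n_i\}$, $v\in\{1,\ldots,n_j\}$ the numbers $l_{iu}$ and $l_{jv}$ are even.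
   Context: The coordinates on $\mathbb{K}^{n_0+n_1+n_2}$ are $T_{ij}$, $i\in\{0,1,2\}$, $1\le j\le n_i$. A derivation $\partial$ of a commutative $\mathbb{K}$-algebra $A$ (a $\mathbb{K}$-linear map satisfying the Leibniz rule) is locally nilpotent (an LND) if for every $a\in A$ there is a positive integer $n$ with $\partial^n(a)=0$. An affine variety $X$ is rigid if $\mathbb{K}[X]$ admits no nonzero LND. *)

theory Defs
  imports
    "HOL-Library.Poly_Mapping"
    "HOL-Library.FuncSet"
    "HOL-Algebra.Module"
    "HOL-Algebra.Algebraic_Closure_Type"
begin

text \<open>
  The base field is a type \<open>'k\<close>, viewed as a HOL-Algebra ring via
  \<^const>\<open>ring_of_type_algebra\<close> where needed. Commutative algebras are \<open>module\<close> records
  satisfying the library locale \<open>algebra\<close>, so that derivations are defined for arbitrary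
  algebras and only their values on the carrier matter.
\<close>

definition derivation :: "('r, 'm) ring_scheme \<Rightarrow> ('r, 'a, 'n) module_scheme \<Rightarrow> ('a \<Rightarrow> 'a) \<Rightarrow> bool"
  where "derivation K A d \<longleftrightarrow>
    d \<in> carrier A \<rightarrow> carrier A \<and>
    (\<forall>x\<in>carrier A. \<forall>y\<in>carrier A. d (x \<oplus>\<^bsub>A\<^esub> y) = d x \<oplus>\<^bsub>A\<^esub> d y) \<and>
    (\<forall>c\<in>carrier K. \<forall>x\<in>carrier A. d (c \<odot>\<^bsub>A\<^esub> x) = c \<odot>\<^bsub>A\<^esub> d x) \<and>
    (\<forall>x\<in>carrier A. \<forall>y\<in>carrier A.
       d (x \<otimes>\<^bsub>A\<^esub> y) = (d x \<otimes>\<^bsub>A\<^esub> y) \<oplus>\<^bsub>A\<^esub> (x \<otimes>\<^bsub>A\<^esub> d y))"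

definition LND :: "('r, 'm) ring_scheme \<Rightarrow> ('r, 'a, 'n) module_scheme \<Rightarrow> ('a \<Rightarrow> 'a) \<Rightarrow> bool"
  where "LND K A d \<longleftrightarrow>
    derivation K A d \<and> (\<forall>a\<in>carrier A. \<exists>n>0. (d ^^ n) a = \<zero>\<^bsub>A\<^esub>)"

text \<open>
  A polynomial in the variables \<open>'v\<close> is a finitely supported map from exponent vectors
  to coefficients; it involves only variables from \<open>I\<close> if all its exponent vectors are
  supported in \<open>I\<close>.
\<close>

type_synonym ('v, 'k) mpoly = "('v \<Rightarrow>\<^sub>0 nat) \<Rightarrow>\<^sub>0 'k"

definition polys_in :: "'v set \<Rightarrow> ('v, 'k::zero) mpoly set"
  where "polys_in I = {p. \<forall>m\<in>Poly_Mapping.keys p. Poly_Mapping.keys m \<subseteq> I}"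

definition eval_mpoly :: "('v, 'k::comm_semiring_1) mpoly \<Rightarrow> ('v \<Rightarrow> 'k) \<Rightarrow> 'k"
  where "eval_mpoly p x =
    (\<Sum>m\<in>Poly_Mapping.keys p.
       Poly_Mapping.lookup p m * (\<Prod>v\<in>Poly_Mapping.keys m. x v ^ Poly_Mapping.lookup m v))"

text \<open>
  Points of affine space with coordinates indexed by \<open>I\<close> are the extensional functions on
  \<open>I\<close>. For an algebraic subset \<open>V\<close>, the algebra \<open>K[V]\<close> of regular functions consists of the
  restrictions to \<open>V\<close> of polynomial functions in these coordinates, that is, of the classes of
  polynomials modulo the ideal of all polynomials vanishing on \<open>V\<close>.
\<close>

definition affine_space :: "'v set \<Rightarrow> ('v \<Rightarrow> 'k) set"
  where "affine_space I = (I \<rightarrow>\<^sub>E UNIV)"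

definition coordinate_ring ::
    "'v set \<Rightarrow> ('v \<Rightarrow> 'k::field) set \<Rightarrow> ('k, ('v \<Rightarrow> 'k) \<Rightarrow> 'k) module"
  where "coordinate_ring I V = \<lparr>
    carrier = (\<lambda>p. restrict (eval_mpoly p) V) ` polys_in I,
    monoid.mult = (\<lambda>f g. \<lambda>x\<in>V. f x * g x),
    one = (\<lambda>x\<in>V. 1),
    ring.zero = (\<lambda>x\<in>V. 0),
    add = (\<lambda>f g. \<lambda>x\<in>V. f x + g x),
    module.smult = (\<lambda>c f. \<lambda>x\<in>V. c * f x) \<rparr>"

lemma poly_mapping_add_single_induct:
  assumes "P 0" and step: "\<And>f a b. P f \<Longrightarrow> P (f + Poly_Mapping.single a b)"
  shows "P (f :: 'a \<Rightarrow>\<^sub>0 'b::monoid_add)"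
proof (induction f rule: update_induct)
  case const
  show ?case by fact
next
  case (update f a b)
  have "Poly_Mapping.update a b f = f + Poly_Mapping.single a b"
    using update by (intro poly_mapping_eqI)
      (auto simp: lookup_update lookup_add lookup_single in_keys_iff when_def)
  thus ?case using update step by simp
qed

lemma eval_mpoly_zero [simp]: "eval_mpoly 0 x = 0"
  by (simp add: eval_mpoly_def)

lemma eval_mpoly_add [simp]: "eval_mpoly (p + q) x = eval_mpoly p x + eval_mpoly q x"
  unfolding eval_mpoly_def
  by (rule setsum_keys_plus_distrib) (auto simp: algebra_simps)

lemma eval_mpoly_single:
  "eval_mpoly (Poly_Mapping.single m c) x =
     c * (\<Prod>v\<in>Poly_Mapping.keys m. x v ^ Poly_Mapping.lookup m v)"
  by (simp add: eval_mpoly_def)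

lemma eval_mpoly_single_mult_single:
  "eval_mpoly (Poly_Mapping.single m c * Poly_Mapping.single m' c') x =
     eval_mpoly (Poly_Mapping.single m c) x * eval_mpoly (Poly_Mapping.single m' c') x"
proof -
  let ?A = "Poly_Mapping.keys m \<union> Poly_Mapping.keys m'"
  let ?e = "\<lambda>m. \<Prod>v\<in>Poly_Mapping.keys m. x v ^ Poly_Mapping.lookup m v"
  have ext: "?e k = (\<Prod>v\<in>?A. x v ^ Poly_Mapping.lookup k v)" if "Poly_Mapping.keys k \<subseteq> ?A" for k
    using that by (intro prod.mono_neutral_left) (auto simp: in_keys_iff)
  have "?e (m + m') = ?e m * ?e m'"
    by (subst (1 2 3) ext) (simp_all add: keys_add lookup_add power_add prod.distrib)
  thus ?thesis by (simp add: mult_single eval_mpoly_single mult_ac)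
qed

lemma eval_mpoly_mult [simp]: "eval_mpoly (p * q) x = eval_mpoly p x * eval_mpoly q x"
proof (induction p rule: poly_mapping_add_single_induct)
  case (2 p m c)
  have "eval_mpoly (Poly_Mapping.single m c * q) x =
          eval_mpoly (Poly_Mapping.single m c) x * eval_mpoly q x"
    by (induction q rule: poly_mapping_add_single_induct)
       (simp_all add: eval_mpoly_single_mult_single algebra_simps)
  with 2 show ?case by (simp add: algebra_simps)
qed simp

lemma polys_in_const: "Poly_Mapping.single 0 c \<in> polys_in I"
  by (simp add: polys_in_def)

lemma polys_in_add: "p \<in> polys_in I \<Longrightarrow> q \<in> polys_in I \<Longrightarrow> p + q \<in> polys_in I"
  using keys_add[of p q] by (auto simp: polys_in_def)

lemma polys_in_mult:
  assumes pq: "p \<in> polys_in I" "q \<in> polys_in I"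
  shows "p * q \<in> polys_in I"
proof -
  have "Poly_Mapping.keys m \<subseteq> I" if m: "m \<in> Poly_Mapping.keys (p * q)" for m
  proof -
    from m keys_mult[of p q] obtain a b
      where ab: "m = a + b" "a \<in> Poly_Mapping.keys p" "b \<in> Poly_Mapping.keys q"
      by blast
    with pq have "Poly_Mapping.keys a \<subseteq> I" "Poly_Mapping.keys b \<subseteq> I"
      by (simp_all add: polys_in_def)
    with ab(1) keys_add[of a b] show ?thesis by blast
  qed
  thus ?thesis by (simp add: polys_in_def)
qed

theorem algebra_coordinate_ring:
  "algebra (ring_of_type_algebra :: 'k::Fields.field ring) (coordinate_ring I V)"
proof -
  let ?A = "coordinate_ring I V"
  have closed:
    "restrict (eval_mpoly (Poly_Mapping.single 0 c)) V \<in> carrier ?A"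
    "p \<in> polys_in I \<Longrightarrow> q \<in> polys_in I \<Longrightarrow> restrict (eval_mpoly (p + q)) V \<in> carrier ?A"
    "p \<in> polys_in I \<Longrightarrow> q \<in> polys_in I \<Longrightarrow> restrict (eval_mpoly (p * q)) V \<in> carrier ?A"
    for c :: 'k and p q
    by (auto simp: coordinate_ring_def polys_in_const polys_in_add polys_in_mult)
  have const: "(\<lambda>x\<in>V. c) \<in> carrier ?A" for c :: 'k
    using closed(1)[of c] by (simp add: eval_mpoly_single restrict_def cong: if_cong)
  have add: "(\<lambda>x\<in>V. f x + g x) \<in> carrier ?A" if "f \<in> carrier ?A" "g \<in> carrier ?A" for f g
  proof -
    from that obtain p q where pq: "p \<in> polys_in I" "q \<in> polys_in I"
      "f = restrict (eval_mpoly p) V" "g = restrict (eval_mpoly q) V"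
      by (auto simp: coordinate_ring_def)
    have "(\<lambda>x\<in>V. f x + g x) = restrict (eval_mpoly (p + q)) V"
      by (auto simp: pq restrict_def)
    thus ?thesis using closed(2) pq by simp
  qed
  have mult: "(\<lambda>x\<in>V. f x * g x) \<in> carrier ?A" if "f \<in> carrier ?A" "g \<in> carrier ?A" for f g
  proof -
    from that obtain p q where pq: "p \<in> polys_in I" "q \<in> polys_in I"
      "f = restrict (eval_mpoly p) V" "g = restrict (eval_mpoly q) V"
      by (auto simp: coordinate_ring_def)
    have "(\<lambda>x\<in>V. f x * g x) = restrict (eval_mpoly (p * q)) V"
      by (auto simp: pq restrict_def)
    thus ?thesis using closed(3) pq by simp
  qed
  have smult: "(\<lambda>x\<in>V. c * f x) \<in> carrier ?A" if "f \<in> carrier ?A" for c f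
    using mult[OF const[of c] that] by (simp add: restrict_def cong: if_cong)
  have outside: "undefined = f v" if "f \<in> carrier ?A" "v \<notin> V" for f v
    using that by (auto simp: coordinate_ring_def)
  have neg: "\<exists>g\<in>carrier ?A. (\<lambda>x\<in>V. g x + f x) = (\<lambda>x\<in>V. 0)" if "f \<in> carrier ?A" for f
    using smult[OF that, of "-1"]
    by (intro bexI[of _ "\<lambda>x\<in>V. -1 * f x"]) (auto simp: restrict_def)
  have ops: "x \<otimes>\<^bsub>?A\<^esub> y = (\<lambda>v\<in>V. x v * y v)" "x \<oplus>\<^bsub>?A\<^esub> y = (\<lambda>v\<in>V. x v + y v)"
    "\<one>\<^bsub>?A\<^esub> = (\<lambda>v\<in>V. 1)" "\<zero>\<^bsub>?A\<^esub> = (\<lambda>v\<in>V. 0)" "c \<odot>\<^bsub>?A\<^esub> x = (\<lambda>v\<in>V. c * x v)" for x y c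
    by (simp_all add: coordinate_ring_def)
  have "cring ?A"
  proof (rule cringI)
    show "abelian_group ?A"
      by (rule abelian_groupI)
         (use add const neg in \<open>auto simp: ops fun_eq_iff restrict_def algebra_simps intro: outside\<close>)
    show "comm_monoid ?A"
      by (rule comm_monoidI)
         (use mult const in \<open>auto simp: ops fun_eq_iff restrict_def algebra_simps intro: outside\<close>)
  qed (auto simp: ops fun_eq_iff restrict_def algebra_simps)
  thus ?thesis
    by (intro algebraI cring_from_type_algebra)
       (use smult in \<open>auto simp: ops ring_of_type_algebra_def fun_eq_iff restrict_def
          algebra_simps intro: outside outside[symmetric]\<close>)
qed

definition rigid :: "'v set \<Rightarrow> ('v \<Rightarrow> 'k::field) set \<Rightarrow> bool"
  where "rigid I V \<longleftrightarrow>
    \<not> (\<exists>d. LND (ring_of_type_algebra :: 'k ring) (coordinate_ring I V) d \<and>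
           (\<exists>f\<in>carrier (coordinate_ring I V). d f \<noteq> \<zero>\<^bsub>coordinate_ring I V\<^esub>))"

text \<open>The variable \<open>T\<^sub>i\<^sub>j\<close> is indexed by the pair \<open>(i, j)\<close>.\<close>

definition trinomial_index :: "(nat \<Rightarrow> nat) \<Rightarrow> (nat \<times> nat) set"
  where "trinomial_index n = (SIGMA i:{0, 1, 2}. {1..n i})"

definition trinomial_hypersurface ::
    "(nat \<Rightarrow> nat) \<Rightarrow> (nat \<Rightarrow> nat \<Rightarrow> nat) \<Rightarrow> (nat \<times> nat \<Rightarrow> 'k::field) set"
  where "trinomial_hypersurface n l =
    {x \<in> affine_space (trinomial_index n).
       (\<Prod>j=1..n 0. x (0, j) ^ l 0 j) + (\<Prod>j=1..n 1. x (1, j) ^ l 1 j)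
         + (\<Prod>j=1..n 2. x (2, j) ^ l 2 j) = 0}"

end

theory Submission
  imports Defs
begin

text \<open>
  An algebra derivation of the coordinate ring is represented by the values \<open>\<delta> v\<close> of a polynomial
  derivation on the variables that preserves the vanishing ideal \<open>J\<close>. Both conditions of the theorem
  give explicit triangular locally nilpotent derivations.

  Conversely, let all exponents be at least 2. Taking leading components with respect to finitely many
  weights of the torus action, one may assume that the derivation is homogeneous. The exponential
  flow sends the time parameter \<open>s\<close> to a polynomial curve on the hypersurface through a general point,
  so the three monomials become polynomials in \<open>s\<close> whose roots are all multiple and whose sum is zero;
  by Mason--Stothers, the minimal exponents \<open>\<mu>\<^sub>i\<close> satisfy \<open>1/\<mu>\<^sub>0 + 1/\<mu>\<^sub>1 + 1/\<mu>\<^sub>2 > 1\<close>.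
  Let \<open>d\<^sub>i\<close> be the gcd of the exponents of the \<open>i\<close>-th monomial. Either two of the pairs
  \<open>(d\<^sub>i, \<mu>\<^sub>i)\<close> are \<open>(2, 2)\<close>, which is the second condition, or one \<open>d\<^sub>k\<close> is coprime to the two others.

  In the latter case put \<open>g = gcd d\<^sub>i d\<^sub>j\<close>, so that the \<open>i\<close>-th and \<open>j\<close>-th monomials are \<open>U\<^sup>g\<close> and \<open>W\<^sup>g\<close>.
  Homogeneous elements are monomials times binary forms in \<open>U, W\<close>, hence products of linear forms.
  This yields a linear form \<open>\<ell>\<close> in the kernel and a second one, \<open>L\<close>, which is the power of a linear
  polynomial along a general orbit. Every linear form proportional to neither has a simple root along
  that orbit, while the \<open>k\<close>-th monomial \<open>-(U\<^sup>g + W\<^sup>g)\<close> has only multiple roots. So each of the \<open>g\<close>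
  linear factors of \<open>U\<^sup>g + W\<^sup>g\<close> is proportional to \<open>\<ell>\<close> or \<open>L\<close>; hence \<open>g \<le> 2\<close>, and the simple roots of
  \<open>U\<close> and \<open>W\<close> force exponents equal to \<open>g\<close> in both of their monomials, which leaves only \<open>g = 2\<close>.
\<close>

text \<open>\<open>K[V]\<close> is a ring of functions, so \<open>J\<close> is a vanishing ideal by
  definition, and neither generators nor primeness come with it. Primeness makes degrees with
  respect to an LND additive and kernels factorially closed; it is obtained from one plane curve
  with a power series point and spread over \<open>V\<close> by the torus. Likewise an explicit
  derivation preserves \<open>J\<close> because its flow moves points inside \<open>V\<close>.
  Mason--Stothers needs three monomials without common root along the orbit. A common root would
  kill one variable in every block. For each such choice a kernel element in the ideal of the three
  variables is produced in advance, and the orbit starts at a point where all these finitely many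
  elements are nonzero; being constant along the orbit, they forbid the common root. The weights see
  exponents only rationally: monomials of equal weight may differ by a fractional combination of the
  three exponent vectors. Coprimality of one gcd with the two others makes this difference integral
  enough to be expressed by powers of \<open>U\<close>, \<open>W\<close> and the third
  monomial.\<close>

hide_const (open) Coset.order

section \<open>Polynomials as finitely supported maps: generators, induction, evaluation\<close>

definition Var :: "'v \<Rightarrow> ('v, 'k::comm_ring_1) mpoly"
  where "Var v = Poly_Mapping.single (Poly_Mapping.single v 1) 1"

definition Cst :: "'k \<Rightarrow> ('v, 'k::comm_ring_1) mpoly"
  where "Cst c = Poly_Mapping.single 0 c"

lemma keys_nat_add: "Poly_Mapping.keys (a + b :: 'v \<Rightarrow>\<^sub>0 nat) = Poly_Mapping.keys a \<union> Poly_Mapping.keys b"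
  by (auto simp: in_keys_iff lookup_add)

text \<open>Multiplication by a single variable replaces general products in the induction step, so
  that for evaluations and derivations only the rule for one generator has to be checked. Staying
  inside \<open>polys_in I\<close> keeps the variables outside \<open>I\<close> away.\<close>

lemma polys_in_induct [consumes 1, case_names Cst add Var]:
  fixes p :: "('v, 'k::comm_ring_1) mpoly"
  assumes p: "p \<in> polys_in I"
    and c: "\<And>c. P (Cst c)"
    and a: "\<And>p q. p \<in> polys_in I \<Longrightarrow> q \<in> polys_in I \<Longrightarrow> P p \<Longrightarrow> P q \<Longrightarrow> P (p + q)"
    and v: "\<And>p v. p \<in> polys_in I \<Longrightarrow> v \<in> I \<Longrightarrow> P p \<Longrightarrow> P (p * Var v)"
  shows "P p"
proof -
  have *: "P (Poly_Mapping.single m c)" if "Poly_Mapping.keys m \<subseteq> I" for m c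
    using that
  proof (induction m rule: poly_mapping_add_single_induct)
    case 1
    show ?case using c by (simp add: Cst_def)
  next
    case (2 m u k)
    from 2(2) show ?case
    proof (induction k)
      case 0
      thus ?case using 2 by simp
    next
      case (Suc k)
      have sub: "Poly_Mapping.keys (m + Poly_Mapping.single u k) \<subseteq> I" "u \<in> I"
        using Suc.prems by (auto simp: keys_nat_add split: if_splits)
      have "Poly_Mapping.single (m + Poly_Mapping.single u (Suc k)) c
          = Poly_Mapping.single (m + Poly_Mapping.single u k) c * Var u"
        by (simp add: Var_def mult_single single_add [symmetric] add.assoc)
      moreover have "Poly_Mapping.single (m + Poly_Mapping.single u k) c \<in> polys_in I"
        using sub by (auto simp: polys_in_def split: if_splits)
      ultimately show ?case using v Suc.IH sub by simp
    qed
  qed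
  have **: "P (\<Sum>m\<in>A. Poly_Mapping.single m (Poly_Mapping.lookup p m)) \<and>
      (\<Sum>m\<in>A. Poly_Mapping.single m (Poly_Mapping.lookup p m)) \<in> polys_in I"
    if "finite A" "\<forall>m\<in>A. Poly_Mapping.keys m \<subseteq> I" for A
    using that
  proof (induction A rule: finite_induct)
    case empty
    show ?case using c[of 0] by (simp add: Cst_def polys_in_def)
  next
    case (insert m A)
    have "Poly_Mapping.single m (Poly_Mapping.lookup p m) \<in> polys_in I"
      using insert.prems by (auto simp: polys_in_def split: if_splits)
    thus ?case using insert a[OF _ _ *] polys_in_add by (auto)
  qed
  have "p = (\<Sum>m\<in>Poly_Mapping.keys p. Poly_Mapping.single m (Poly_Mapping.lookup p m))"
    by (intro poly_mapping_eqI)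
       (auto simp: lookup_sum lookup_single when_def in_keys_iff)
  thus ?thesis using **[of "Poly_Mapping.keys p"] p by (auto simp: polys_in_def)
qed

lemma polys_in_UNIV [simp]: "p \<in> polys_in UNIV"
  by (simp add: polys_in_def)

lemma mpoly_induct [case_names Cst add Var]:
  fixes p :: "('v, 'k::comm_ring_1) mpoly"
  assumes "\<And>c. P (Cst c)" "\<And>p q. P p \<Longrightarrow> P q \<Longrightarrow> P (p + q)" "\<And>p v. P p \<Longrightarrow> P (p * Var v)"
  shows "P p"
  by (rule polys_in_induct[of p UNIV]) (use assms in auto)

lemma polys_in_Cst [simp]: "Cst c \<in> polys_in I"
  by (simp add: Cst_def polys_in_const)

lemma polys_in_Var [simp]: "Var v \<in> polys_in I \<longleftrightarrow> v \<in> I"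
  by (simp add: Var_def polys_in_def)

lemma Cst_0 [simp]: "Cst 0 = 0" and Cst_1 [simp]: "Cst 1 = 1"
  by (simp_all add: Cst_def)

lemma polys_in_0 [simp]: "0 \<in> polys_in I" and polys_in_1 [simp]: "1 \<in> polys_in I"
  by (simp_all add: polys_in_def)

lemma polys_in_uminus [simp]: "(-p :: ('v, 'k::comm_ring_1) mpoly) \<in> polys_in I \<longleftrightarrow> p \<in> polys_in I"
  by (simp add: polys_in_def in_keys_iff)

lemma polys_in_prod: "(\<And>a. a \<in> A \<Longrightarrow> f a \<in> polys_in I) \<Longrightarrow> prod f A \<in> polys_in I"
  by (induction A rule: infinite_finite_induct) (auto intro: polys_in_mult)

lemma polys_in_power: "p \<in> polys_in I \<Longrightarrow> p ^ k \<in> polys_in I"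
  by (induction k) (auto intro: polys_in_mult)

lemma eval_Cst [simp]: "eval_mpoly (Cst c) x = c"
  by (simp add: Cst_def eval_mpoly_single)

lemma eval_Var [simp]: "eval_mpoly (Var v) x = x v"
  by (simp add: Var_def eval_mpoly_single)

lemma eval_one [simp]: "eval_mpoly 1 x = (1 :: 'k::comm_ring_1)"
  using eval_Cst[of 1 x] by simp

lemma eval_uminus [simp]: "eval_mpoly (-p) x = - (eval_mpoly p x :: 'k::comm_ring_1)"
  using eval_mpoly_add[of p "-p" x] by (simp add: eq_neg_iff_add_eq_0 add.commute)

lemma eval_diff [simp]: "eval_mpoly (p - q) x = (eval_mpoly p x - eval_mpoly q x :: 'k::comm_ring_1)"
  using eval_mpoly_add[of p "-q" x] by simp

lemma eval_power [simp]: "eval_mpoly (p ^ k) x = (eval_mpoly p x ^ k :: 'k::comm_ring_1)"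
  by (induction k) auto

lemma eval_sum [simp]: "eval_mpoly (sum f A) x = (\<Sum>a\<in>A. eval_mpoly (f a) x :: 'k::comm_ring_1)"
  by (induction A rule: infinite_finite_induct) auto

lemma eval_prod [simp]: "eval_mpoly (prod f A) x = (\<Prod>a\<in>A. eval_mpoly (f a) x :: 'k::comm_ring_1)"
  by (induction A rule: infinite_finite_induct) auto

text \<open>Power series points serve to test vanishing: the target is an integral domain, so the
  kernel of such an evaluation is a prime ideal.\<close>

definition fps_eval :: "('v \<Rightarrow> 'k fps) \<Rightarrow> ('v, 'k::comm_ring_1) mpoly \<Rightarrow> 'k fps"
  where "fps_eval x p =
    (\<Sum>m\<in>Poly_Mapping.keys p.
       fps_const (Poly_Mapping.lookup p m) * (\<Prod>v\<in>Poly_Mapping.keys m. x v ^ Poly_Mapping.lookup m v))"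

lemma fps_eval_add [simp]: "fps_eval x (p + q) = fps_eval x p + fps_eval x q"
  unfolding fps_eval_def
  by (rule setsum_keys_plus_distrib) (auto simp: algebra_simps simp flip: fps_const_add)

lemma fps_eval_Cst [simp]: "fps_eval x (Cst c) = fps_const c"
  by (simp add: fps_eval_def Cst_def)

lemma fps_eval_single:
  "fps_eval x (Poly_Mapping.single m c) =
     fps_const c * (\<Prod>v\<in>Poly_Mapping.keys m. x v ^ Poly_Mapping.lookup m v)"
  by (simp add: fps_eval_def)

lemma prod_keys_superset:
  assumes "finite A" "Poly_Mapping.keys k \<subseteq> A"
  shows "(\<Prod>v\<in>Poly_Mapping.keys k. x v ^ Poly_Mapping.lookup k v) =
    (\<Prod>v\<in>A. (x v :: 'a::comm_monoid_mult) ^ Poly_Mapping.lookup k v)"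
  using assms by (intro prod.mono_neutral_left) (auto simp: in_keys_iff)

lemma prod_keys_add:
  "(\<Prod>v\<in>Poly_Mapping.keys (m + k). x v ^ Poly_Mapping.lookup (m + k) v) =
    (\<Prod>v\<in>Poly_Mapping.keys m. x v ^ Poly_Mapping.lookup m v) *
    (\<Prod>v\<in>Poly_Mapping.keys k. (x v :: 'a::comm_monoid_mult) ^ Poly_Mapping.lookup k v)"
  by (subst (1 2 3) prod_keys_superset[where A = "Poly_Mapping.keys m \<union> Poly_Mapping.keys k"])
     (simp_all add: keys_nat_add lookup_add power_add prod.distrib)

lemma fps_eval_mult_Var [simp]: "fps_eval x (p * Var v) = fps_eval x p * x v"
proof (induction p rule: poly_mapping_add_single_induct)
  case 1
  show ?case by (simp add: fps_eval_def)
next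
  case (2 p m c)
  have "fps_eval x (Poly_Mapping.single m c * Var v) = fps_eval x (Poly_Mapping.single m c) * x v"
    by (simp add: Var_def mult_single fps_eval_single prod_keys_add mult_ac)
  with 2 show ?case by (simp add: algebra_simps)
qed

lemma fps_eval_Var [simp]: "fps_eval x (Var v) = x v"
  using fps_eval_mult_Var[of x 1 v] fps_eval_Cst[of x 1] by simp

lemma fps_eval_mult [simp]: "fps_eval x (p * q) = fps_eval x p * fps_eval x q"
proof (induction q rule: mpoly_induct)
  case (Cst c)
  show ?case
  proof (induction p rule: mpoly_induct)
    case (Cst d)
    show ?case using fps_eval_Cst[of x "d * c"] by (simp add: Cst_def mult_single del: fps_eval_Cst flip: fps_const_mult)
        (simp add: fps_eval_single)
  next
    case (add p q)
    thus ?case by (simp add: algebra_simps)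
  next
    case (Var p v)
    have "p * Var v * Cst c = (p * Cst c) * Var v" by (simp add: mult_ac)
    hence "fps_eval x (p * Var v * Cst c) = fps_eval x (p * Cst c) * x v" by (simp only: fps_eval_mult_Var)
    thus ?case using Var by (simp add: mult_ac)
  qed
next
  case (add p q)
  thus ?case by (simp add: algebra_simps)
next
  case (Var q v)
  have "p * (q * Var v) = (p * q) * Var v" by (simp add: mult_ac)
  hence "fps_eval x (p * (q * Var v)) = fps_eval x (p * q) * x v" by (simp only: fps_eval_mult_Var)
  thus ?case using Var by (simp add: mult_ac)
qed

section \<open>Derivations of polynomial rings\<close>

text \<open>The truncated subtraction is harmless: the sum runs only over \<open>v\<close> with
  positive exponent in \<open>m\<close>.\<close>

definition dmon :: "('v \<Rightarrow> ('v, 'k::comm_ring_1) mpoly) \<Rightarrow> ('v \<Rightarrow>\<^sub>0 nat) \<Rightarrow> ('v, 'k) mpoly"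
  where "dmon \<delta> m = (\<Sum>v\<in>Poly_Mapping.keys m.
    Poly_Mapping.single (m - Poly_Mapping.single v 1) (of_nat (Poly_Mapping.lookup m v)) * \<delta> v)"

definition mder :: "('v \<Rightarrow> ('v, 'k::comm_ring_1) mpoly) \<Rightarrow> ('v, 'k) mpoly \<Rightarrow> ('v, 'k) mpoly"
  where "mder \<delta> p = (\<Sum>m\<in>Poly_Mapping.keys p. Cst (Poly_Mapping.lookup p m) * dmon \<delta> m)"

lemma mder_add [simp]: "mder \<delta> (p + q) = mder \<delta> p + mder \<delta> q"
  unfolding mder_def
  by (rule setsum_keys_plus_distrib) (auto simp: Cst_def single_add algebra_simps)

lemma mder_single: "mder \<delta> (Poly_Mapping.single m c) = Cst c * dmon \<delta> m"
  by (simp add: mder_def)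

lemma mder_Cst [simp]: "mder \<delta> (Cst c) = 0"
  by (simp add: Cst_def mder_single dmon_def)

lemma dmon_single [simp]: "dmon \<delta> (Poly_Mapping.single v (Suc 0)) = \<delta> v"
proof -
  have "Poly_Mapping.single v (Suc 0) - Poly_Mapping.single v (Suc 0) = (0 :: 'a \<Rightarrow>\<^sub>0 nat)"
    by (intro poly_mapping_eqI) (simp add: lookup_minus)
  thus ?thesis unfolding dmon_def by simp
qed

lemma mder_Var [simp]: "mder \<delta> (Var v) = \<delta> v"
  by (simp add: Var_def mder_single)

lemma dmon_superset:
  assumes "finite A" "Poly_Mapping.keys m \<subseteq> A"
  shows "dmon \<delta> m = (\<Sum>v\<in>A.
    Poly_Mapping.single (m - Poly_Mapping.single v 1) (of_nat (Poly_Mapping.lookup m v)) * \<delta> v)"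
  unfolding dmon_def using assms
  by (intro sum.mono_neutral_left) (auto simp: in_keys_iff)

lemma dmon_add:
  "dmon \<delta> (m + k) = dmon \<delta> m * Poly_Mapping.single k 1 + Poly_Mapping.single m 1 * dmon \<delta> k"
proof -
  let ?A = "Poly_Mapping.keys m \<union> Poly_Mapping.keys k"
  \<comment> \<open>If the exponent of \<open>v\<close> in \<open>a\<close> is zero, truncation may
    falsify the identity of exponents, but then both coefficients vanish.\<close>
  have *: "Poly_Mapping.single (a + b - Poly_Mapping.single v 1) (of_nat (Poly_Mapping.lookup a v) :: 'b)
      = Poly_Mapping.single (a - Poly_Mapping.single v 1) (of_nat (Poly_Mapping.lookup a v)) * Poly_Mapping.single b 1"
    for a b :: "'a \<Rightarrow>\<^sub>0 nat" and v
  proof (cases "Poly_Mapping.lookup a v = 0")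
    case False
    hence "a + b - Poly_Mapping.single v 1 = (a - Poly_Mapping.single v 1) + b"
      by (intro poly_mapping_eqI) (auto simp: lookup_add lookup_minus lookup_single when_def)
    thus ?thesis by (simp add: mult_single)
  qed simp
  have "dmon \<delta> (m + k) = (\<Sum>v\<in>?A.
      Poly_Mapping.single (m + k - Poly_Mapping.single v 1) (of_nat (Poly_Mapping.lookup m v)) * \<delta> v +
      Poly_Mapping.single (k + m - Poly_Mapping.single v 1) (of_nat (Poly_Mapping.lookup k v)) * \<delta> v)"
    by (subst dmon_superset[of ?A])
       (auto simp: keys_nat_add lookup_add single_add algebra_simps)
  also have "\<dots> = dmon \<delta> m * Poly_Mapping.single k 1 + Poly_Mapping.single m 1 * dmon \<delta> k"
    unfolding * by (subst (1 2) dmon_superset[of ?A])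
      (auto simp: sum.distrib sum_distrib_left sum_distrib_right mult_ac)
  finally show ?thesis .
qed

lemma single_eq_Cst_mult: "Poly_Mapping.single m c = Cst c * Poly_Mapping.single m 1"
  by (simp add: Cst_def mult_single)

lemma mder_mult [simp]: "mder \<delta> (p * q) = mder \<delta> p * q + p * mder \<delta> q"
proof (induction p rule: poly_mapping_add_single_induct)
  case 1
  show ?case by (simp add: mder_def)
next
  case (2 p m c)
  have "mder \<delta> (Poly_Mapping.single m c * q)
      = mder \<delta> (Poly_Mapping.single m c) * q + Poly_Mapping.single m c * mder \<delta> q"
  proof (induction q rule: poly_mapping_add_single_induct)
    case 1
    show ?case by (simp add: mder_def)
  next
    case (2 q k d)
    have "mder \<delta> (Poly_Mapping.single m c * Poly_Mapping.single k d)
        = Cst (c * d) * (dmon \<delta> m * Poly_Mapping.single k 1 + Poly_Mapping.single m 1 * dmon \<delta> k)"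
      by (simp add: mult_single mder_single dmon_add)
    also have "Cst (c * d) = (Cst c * Cst d :: ('a, 'b) mpoly)"
      by (simp add: Cst_def mult_single)
    also have "\<dots> * (dmon \<delta> m * Poly_Mapping.single k 1 + Poly_Mapping.single m 1 * dmon \<delta> k)
        = (Cst c * dmon \<delta> m) * (Cst d * Poly_Mapping.single k 1)
          + (Cst c * Poly_Mapping.single m 1) * (Cst d * dmon \<delta> k)"
      by (simp add: algebra_simps)
    also have "\<dots> = mder \<delta> (Poly_Mapping.single m c) * Poly_Mapping.single k d
          + Poly_Mapping.single m c * mder \<delta> (Poly_Mapping.single k d)"
      by (simp add: mder_single flip: single_eq_Cst_mult)
    finally show ?case using 2 by (simp add: algebra_simps)
  qed
  with 2 show ?case by (simp add: algebra_simps)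
qed

lemma mder_0 [simp]: "mder \<delta> 0 = 0" and mder_1 [simp]: "mder \<delta> 1 = 0"
  using mder_Cst[of \<delta> 0] mder_Cst[of \<delta> 1] by simp_all

lemma mder_uminus [simp]: "mder \<delta> (-p) = - mder \<delta> p"
  using mder_add[of \<delta> p "-p"] by (simp add: eq_neg_iff_add_eq_0 add.commute)

lemma mder_diff [simp]: "mder \<delta> (p - q) = mder \<delta> p - mder \<delta> q"
  using mder_add[of \<delta> p "-q"] by simp

lemma mder_sum: "mder \<delta> (sum f A) = (\<Sum>a\<in>A. mder \<delta> (f a))"
  by (induction A rule: infinite_finite_induct) auto

lemma mder_power_Suc: "mder \<delta> (p ^ Suc k) = of_nat (Suc k) * p ^ k * mder \<delta> p"
  by (induction k) (auto simp: algebra_simps)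

lemma mder_polys_in:
  assumes "p \<in> polys_in I" "\<And>v. v \<in> I \<Longrightarrow> \<delta> v \<in> polys_in I"
  shows "mder \<delta> p \<in> polys_in I"
  using assms(1) by (induction rule: polys_in_induct) (auto intro!: polys_in_add polys_in_mult assms(2))

lemma funpow_mder_add: "(mder \<delta> ^^ n) (p + q) = (mder \<delta> ^^ n) p + (mder \<delta> ^^ n) q"
  by (induction n) auto

lemma funpow_mder_diff: "(mder \<delta> ^^ n) (p - q) = (mder \<delta> ^^ n) p - (mder \<delta> ^^ n) q"
  by (induction n) auto

lemma funpow_mder_Cst_mult: "(mder \<delta> ^^ n) (Cst c * p) = Cst c * (mder \<delta> ^^ n) p"
  by (induction n) auto

lemma funpow_mder_0 [simp]: "(mder \<delta> ^^ n) 0 = 0"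
  by (induction n) auto

lemma mder_Leibniz:
  "(mder \<delta> ^^ n) (p * q) = (\<Sum>i\<le>n. of_nat (n choose i) * ((mder \<delta> ^^ i) p * (mder \<delta> ^^ (n - i)) q))"
proof (induction n)
  case (Suc n)
  let ?D = "mder \<delta>"
  have nat: "mder \<delta> (of_nat k * r) = of_nat k * mder \<delta> r" for k :: nat and r
    by (induction k) (auto simp: algebra_simps)
  have nat0: "mder \<delta> (of_nat k) = 0" for k :: nat
    by (induction k) auto
  have "(?D ^^ Suc n) (p * q) = (\<Sum>i\<le>n. of_nat (n choose i) * ((?D ^^ Suc i) p * (?D ^^ (n - i)) q))
      + (\<Sum>i\<le>n. of_nat (n choose i) * ((?D ^^ i) p * (?D ^^ (Suc n - i)) q))"
    using Suc by (simp add: mder_sum nat nat0 Suc_diff_le ring_distribs sum.distrib)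
  also have "(\<Sum>i\<le>n. of_nat (n choose i) * ((?D ^^ Suc i) p * (?D ^^ (n - i)) q))
     = (\<Sum>i\<in>{1..Suc n}. of_nat (n choose (i - 1)) * ((?D ^^ i) p * (?D ^^ (Suc n - i)) q))"
    by (rule sum.reindex_bij_witness[of _ "\<lambda>i. i - 1" Suc]) auto
  also have "\<dots> = (\<Sum>i\<le>Suc n. of_nat (if i = 0 then 0 else n choose (i - 1)) * ((?D ^^ i) p * (?D ^^ (Suc n - i)) q))"
    by (rule sum.mono_neutral_cong_left) auto
  also have "(\<Sum>i\<le>n. of_nat (n choose i) * ((?D ^^ i) p * (?D ^^ (Suc n - i)) q))
     = (\<Sum>i\<le>Suc n. of_nat (n choose i) * ((?D ^^ i) p * (?D ^^ (Suc n - i)) q))"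
    by (rule sum.mono_neutral_cong_left) (auto simp: le_Suc_eq binomial_eq_0)
  also have "(\<Sum>i\<le>Suc n. of_nat (if i = 0 then 0 else n choose (i - 1)) * ((?D ^^ i) p * (?D ^^ (Suc n - i)) q)) + \<dots>
     = (\<Sum>i\<le>Suc n. of_nat (Suc n choose i) * ((?D ^^ i) p * (?D ^^ (Suc n - i)) q))"
    unfolding sum.distrib [symmetric] ring_distribs(2) [symmetric] of_nat_add [symmetric]
    by (rule sum.cong) (auto simp: choose_reduce_nat)
  finally show ?case .
qed simp

section \<open>Root multiplicities of one-variable polynomials\<close>

lemma alg_closed_dvdI:
  fixes p q :: "'k::alg_closed_field poly"
  assumes "p \<noteq> 0" "q \<noteq> 0" "\<And>a. order a p \<le> order a q"
  shows "p dvd q"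
  using assms
proof (induction "degree p" arbitrary: p q)
  case 0
  thus ?case by (simp add: is_unit_iff_degree dvd_trans[of p 1 q])
next
  case (Suc d)
  then obtain a where a: "poly p a = 0"
    using alg_closed_imp_poly_has_root[of p] by auto
  hence "order a q \<noteq> 0" using Suc.prems order_root[of p a] by (metis le_zero_eq)
  hence "poly q a = 0" by (simp add: order_root)
  with a obtain p' q' where pq: "p = [:-a,1:] * p'" "q = [:-a,1:] * q'"
    by (auto simp: poly_eq_0_iff_dvd dvd_def)
  have nz: "p' \<noteq> 0" "q' \<noteq> 0" using Suc.prems pq by auto
  have ord: "order b p' \<le> order b q'" for b
    using Suc.prems(3)[of b] Suc.prems(1,2) unfolding pq by (subst (asm) (1 2) order_mult) auto
  have "degree p = Suc (degree p')"
    unfolding pq using nz by (subst degree_mult_eq) auto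
  with Suc nz ord have "p' dvd q'" by auto
  thus ?case unfolding pq by (intro mult_dvd_mono) auto
qed

text \<open>In characteristic zero \<open>z ^ b = \<kappa>\<close> has \<open>b\<close> distinct
  solutions, since the derivative of \<open>z ^ b - \<kappa>\<close> vanishes at most at 0. The
  bound serves twice: for polynomials in \<open>z\<close> over a general point of a curve, and for
  the polynomial in \<open>\<zeta>\<close> that bounds \<open>g\<close>.\<close>

lemma root_power_roots:
  fixes \<kappa> :: "'k::{alg_closed_field, field_char_0}"
  assumes "q \<noteq> 0" "b > 0" "\<kappa> \<noteq> 0" "\<And>z. z ^ b = \<kappa> \<Longrightarrow> poly q z = 0"
  shows "degree q \<ge> b"
proof -
  let ?p = "monom 1 b - [:\<kappa>:]"
  have nz: "?p \<noteq> 0"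
  proof
    assume "?p = 0"
    hence "coeff ?p b = coeff 0 b" by simp
    thus False using \<open>b > 0\<close> by (simp add: coeff_pCons split: nat.splits)
  qed
  have "order a ?p \<le> order a q" for a
  proof (cases "a ^ b = \<kappa>")
    case True
    hence "poly (pderiv ?p) a \<noteq> 0"
      using \<open>b > 0\<close> \<open>\<kappa> \<noteq> 0\<close> by (auto simp: pderiv_diff pderiv_monom poly_monom pderiv_pCons)
    hence "pderiv ?p \<noteq> 0" "order a (pderiv ?p) = 0" by (auto simp: order_0I)
    moreover have "poly ?p a = 0" using True by (simp add: poly_monom)
    hence "order a ?p \<noteq> 0" using nz order_root by blast
    ultimately have "order a ?p = 1" using order_pderiv[of ?p a] nz True by (simp add: poly_monom)
    moreover have "order a q \<noteq> 0" using assms(4)[OF True] assms(1) by (auto simp: order_root)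
    ultimately show ?thesis by linarith
  next
    case False
    hence "order a ?p = 0" by (intro order_0I) (simp add: poly_monom)
    thus ?thesis by simp
  qed
  hence "?p dvd q" using nz assms(1) by (intro alg_closed_dvdI)
  hence "degree ?p \<le> degree q" using assms(1) by (rule dvd_imp_degree_le)
  moreover have "degree ?p = b"
  proof -
    have "degree (monom 1 b + [:-\<kappa>:]) = degree (monom (1::'k) b)"
      using assms(2) by (intro degree_add_eq_left) (simp add: degree_monom_eq)
    moreover have "?p = monom 1 b + [:-\<kappa>:]" by (metis diff_conv_add_uminus minus_pCons neg_equal_0_iff_equal)
    ultimately show ?thesis by (metis degree_monom_eq one_neq_zero)
  qed
  ultimately show ?thesis by simp
qed

section \<open>Curves z^b = h(y) and a power series point on them\<close>

definition fpoly :: "'k::comm_ring_1 poly \<Rightarrow> 'k fps \<Rightarrow> 'k fps"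
  where "fpoly c Y = poly (map_poly fps_const c) Y"

lemma fpoly_0 [simp]: "fpoly 0 Y = 0"
  by (simp add: fpoly_def)

lemma fpoly_pCons [simp]: "fpoly (pCons a c) Y = fps_const a + Y * fpoly c Y"
  by (simp add: fpoly_def map_poly_pCons)

lemma fpoly_add [simp]: "fpoly (c + d) Y = fpoly c Y + fpoly d Y"
  by (induction c d rule: poly_induct2) (auto simp: algebra_simps simp flip: fps_const_add)

lemma fpoly_smult [simp]: "fpoly (smult a c) Y = fps_const a * fpoly c Y"
  by (induction c) (auto simp: algebra_simps simp flip: fps_const_mult)

lemma fpoly_mult [simp]: "fpoly (c * d) Y = fpoly c Y * fpoly d Y"
  by (induction c) (auto simp: algebra_simps)

text \<open>Multiplication by \<open>z\<close> on the basis \<open>1, z, ..., z^(b-1)\<close>: the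
  top coefficient wraps around to index 0 with the factor \<open>h\<close>.\<close>

lemma shift_sum:
  fixes z :: "'s::comm_ring_1"
  assumes "z ^ b = h" "b > 0"
  shows "(\<Sum>i<b. c i * z ^ i) * z = (\<Sum>i<b. (if i = 0 then h * c (b - 1) else c (i - 1)) * z ^ i)"
proof -
  obtain b' where b: "b = Suc b'" using assms(2) by (cases b) auto
  have "(\<Sum>i<b. c i * z ^ i) * z = (\<Sum>i<b'. c i * z ^ Suc i) + c b' * z ^ b"
    by (simp add: b sum_distrib_right sum_distrib_left algebra_simps)
  also have "\<dots> = (\<Sum>i<b. (if i = 0 then h * c (b - 1) else c (i - 1)) * z ^ i)"
    unfolding b by (subst sum.lessThan_Suc_shift) (simp add: assms(1)[unfolded b] algebra_simps del: power_Suc)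
  finally show ?thesis .
qed

text \<open>On the curve \<open>z\<^sup>b = h(y)\<close> every polynomial reduces to one of degree less than \<open>b\<close> in \<open>z\<close>; the
  same reduction is valid for power series solutions.\<close>

lemma curve_normal_form:
  fixes p :: "('v, 'k::field) mpoly" and h :: "'k poly" and A A' :: "'v \<Rightarrow> 'k poly"
  assumes "b > 0"
  obtains c where
    "\<And>y z. z ^ b = poly h y \<Longrightarrow>
       eval_mpoly p (\<lambda>v. poly (A v) y + poly (A' v) y * z) = (\<Sum>i<b. poly (c i) y * z ^ i)"
    "\<And>Y Z. Z ^ b = fpoly h Y \<Longrightarrow>
       fps_eval (\<lambda>v. fpoly (A v) Y + fpoly (A' v) Y * Z) p = (\<Sum>i<b. fpoly (c i) Y * Z ^ i)"
proof -
  let ?x = "\<lambda>y z v. poly (A v) y + poly (A' v) y * z"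
  let ?X = "\<lambda>Y Z v. fpoly (A v) Y + fpoly (A' v) Y * Z"
  have "\<exists>c. (\<forall>y z. z ^ b = poly h y \<longrightarrow> eval_mpoly p (?x y z) = (\<Sum>i<b. poly (c i) y * z ^ i)) \<and>
      (\<forall>Y Z. Z ^ b = fpoly h Y \<longrightarrow> fps_eval (?X Y Z) p = (\<Sum>i<b. fpoly (c i) Y * Z ^ i))"
  proof (induction p rule: mpoly_induct)
    case (Cst a)
    have sum: "(\<Sum>i<b. (if i = 0 then d else 0) * z ^ i) = d" for d z :: "'s::comm_ring_1"
    proof -
      have "(\<Sum>i<b. (if i = 0 then d else 0) * z ^ i) = (\<Sum>i\<in>{0}. (if i = 0 then d else 0) * z ^ i)"
        using assms by (intro sum.mono_neutral_right) auto
      thus ?thesis by simp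
    qed
    show ?case
      by (rule exI[of _ "\<lambda>i. if i = 0 then [:a:] else 0"])
         (auto simp: if_distrib[of "\<lambda>p. poly p _"] if_distrib[of "\<lambda>p. fpoly p _"] sum cong: if_cong)
  next
    case (add p q)
    then obtain c d where
      "\<forall>y z. z ^ b = poly h y \<longrightarrow> eval_mpoly p (?x y z) = (\<Sum>i<b. poly (c i) y * z ^ i)"
      "\<forall>Y Z. Z ^ b = fpoly h Y \<longrightarrow> fps_eval (?X Y Z) p = (\<Sum>i<b. fpoly (c i) Y * Z ^ i)"
      "\<forall>y z. z ^ b = poly h y \<longrightarrow> eval_mpoly q (?x y z) = (\<Sum>i<b. poly (d i) y * z ^ i)"
      "\<forall>Y Z. Z ^ b = fpoly h Y \<longrightarrow> fps_eval (?X Y Z) q = (\<Sum>i<b. fpoly (d i) Y * Z ^ i)"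
      by blast
    thus ?case
      by (intro exI[of _ "\<lambda>i. c i + d i"]) (auto simp: algebra_simps sum.distrib)
  next
    case (Var p v)
    then obtain c where c:
      "\<And>y z. z ^ b = poly h y \<Longrightarrow> eval_mpoly p (?x y z) = (\<Sum>i<b. poly (c i) y * z ^ i)"
      "\<And>Y Z. Z ^ b = fpoly h Y \<Longrightarrow> fps_eval (?X Y Z) p = (\<Sum>i<b. fpoly (c i) Y * Z ^ i)"
      by blast
    define c' where "c' i = A v * c i + A' v * (if i = 0 then h * c (b - 1) else c (i - 1))" for i
    have "eval_mpoly (p * Var v) (?x y z) = (\<Sum>i<b. poly (c' i) y * z ^ i)" if "z ^ b = poly h y" for y z
    proof -
      have "eval_mpoly (p * Var v) (?x y z) = poly (A v) y * (\<Sum>i<b. poly (c i) y * z ^ i)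
          + poly (A' v) y * ((\<Sum>i<b. poly (c i) y * z ^ i) * z)"
        using c(1)[OF that] by (simp add: algebra_simps)
      also have "\<dots> = (\<Sum>i<b. poly (c' i) y * z ^ i)"
        unfolding shift_sum[OF that assms]
        by (simp add: sum_distrib_left sum.distrib[symmetric] c'_def algebra_simps if_distrib[of "\<lambda>p. poly p _"] cong: if_cong)
      finally show ?thesis .
    qed
    moreover have "fps_eval (?X Y Z) (p * Var v) = (\<Sum>i<b. fpoly (c' i) Y * Z ^ i)"
      if "Z ^ b = fpoly h Y" for Y Z
    proof -
      have "fps_eval (?X Y Z) (p * Var v) = fpoly (A v) Y * (\<Sum>i<b. fpoly (c i) Y * Z ^ i)
          + fpoly (A' v) Y * ((\<Sum>i<b. fpoly (c i) Y * Z ^ i) * Z)"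
        using c(2)[OF that] by (simp add: algebra_simps)
      also have "\<dots> = (\<Sum>i<b. fpoly (c' i) Y * Z ^ i)"
        unfolding shift_sum[OF that assms]
        by (simp add: sum_distrib_left sum.distrib[symmetric] c'_def algebra_simps if_distrib[of "\<lambda>p. fpoly p _"] cong: if_cong)
      finally show ?thesis .
    qed
    ultimately show ?case by blast
  qed
  thus thesis using that by blast
qed

text \<open>Over a general \<open>y\<close> there are \<open>b\<close> distinct values of
  \<open>z\<close>, too many roots for a nonzero polynomial of degree below \<open>b\<close>. The
  finite set \<open>F\<close> allows the vanishing to be known only over general
  \<open>y\<close>.\<close>

lemma curve_vanishing:
  fixes h :: "'k::{alg_closed_field, field_char_0} poly"
  assumes "b > 0" "h \<noteq> 0" "finite F"
    and zero: "\<And>y z. y \<notin> F \<Longrightarrow> poly h y \<noteq> 0 \<Longrightarrow> z ^ b = poly h y \<Longrightarrow> (\<Sum>i<b. poly (c i) y * z ^ i) = 0"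
    and "i < b"
  shows "c i = 0"
proof (rule ccontr)
  assume nz: "c i \<noteq> 0"
  have "finite (F \<union> {y. poly h y = 0} \<union> {y. poly (c i) y = 0})"
    using assms nz poly_roots_finite by auto
  from ex_new_if_finite[OF infinite_UNIV_char_0 this]
  obtain y where y: "y \<notin> F" "poly h y \<noteq> 0" "poly (c i) y \<noteq> 0" by auto
  define q where "q = (\<Sum>j<b. monom (poly (c j) y) j)"
  have "coeff q i = poly (c i) y"
    using \<open>i < b\<close> by (simp add: q_def coeff_sum)
  hence "q \<noteq> 0" using y by auto
  moreover have "poly q z = 0" if "z ^ b = poly h y" for z
    using zero[OF y(1,2) that] by (simp add: q_def poly_sum poly_monom)
  ultimately have "degree q \<ge> b"
    using root_power_roots y assms by blast
  moreover have "degree q < b"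
    unfolding q_def using assms(1)
    by (intro degree_sum_less) (auto intro: le_less_trans[OF degree_monom_le])
  ultimately show False by simp
qed

text \<open>A nonconstant power series is transcendental over an algebraically closed field: the
  polynomial splits, and no linear factor vanishes at \<open>Y\<close>.\<close>

lemma fpoly_nonzero:
  fixes c :: "'k::alg_closed_field poly"
  assumes "c \<noteq> 0" "\<And>r. Y \<noteq> fps_const r"
  shows "fpoly c Y \<noteq> 0"
  using assms(1)
proof (induction "degree c" arbitrary: c)
  case 0
  then obtain a where "c = [:a:]" by (metis degree_eq_zeroE)
  thus ?case using 0 by auto
next
  case (Suc d)
  then obtain a where a: "poly c a = 0"
    using alg_closed_imp_poly_has_root[of c] by auto
  then obtain c' where c: "c = [:-a,1:] * c'"
    by (auto simp: poly_eq_0_iff_dvd dvd_def)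
  have nz: "c' \<noteq> 0" using Suc.prems c by auto
  have "degree c = Suc (degree c')"
    unfolding c using nz by (subst degree_mult_eq) auto
  hence "fpoly c' Y \<noteq> 0" using Suc nz by auto
  moreover have "fpoly [:-a,1:] Y \<noteq> 0"
    using assms(2)[of a] by (simp add: eq_neg_iff_add_eq_0 flip: fps_const_neg)
  ultimately show ?case unfolding c fpoly_mult by simp
qed

lemma fpoly_supported:
  assumes "\<And>n. \<not> b dvd n \<Longrightarrow> fps_nth Y n = 0" "\<not> b dvd n"
  shows "fps_nth (fpoly c Y) n = 0"
  using assms(2)
proof (induction c arbitrary: n)
  case (pCons a c)
  have "fps_nth (Y * fpoly c Y) n = 0"
    unfolding fps_mult_nth
  proof (intro sum.neutral ballI)
    fix i assume "i \<in> {0..n}"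
    show "fps_nth Y i * fps_nth (fpoly c Y) (n - i) = 0"
    proof (cases "b dvd i")
      case True
      hence "\<not> b dvd n - i" using pCons.prems \<open>i \<in> {0..n}\<close>
        by (metis atLeastAtMost_iff dvd_diffD)
      thus ?thesis using pCons.IH by simp
    qed (use assms in auto)
  qed
  moreover have "n \<noteq> 0" using pCons.prems by (metis dvd_0_right)
  ultimately show ?case by simp
qed simp

text \<open>The curve \<open>1 + y^a + z^b = 0\<close> is parametrised near
  \<open>(\<eta>, 0)\<close> by \<open>z = X\<close> and \<open>y = \<eta> (1 + X^b)^(1/a)\<close>.
  All exponents of \<open>Y\<close> are multiples of \<open>b\<close>, so the terms
  \<open>c i (Y) X^i\<close> live in distinct residue classes modulo \<open>b\<close> and cannot
  cancel.\<close>

lemma curve_power_series: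
  fixes a b :: nat
  assumes "a > 0" "b > 0"
  obtains Y :: "'k::{alg_closed_field, field_char_0} fps"
    where "fps_X ^ b = fpoly (- (1 + monom 1 a)) Y"
      "\<And>c. (\<Sum>i<b. fpoly (c i) Y * fps_X ^ i) = 0 \<Longrightarrow> \<forall>i<b. c i = 0"
proof -
  obtain \<eta> :: 'k where \<eta>: "\<eta> ^ a = -1" using nth_root_exists[OF assms(1)] by blast
  hence \<eta>0: "\<eta> \<noteq> 0" using assms(1) by (auto simp: power_0_left)
  define Y where "Y = fps_const \<eta> * (fps_binomial (1 / of_nat a) oo fps_X ^ b)"
  have "(fps_binomial (1 / of_nat a) oo fps_X ^ b) ^ a = (fps_binomial (1 / of_nat a) ^ a oo fps_X ^ b :: 'k fps)"
    using assms(2) by (intro fps_compose_power) simp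
  also have "\<dots> = (1 + fps_X) oo fps_X ^ b"
    using assms(1) by (simp add: fps_binomial_power fps_binomial_1)
  also have "\<dots> = 1 + fps_X ^ b"
    using assms(2) by (simp add: fps_compose_add_distrib)
  finally have Ya: "Y ^ a = - (1 + fps_X ^ b)"
    by (simp add: Y_def power_mult_distrib \<eta> fps_const_power flip: fps_const_neg)
  have fm: "fpoly (monom 1 k) Y = Y ^ k" for k
    by (induction k) (simp_all add: monom_Suc monom_0)
  have "fpoly (- (1 + monom 1 a)) Y = fpoly (smult (-1) (1 + monom 1 a)) Y"
    by simp
  also have "\<dots> = - (1 + Y ^ a)"
    unfolding fpoly_smult fpoly_add fm by (simp add: one_pCons flip: fps_const_neg)
  finally have 1: "fps_X ^ b = fpoly (- (1 + monom 1 a)) Y" by (simp add: Ya)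
  have Ysup: "fps_nth Y k = 0" if "\<not> b dvd k" for k
    using that by (simp add: Y_def fps_nth_compose_X_power)
  have "fps_nth Y b = \<eta> / of_nat a"
    using assms by (simp add: Y_def fps_nth_compose_X_power)
  hence Yc: "Y \<noteq> fps_const r" for r using \<eta>0 assms by auto
  have 2: "\<forall>i<b. c i = 0" if "(\<Sum>i<b. fpoly (c i) Y * fps_X ^ i) = 0" for c
  proof (rule ccontr)
    assume "\<not> (\<forall>i<b. c i = 0)"
    then obtain i where i: "i < b" "c i \<noteq> 0" by auto
    from fpoly_nonzero[OF i(2) Yc] obtain k where k: "fps_nth (fpoly (c i) Y) k \<noteq> 0"
      by (auto simp: fps_eq_iff)
    hence bk: "b dvd k" using fpoly_supported Ysup by blast
    \<comment> \<open>The coefficient at \<open>k + i\<close> isolates the summand \<open>i\<close>;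
      the other summands have exponents in other residue classes.\<close>
    have "0 = fps_nth (\<Sum>j<b. fpoly (c j) Y * fps_X ^ j) (k + i)" using that by simp
    also have "\<dots> = (\<Sum>j<b. if k + i < j then 0 else fps_nth (fpoly (c j) Y) (k + i - j))"
      by (simp add: fps_sum_nth fps_X_power_mult_right_nth)
    also have "\<dots> = (\<Sum>j\<in>{i}. if k + i < j then 0 else fps_nth (fpoly (c j) Y) (k + i - j))"
    proof (intro sum.mono_neutral_right ballI)
      fix j assume j: "j \<in> {..<b} - {i}"
      show "(if k + i < j then 0 else fps_nth (fpoly (c j) Y) (k + i - j)) = 0"
      proof (cases "k + i < j")
        case False
        have "\<not> b dvd (k + i - j)"
        proof
          assume "b dvd (k + i - j)"
          hence "int b dvd int (k + i - j)" by simp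
          hence "int b dvd int k + int i - int j" using False by (simp add: of_nat_diff)
          hence "int b dvd int i - int j" using bk
            by (metis add_diff_eq dvd_add_right_iff int_dvd_int_iff)
          moreover have "\<bar>int i - int j\<bar> < int b" "int i - int j \<noteq> 0" using i j by auto
          ultimately show False using zdvd_not_zless[of "\<bar>int i - int j\<bar>" "int b"] by auto
        qed
        thus ?thesis using fpoly_supported Ysup by auto
      qed simp
    qed (use i in auto)
    also have "\<dots> = fps_nth (fpoly (c i) Y) k" by simp
    finally show False using k by simp
  qed
  show thesis by (rule that[OF 1 2])
qed

section \<open>Weights, weight components and torus scaling\<close>

definition wt :: "('v \<Rightarrow> int) \<Rightarrow> ('v \<Rightarrow>\<^sub>0 nat) \<Rightarrow> int"
  where "wt w m = (\<Sum>v\<in>Poly_Mapping.keys m. int (Poly_Mapping.lookup m v) * w v)"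

definition wcomp :: "('v \<Rightarrow> int) \<Rightarrow> int \<Rightarrow> ('v, 'k::comm_ring_1) mpoly \<Rightarrow> ('v, 'k) mpoly"
  where "wcomp w u p =
    (\<Sum>m\<in>{m\<in>Poly_Mapping.keys p. wt w m = u}. Poly_Mapping.single m (Poly_Mapping.lookup p m))"

definition wscale :: "('v \<Rightarrow> int) \<Rightarrow> 'k::field \<Rightarrow> ('v \<Rightarrow> 'k) \<Rightarrow> 'v \<Rightarrow> 'k"
  where "wscale w c x = (\<lambda>v. c powi w v * x v)"

lemma wt_superset:
  assumes "finite A" "Poly_Mapping.keys m \<subseteq> A"
  shows "wt w m = (\<Sum>v\<in>A. int (Poly_Mapping.lookup m v) * w v)"
  unfolding wt_def using assms by (intro sum.mono_neutral_left) (auto simp: in_keys_iff)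

lemma wt_add [simp]: "wt w (m + k) = wt w m + wt w k"
  by (subst (1 2 3) wt_superset[where A = "Poly_Mapping.keys m \<union> Poly_Mapping.keys k"])
     (auto simp: keys_nat_add lookup_add algebra_simps sum.distrib)

lemma wt_0 [simp]: "wt w 0 = 0"
  by (simp add: wt_def)

lemma wt_single [simp]: "wt w (Poly_Mapping.single v k) = int k * w v"
  by (simp add: wt_def)

lemma poly_mapping_sum_single: "p = (\<Sum>m\<in>Poly_Mapping.keys p. Poly_Mapping.single m (Poly_Mapping.lookup p m))"
  by (intro poly_mapping_eqI) (auto simp: lookup_sum lookup_single when_def in_keys_iff)

lemma wcomp_sum: "(\<Sum>u\<in>wt w ` Poly_Mapping.keys p. wcomp w u p) = p"
proof -
  have "(\<Sum>u\<in>wt w ` Poly_Mapping.keys p. wcomp w u p)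
      = (\<Sum>m\<in>Poly_Mapping.keys p. Poly_Mapping.single m (Poly_Mapping.lookup p m))"
    unfolding wcomp_def by (rule sum.image_gen[symmetric]) simp
  thus ?thesis using poly_mapping_sum_single[of p] by simp
qed

lemma lookup_wcomp:
  "Poly_Mapping.lookup (wcomp w u p) m = (if wt w m = u then Poly_Mapping.lookup p m else 0)"
proof -
  have "Poly_Mapping.lookup (wcomp w u p) m =
    (\<Sum>k\<in>{k\<in>Poly_Mapping.keys p. wt w k = u}. if k = m then Poly_Mapping.lookup p k else 0)"
    by (simp add: wcomp_def lookup_sum lookup_single when_def)
  thus ?thesis by (auto simp: in_keys_iff)
qed

lemma keys_wcomp: "Poly_Mapping.keys (wcomp w u p) = {m\<in>Poly_Mapping.keys p. wt w m = u}"
  by (auto simp: in_keys_iff lookup_wcomp split: if_splits)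

lemma eval_wscale_mono:
  assumes "c \<noteq> 0"
  shows "eval_mpoly (Poly_Mapping.single m a) (wscale w c x)
    = c powi wt w m * eval_mpoly (Poly_Mapping.single m a) x"
proof -
  have "(\<Prod>v\<in>A. (c powi w v) ^ k v) = c powi (\<Sum>v\<in>A. int (k v) * w v)" for A k
    by (induction A rule: infinite_finite_induct)
       (use assms in \<open>auto simp: power_int_add power_int_mult mult.commute[of "int _"]\<close>)
  thus ?thesis
    by (simp add: eval_mpoly_single wscale_def wt_def power_mult_distrib prod.distrib mult_ac)
qed

lemma eval_wscale:
  assumes "c \<noteq> 0"
  shows "eval_mpoly p (wscale w c x) =
    (\<Sum>u\<in>wt w ` Poly_Mapping.keys p. c powi u * eval_mpoly (wcomp w u p) x)"
proof -
  have "eval_mpoly (wcomp w u p) (wscale w c x) = c powi u * eval_mpoly (wcomp w u p) x" for u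
    using assms by (simp add: wcomp_def eval_wscale_mono sum_distrib_left)
  thus ?thesis by (subst (1) wcomp_sum[of w p, symmetric]) (simp del: wcomp_sum)
qed

text \<open>Multiplying by \<open>c\<close> to the power \<open>-N\<close>, with \<open>N\<close>
  the least exponent, turns the Laurent polynomial into a nonzero polynomial.\<close>

lemma laurent_zeros_finite:
  fixes a :: "int \<Rightarrow> 'k::field"
  assumes "finite U" "u \<in> U" "a u \<noteq> 0"
  shows "finite {c. c \<noteq> 0 \<and> (\<Sum>u\<in>U. c powi u * a u) = 0}"
proof -
  define N where "N = Min U"
  have N: "v \<ge> N" if "v \<in> U" for v using assms that by (simp add: N_def)
  define q where "q = (\<Sum>v\<in>U. monom (a v) (nat (v - N)))"
  have "coeff q (nat (u - N)) = (\<Sum>v\<in>U. if v = u then a u else 0)"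
    unfolding q_def coeff_sum
  proof (intro sum.cong refl)
    fix v assume "v \<in> U"
    hence "nat (v - N) = nat (u - N) \<longleftrightarrow> v = u" using N[of v] N[of u] assms(2) by auto
    thus "coeff (monom (a v) (nat (v - N))) (nat (u - N)) = (if v = u then a u else 0)" by simp
  qed
  hence "q \<noteq> 0" using assms by auto
  moreover have "{c. c \<noteq> 0 \<and> (\<Sum>u\<in>U. c powi u * a u) = 0} \<subseteq> {c. poly q c = 0}"
  proof safe
    fix c :: 'k assume c: "c \<noteq> 0" "(\<Sum>u\<in>U. c powi u * a u) = 0"
    have "poly q c = (\<Sum>v\<in>U. c powi (-N) * (c powi v * a v))"
      unfolding q_def poly_sum
    proof (intro sum.cong refl)
      fix v assume "v \<in> U"
      hence "c ^ nat (v - N) = c powi (v - N)" using N by (simp flip: power_int_of_nat)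
      thus "poly (monom (a v) (nat (v - N))) c = c powi (-N) * (c powi v * a v)"
        using c by (simp add: poly_monom power_int_diff power_int_minus field_simps)
    qed
    also have "\<dots> = 0" using c by (simp flip: sum_distrib_left)
    finally show "poly q c = 0" .
  qed
  ultimately show ?thesis using poly_roots_finite finite_subset by blast
qed

text \<open>For nonempty \<open>Y\<close> this says that the vanishing ideal of \<open>Y\<close> is
  prime, i.e. that its Zariski closure is irreducible; the empty set qualifies too.\<close>

definition irr :: "('v \<Rightarrow> 'k::comm_ring_1) set \<Rightarrow> bool"
  where "irr Y \<longleftrightarrow> (\<forall>p q. (\<exists>y\<in>Y. eval_mpoly p y \<noteq> 0) \<longrightarrow> (\<exists>y\<in>Y. eval_mpoly q y \<noteq> 0) \<longrightarrow>
    (\<exists>y\<in>Y. eval_mpoly p y \<noteq> 0 \<and> eval_mpoly q y \<noteq> 0))"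

text \<open>If \<open>p\<close> and \<open>q\<close> are nonzero on the swept set, some weight
  component of each is nonzero on \<open>Y\<close>, hence both are nonzero at one common point.
  Along the scaling orbit of that point \<open>p\<close> and \<open>q\<close> are nonzero Laurent
  polynomials in \<open>c\<close>, with finitely many zeros.\<close>

lemma irr_wscale:
  fixes Y :: "('v \<Rightarrow> 'k::field_char_0) set"
  assumes "irr Y"
  shows "irr {wscale w c y |c y. c \<noteq> 0 \<and> y \<in> Y}"
  unfolding irr_def
proof safe
  fix p q c c' y y'
  assume *: "y \<in> Y" "y' \<in> Y" "c \<noteq> 0" "c' \<noteq> 0"
    "eval_mpoly p (wscale w c y) \<noteq> 0" "eval_mpoly q (wscale w c' y') \<noteq> 0"
  have ex: "\<exists>u\<in>wt w ` Poly_Mapping.keys p. eval_mpoly (wcomp w u p) y \<noteq> 0"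
    if "c \<noteq> 0" "eval_mpoly p (wscale w c y) \<noteq> 0" for p c and y :: "'v \<Rightarrow> 'k"
  proof (rule ccontr)
    assume "\<not> ?thesis"
    hence "eval_mpoly p (wscale w c y) = 0"
      unfolding eval_wscale[OF that(1)] by (intro sum.neutral) auto
    thus False using that by simp
  qed
  obtain u where u: "u \<in> wt w ` Poly_Mapping.keys p" "eval_mpoly (wcomp w u p) y \<noteq> 0"
    using ex[OF *(3,5)] by blast
  obtain u' where u': "u' \<in> wt w ` Poly_Mapping.keys q" "eval_mpoly (wcomp w u' q) y' \<noteq> 0"
    using ex[OF *(4,6)] by blast
  have "\<exists>z\<in>Y. eval_mpoly (wcomp w u p) z \<noteq> 0 \<and> eval_mpoly (wcomp w u' q) z \<noteq> 0"
    using assms[unfolded irr_def, rule_format, of "wcomp w u p" "wcomp w u' q"] *(1,2) u(2) u'(2) by blast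
  then obtain z where z: "z \<in> Y" "eval_mpoly (wcomp w u p) z \<noteq> 0" "eval_mpoly (wcomp w u' q) z \<noteq> 0"
    by blast
  let ?B = "\<lambda>p. {c. c \<noteq> 0 \<and> (\<Sum>u\<in>wt w ` Poly_Mapping.keys p. c powi u * eval_mpoly (wcomp w u p) z) = 0}"
  have "finite ({0} \<union> ?B p \<union> ?B q)"
    using laurent_zeros_finite[where a = "\<lambda>u. eval_mpoly (wcomp w u p) z", OF _ u(1) z(2)]
      laurent_zeros_finite[where a = "\<lambda>u. eval_mpoly (wcomp w u q) z", OF _ u'(1) z(3)] by auto
  from ex_new_if_finite[OF infinite_UNIV_char_0 this]
  obtain d where "d \<noteq> 0" "d \<notin> ?B p" "d \<notin> ?B q" by auto
  hence "eval_mpoly p (wscale w d z) \<noteq> 0" "eval_mpoly q (wscale w d z) \<noteq> 0"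
    by (auto simp: eval_wscale)
  thus "\<exists>y\<in>{wscale w c y |c y. c \<noteq> 0 \<and> y \<in> Y}. eval_mpoly p y \<noteq> 0 \<and> eval_mpoly q y \<noteq> 0"
    using \<open>d \<noteq> 0\<close> z(1) by blast
qed

section \<open>Trinomial hypersurfaces and their irreducibility\<close>

locale trinomial =
  fixes n :: "nat \<Rightarrow> nat" and l :: "nat \<Rightarrow> nat \<Rightarrow> nat"
    and V :: "(nat \<times> nat \<Rightarrow> 'k::{alg_closed_field, field_char_0}) set"
  assumes n1: "n 1 \<ge> 1" and n2: "n 2 \<ge> 1"
    and l_pos: "\<And>i j. i \<in> {0,1,2} \<Longrightarrow> j \<in> {1..n i} \<Longrightarrow> l i j > 0"
    and X_eq: "V = trinomial_hypersurface n l"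
begin

abbreviation I :: "(nat \<times> nat) set" where "I \<equiv> trinomial_index n"

definition M :: "nat \<Rightarrow> (nat \<times> nat, 'k) mpoly"
  where "M i = (\<Prod>j\<in>{1..n i}. Var (i, j) ^ l i j)"

text \<open>\<open>J\<close> lives in the polynomial ring on all pairs of numbers, so a variable
  outside \<open>I\<close> is congruent modulo \<open>J\<close> to the constant
  \<open>undefined\<close>.\<close>

definition J :: "(nat \<times> nat, 'k) mpoly set"
  where "J = {p. \<forall>x\<in>V. eval_mpoly p x = 0}"

lemma I_iff: "(i, j) \<in> I \<longleftrightarrow> i \<in> {0,1,2} \<and> j \<in> {1..n i}"
  by (auto simp: trinomial_index_def)

lemma finite_I: "finite I"
  by (simp add: trinomial_index_def)

lemma eval_M: "eval_mpoly (M i) x = (\<Prod>j\<in>{1..n i}. x (i, j) ^ l i j)"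
  by (simp add: M_def)

lemma X_iff: "x \<in> V \<longleftrightarrow> (\<forall>v. v \<notin> I \<longrightarrow> x v = undefined) \<and> (\<Sum>i\<in>{0,1,2}. eval_mpoly (M i) x) = 0"
  by (auto simp: X_eq trinomial_hypersurface_def affine_space_def eval_M PiE_def extensional_def add_ac)

text \<open>These one-parameter subgroups preserve \<open>V\<close>, as all three monomials get the
  same degree; weight 0 outside \<open>I\<close> keeps the coordinates there
  \<open>undefined\<close>.\<close>

definition admissible :: "(nat \<times> nat \<Rightarrow> int) \<Rightarrow> bool"
  where "admissible w \<longleftrightarrow> (\<forall>v. v \<notin> I \<longrightarrow> w v = 0) \<and>
    (\<exists>k. \<forall>i\<in>{0,1,2}. (\<Sum>j\<in>{1..n i}. int (l i j) * w (i, j)) = k)"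

lemma wscale_M:
  assumes "c \<noteq> 0"
  shows "eval_mpoly (M i) (wscale w c x) = c powi (\<Sum>j\<in>{1..n i}. int (l i j) * w (i, j)) * eval_mpoly (M i) x"
proof -
  have "(\<Prod>j\<in>A. (c powi w (i, j)) ^ l i j) = c powi (\<Sum>j\<in>A. int (l i j) * w (i, j))" for A
    by (induction A rule: infinite_finite_induct)
       (use assms in \<open>auto simp: power_int_add power_int_mult mult.commute[of "int _"]\<close>)
  thus ?thesis by (simp add: eval_M wscale_def power_mult_distrib prod.distrib)
qed

lemma wscale_X:
  assumes "admissible w" "c \<noteq> 0" "x \<in> V"
  shows "wscale w c x \<in> V"
proof -
  from assms(1) obtain k where k: "\<forall>i\<in>{0,1,2}. (\<Sum>j\<in>{1..n i}. int (l i j) * w (i, j)) = k"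
    by (auto simp: admissible_def)
  have "(\<Sum>i\<in>{0,1,2}. eval_mpoly (M i) (wscale w c x)) = c powi k * (\<Sum>i\<in>{0,1,2}. eval_mpoly (M i) x)"
    unfolding wscale_M[OF assms(2)] sum_distrib_left using k by (intro sum.cong) auto
  thus ?thesis using assms by (auto simp: X_iff wscale_def admissible_def)
qed

lemma wscale_inverse: "c \<noteq> 0 \<Longrightarrow> wscale w c (wscale w (inverse c) x) = x"
  by (simp add: wscale_def power_int_inverse fun_eq_iff)

text \<open>Scaling preserves \<open>V\<close>, which makes \<open>J\<close> graded: otherwise
  \<open>p\<close> along the scaling orbit of some point would be a nonzero Laurent polynomial
  vanishing at every nonzero scalar.\<close>

lemma J_wcomp:
  assumes "admissible w" "p \<in> J"
  shows "wcomp w u p \<in> J"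
proof (rule ccontr)
  assume "wcomp w u p \<notin> J"
  then obtain x where x: "x \<in> V" "eval_mpoly (wcomp w u p) x \<noteq> 0" by (auto simp: J_def)
  have "wcomp w u p \<noteq> 0" using x by auto
  hence "Poly_Mapping.keys (wcomp w u p) \<noteq> {}" by simp
  hence u: "u \<in> wt w ` Poly_Mapping.keys p" unfolding keys_wcomp by auto
  have "finite ({0} \<union> {c. c \<noteq> 0 \<and> (\<Sum>u\<in>wt w ` Poly_Mapping.keys p. c powi u * eval_mpoly (wcomp w u p) x) = 0})"
    using laurent_zeros_finite[where a = "\<lambda>u. eval_mpoly (wcomp w u p) x", OF _ u x(2)] by simp
  from ex_new_if_finite[OF infinite_UNIV_char_0 this]
  obtain c where "c \<noteq> 0" "eval_mpoly p (wscale w c x) \<noteq> 0" by (auto simp: eval_wscale)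
  thus False using wscale_X[OF assms(1) _ x(1)] assms(2) by (auto simp: J_def)
qed

text \<open>The plane curve \<open>1 + y^a + z^b = 0\<close>, from which irreducibility is spread
  over \<open>V\<close> by freeing one coordinate at a time.\<close>

definition slice :: "(nat \<times> nat \<Rightarrow> 'k) set"
  where "slice = {x\<in>V. \<forall>v\<in>I - {(1,1),(2,1)}. x v = 1}"

lemma prod_M_base:
  assumes "i \<in> {1,2}" "\<And>v. v \<in> I - {(1,1),(2,1)} \<Longrightarrow> x v = 1"
  shows "eval_mpoly (M i) x = x (i, 1) ^ l i 1"
proof -
  have "eval_mpoly (M i) x = (\<Prod>j\<in>{1}. x (i, j) ^ l i j)"
    unfolding eval_M using assms n1 n2 by (intro prod.mono_neutral_right) (auto simp: I_iff)
  thus ?thesis by simp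
qed

text \<open>Evaluation at the power series point is a homomorphism into an integral domain. Its
  kernel is exactly the ideal of the curve, because vanishing on either side means that all normal
  form coefficients \<open>c i\<close> are zero.\<close>

lemma irr_slice: "irr slice"
proof -
  define a b where "a = l 1 1" and "b = l 2 1"
  have ab: "a > 0" "b > 0" using l_pos n1 n2 by (auto simp: a_def b_def)
  define h :: "'k poly" where "h = - (1 + monom 1 a)"
  define A :: "nat \<times> nat \<Rightarrow> 'k poly" where
    "A v = (if v = (1,1) then [:0,1:] else if v = (2,1) then 0 else if v \<in> I then 1 else [:undefined:])" for v
  define A' :: "nat \<times> nat \<Rightarrow> 'k poly" where "A' v = (if v = (2,1) then 1 else 0)" for v
  let ?x = "\<lambda>y z v. poly (A v) y + poly (A' v) y * z"
  have "coeff h 0 = -1" using ab by (simp add: h_def)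
  hence h0: "h \<noteq> 0" by auto
  have x: "?x y z \<in> slice" if "z ^ b = poly h y" for y z
  proof -
    have 1: "?x y z v = 1" if "v \<in> I - {(1,1),(2,1)}" for v
      using that by (auto simp: A_def A'_def)
    have "eval_mpoly (M 0) (?x y z) = 1"
      unfolding eval_M using 1 by (intro prod.neutral) (auto simp: I_iff)
    moreover have "eval_mpoly (M 1) (?x y z) = y ^ a" "eval_mpoly (M 2) (?x y z) = z ^ b"
      using prod_M_base[OF _ 1, where i = 1] prod_M_base[OF _ 1, where i = 2]
      by (auto simp: a_def b_def A_def A'_def)
    moreover have "?x y z v = undefined" if "v \<notin> I" for v
      using that n1 n2 by (auto simp: A_def A'_def I_iff)
    ultimately show ?thesis using 1 that by (simp add: slice_def X_iff h_def poly_monom)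
  qed
  have surj: "\<exists>y z. z ^ b = poly h y \<and> x = ?x y z" if "x \<in> slice" for x
  proof (intro exI conjI)
    have 1: "x v = 1" if "v \<in> I - {(1,1),(2,1)}" for v
      using that \<open>x \<in> slice\<close> by (auto simp: slice_def)
    have V: "x \<in> V" using that by (simp add: slice_def)
    have "eval_mpoly (M 0) x = 1"
      unfolding eval_M using 1 by (intro prod.neutral) (auto simp: I_iff)
    moreover have "eval_mpoly (M 1) x = x (1,1) ^ a" "eval_mpoly (M 2) x = x (2,1) ^ b"
      using prod_M_base[OF _ 1, of 1] prod_M_base[OF _ 1, of 2] by (simp_all add: a_def b_def)
    ultimately have "x (2,1) ^ b + (1 + x (1,1) ^ a) = 0"
      using V by (simp add: X_iff add_ac)
    thus "x (2,1) ^ b = poly h (x (1,1))"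
      by (simp add: h_def poly_monom eq_neg_iff_add_eq_0 del: minus_add_distrib)
    show "x = ?x (x (1,1)) (x (2,1))"
    proof
      fix v show "x v = ?x (x (1,1)) (x (2,1)) v"
        using 1[of v] V[unfolded X_iff, THEN conjunct1, rule_format, of v]
        by (cases "v \<in> I") (auto simp: A_def A'_def)
    qed
  qed
  obtain Y :: "'k fps" where Y: "fps_X ^ b = fpoly h Y"
    "\<And>c. (\<Sum>i<b. fpoly (c i) Y * fps_X ^ i) = 0 \<Longrightarrow> \<forall>i<b. c i = 0"
    using curve_power_series[OF ab] unfolding h_def by blast
  define \<Theta> where "\<Theta> = fps_eval (\<lambda>v. fpoly (A v) Y + fpoly (A' v) Y * fps_X)"
  have \<Theta>: "\<Theta> p = 0 \<longleftrightarrow> (\<forall>x\<in>slice. eval_mpoly p x = 0)" for p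
  proof -
    obtain c where c: "\<And>y z. z ^ b = poly h y \<Longrightarrow> eval_mpoly p (?x y z) = (\<Sum>i<b. poly (c i) y * z ^ i)"
      "\<And>Y Z. Z ^ b = fpoly h Y \<Longrightarrow>
         fps_eval (\<lambda>v. fpoly (A v) Y + fpoly (A' v) Y * Z) p = (\<Sum>i<b. fpoly (c i) Y * Z ^ i)"
      using curve_normal_form[OF ab(2), of h p A A'] by blast
    have Th: "\<Theta> p = (\<Sum>i<b. fpoly (c i) Y * fps_X ^ i)" unfolding \<Theta>_def by (rule c(2)[OF Y(1)])
    show ?thesis
    proof
      assume "\<Theta> p = 0"
      hence c0: "\<forall>i<b. c i = 0" using Y(2)[of c] Th by simp
      show "\<forall>x\<in>slice. eval_mpoly p x = 0"
      proof
        fix x assume "x \<in> slice"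
        then obtain y z where yz: "z ^ b = poly h y" "x = ?x y z" using surj by blast
        show "eval_mpoly p x = 0" unfolding yz(2) c(1)[OF yz(1)] using c0 by simp
      qed
    next
      assume z: "\<forall>x\<in>slice. eval_mpoly p x = 0"
      have "c i = 0" if "i < b" for i
      proof (rule curve_vanishing[OF ab(2) h0 finite.emptyI _ that])
        fix y z' assume "z' ^ b = poly h y"
        thus "(\<Sum>i<b. poly (c i) y * z' ^ i) = 0" using c(1)[of z' y] x[of z' y] z by metis
      qed
      thus "\<Theta> p = 0" unfolding Th by simp
    qed
  qed
  show ?thesis unfolding irr_def
  proof (intro allI impI)
    fix p q assume "\<exists>y\<in>slice. eval_mpoly p y \<noteq> 0" "\<exists>y\<in>slice. eval_mpoly q y \<noteq> 0"
    hence "\<Theta> p \<noteq> 0" "\<Theta> q \<noteq> 0" using \<Theta>[of p] \<Theta>[of q] by blast+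
    hence "\<Theta> (p * q) \<noteq> 0" unfolding \<Theta>_def fps_eval_mult by simp
    hence "\<exists>y\<in>slice. eval_mpoly (p * q) y \<noteq> 0" using \<Theta>[of "p * q"] by blast
    thus "\<exists>y\<in>slice. eval_mpoly p y \<noteq> 0 \<and> eval_mpoly q y \<noteq> 0"
      unfolding eval_mpoly_mult by (metis mult_zero_left mult_zero_right)
  qed
qed

text \<open>Weights for which the trinomial is homogeneous: \<open>blk\<close> leaves all three monomials of degree 0,
  \<open>crs a\<close> is positive on one chosen variable \<open>(i, a i)\<close> of each monomial and zero elsewhere.\<close>

definition blk :: "nat \<Rightarrow> nat \<Rightarrow> nat \<Rightarrow> nat \<times> nat \<Rightarrow> int"
  where "blk i a b v = (if v = (i, a) then int (l i b) else if v = (i, b) then - int (l i a) else 0)"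

definition crs :: "(nat \<Rightarrow> nat) \<Rightarrow> nat \<times> nat \<Rightarrow> int"
  where "crs a v = (if fst v \<in> {0,1,2} \<and> snd v = a (fst v)
    then (\<Prod>i\<in>{0,1,2} - {fst v}. int (l i (a i))) else 0)"

lemma admissible_blk:
  assumes "i \<in> {0,1,2}" "a \<in> {1..n i}" "b \<in> {1..n i}" "a \<noteq> b"
  shows "admissible (blk i a b)"
proof -
  have "(\<Sum>j\<in>{1..n k}. int (l k j) * blk i a b (k, j)) = 0" for k
  proof (cases "k = i")
    case True
    have "(\<Sum>j\<in>{1..n k}. int (l k j) * blk i a b (k, j)) = (\<Sum>j\<in>{a,b}. int (l k j) * blk i a b (k, j))"
      using assms True by (intro sum.mono_neutral_right) (auto simp: blk_def)
    thus ?thesis using assms True by (simp add: blk_def)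
  qed (auto simp: blk_def)
  thus ?thesis using assms by (auto simp: admissible_def blk_def I_iff)
qed

lemma sum_crs:
  assumes "i \<in> {0,1,2}" "a i \<in> {1..n i}"
  shows "(\<Sum>j\<in>{1..n i}. int (l i j) * crs a (i, j)) = (\<Prod>i\<in>{0,1,2}. int (l i (a i)))"
proof -
  have "(\<Sum>j\<in>{1..n i}. int (l i j) * crs a (i, j)) = (\<Sum>j\<in>{a i}. int (l i j) * crs a (i, j))"
    using assms by (intro sum.mono_neutral_right) (auto simp: crs_def)
  also have "\<dots> = int (l i (a i)) * (\<Prod>k\<in>{0,1,2} - {i}. int (l k (a k)))"
    using assms by (simp add: crs_def)
  also have "\<dots> = (\<Prod>k\<in>{0,1,2}. int (l k (a k)))"
    by (rule prod.remove[symmetric]) (use assms in auto)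
  finally show ?thesis .
qed

lemma admissible_crs:
  assumes "\<And>i. i \<in> {0,1,2} \<Longrightarrow> a i \<in> {1..n i}"
  shows "admissible (crs a)"
  unfolding admissible_def
proof (intro conjI allI impI exI ballI)
  fix v assume "v \<notin> I"
  thus "crs a v = 0" using assms by (cases v) (auto simp: crs_def I_iff)
next
  fix i :: nat assume "i \<in> {0,1,2}"
  thus "(\<Sum>j\<in>{1..n i}. int (l i j) * crs a (i, j)) = (\<Prod>i\<in>{0,1,2}. int (l i (a i)))"
    using sum_crs assms by blast
qed

text \<open>\<open>S\<close> collects the coordinates with second index above 1 that are already
  free; \<open>(1,1)\<close> and \<open>(2,1)\<close> may vanish, as they may on the curve.\<close>

definition Yset :: "(nat \<times> nat) set \<Rightarrow> (nat \<times> nat \<Rightarrow> 'k) set"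
  where "Yset S = {x\<in>V. (\<forall>v\<in>I - {(1,1),(2,1)}. x v \<noteq> 0) \<and> (\<forall>v\<in>I. snd v \<noteq> 1 \<and> v \<notin> S \<longrightarrow> x v = 1)}"

text \<open>Roots exist in the field, so a point with \<open>x v\<close> nonzero can be scaled to
  \<open>x v = 1\<close>. Thus scaling \<open>Y\<close> sweeps out \<open>Z\<close>, and
  \<open>irr_wscale\<close> applies.\<close>

lemma Yset_scale:
  fixes Y Z :: "(nat \<times> nat \<Rightarrow> 'k) set"
  assumes w: "admissible w" and v: "v \<in> I" and wv: "w v > 0"
    and Y: "Y = {x\<in>Z. x v = 1}"
    and Z: "\<And>x c. c \<noteq> 0 \<Longrightarrow> x \<in> Z \<Longrightarrow> wscale w c x \<in> Z" "\<And>x. x \<in> Z \<Longrightarrow> x v \<noteq> 0"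
    and irr: "irr Y"
  shows "irr Z"
proof -
  have "Z = {wscale w c y |c y. c \<noteq> 0 \<and> y \<in> Y}"
  proof safe
    fix x assume x: "x \<in> Z"
    obtain c where c: "c ^ nat (w v) = x v" using nth_root_exists[of "nat (w v)" "x v"] wv by auto
    have c0: "c \<noteq> 0" using c Z(2)[OF x] wv by (auto simp: power_0_left split: if_splits)
    have "c powi w v = x v" using c wv by (metis power_int_of_nat int_nat_eq less_imp_le)
    hence "wscale w (inverse c) x v = 1"
      using Z(2)[OF x] by (simp add: wscale_def power_int_inverse)
    hence "wscale w (inverse c) x \<in> Y" using Z(1)[OF _ x] c0 by (simp add: Y)
    thus "\<exists>c y. x = wscale w c y \<and> c \<noteq> 0 \<and> y \<in> Y"
      using c0 wscale_inverse[OF c0] by metis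
  next
    fix c :: 'k and y assume "c \<noteq> 0" "y \<in> Y"
    thus "wscale w c y \<in> Z" using Z(1) by (simp add: Y)
  qed
  thus ?thesis using irr_wscale[OF irr] by simp
qed

lemma irr_Yset_empty: "irr (Yset {})"
proof (cases "n 0 = 0")
  case True
  have "Yset {} = slice"
  proof safe
    fix x assume x: "x \<in> Yset {}"
    have "x v = 1" if "v \<in> I - {(1,1),(2,1)}" for v
    proof (cases v)
      case (Pair i j)
      hence "snd v \<noteq> 1" "v \<in> I" using that True by (auto simp: I_iff)
      thus ?thesis using x by (simp add: Yset_def)
    qed
    thus "x \<in> slice" using x by (simp add: Yset_def slice_def)
  next
    fix x assume x: "x \<in> slice"
    hence "x v = 1" if "v \<in> I - {(1,1),(2,1)}" for v using that by (auto simp: slice_def)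
    moreover have "v \<in> I - {(1,1),(2,1)}" if "v \<in> I" "snd v \<noteq> 1" for v using that by auto
    ultimately show "x \<in> Yset {}" using x by (auto simp: Yset_def slice_def)
  qed
  thus ?thesis using irr_slice by simp
next
  case False
  \<comment> \<open>This weight frees \<open>(0,1)\<close>; the only other coordinates it moves,
    \<open>(1,1)\<close> and \<open>(2,1)\<close>, are unconstrained anyway.\<close>
  let ?w = "crs (\<lambda>_. 1)"
  have one: "1 \<in> {1..n i}" if "i \<in> {0,1,2}" for i using that n1 n2 False by auto
  have adm: "admissible ?w" by (rule admissible_crs) (rule one)
  have w: "?w v = 0" if "snd v \<noteq> 1" for v using that by (simp add: crs_def)
  show ?thesis
  proof (rule Yset_scale[OF adm, where v = "(0,1)"])
    show "(0,1) \<in> I" using one[of 0] by (simp add: I_iff)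
    have "0 < (\<Prod>i\<in>{0,1,2} - {0}. int (l i 1))"
      by (intro prod_pos ballI) (use l_pos one in auto)
    thus "?w (0,1) > 0" by (simp add: crs_def)
    show "slice = {x \<in> Yset {}. x (0,1) = 1}"
    proof safe
      fix x assume "x \<in> slice"
      thus "x \<in> Yset {}" "x (0,1) = 1" using \<open>(0,1) \<in> I\<close> by (auto simp: slice_def Yset_def)
    next
      fix x assume x: "x \<in> Yset {}" "x (0,1) = 1"
      have "x v = 1" if "v \<in> I - {(1,1),(2,1)}" for v
      proof (cases "snd v = 1")
        case True
        hence "v = (0,1)" using that by (cases v) (auto simp: I_iff)
        thus ?thesis using x by simp
      qed (use that x in \<open>auto simp: Yset_def\<close>)
      thus "x \<in> slice" using x by (simp add: slice_def Yset_def)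
    qed
    show "wscale ?w c x \<in> Yset {}" if "c \<noteq> 0" "x \<in> Yset {}" for x c
      using that wscale_X[OF adm] w by (auto simp: Yset_def wscale_def)
    show "x (0,1) \<noteq> 0" if "x \<in> Yset {}" for x
      using that \<open>(0,1) \<in> I\<close> by (auto simp: Yset_def)
  qed (rule irr_slice)
qed

lemma irr_Yset:
  assumes "finite S" "S \<subseteq> I" "\<forall>v\<in>S. snd v \<noteq> 1"
  shows "irr (Yset S)"
  using assms
proof (induction S rule: finite_induct)
  case empty
  show ?case by (rule irr_Yset_empty)
next
  case (insert v S)
  obtain i j where v: "v = (i, j)" by (cases v)
  have ij: "i \<in> {0,1,2}" "j \<in> {1..n i}" "j \<noteq> 1" "1 \<in> {1..n i}" using insert.prems v by (auto simp: I_iff)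
  let ?w = "blk i j 1"
  have adm: "admissible ?w" by (rule admissible_blk) (use ij in auto)
  have w: "?w u = 0" if "u \<noteq> v" "snd u \<noteq> 1" for u using that v by (auto simp: blk_def)
  show ?case
  proof (rule Yset_scale[OF adm, where v = v])
    show "v \<in> I" using insert.prems by auto
    show "?w v > 0" using l_pos[of i 1] ij by (simp add: v blk_def)
    show "Yset S = {x \<in> Yset (insert v S). x v = 1}"
      using insert ij v by (auto simp: Yset_def)
    show "wscale ?w c x \<in> Yset (insert v S)" if "c \<noteq> 0" "x \<in> Yset (insert v S)" for x c
      using that wscale_X[OF adm] w by (auto simp: Yset_def wscale_def)
    show "x v \<noteq> 0" if "x \<in> Yset (insert v S)" for x
      using that insert.prems ij v by (auto simp: Yset_def)
    show "irr (Yset S)" using insert by auto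
  qed
qed

lemma V_outside: "x \<in> V \<Longrightarrow> v \<notin> I \<Longrightarrow> x v = undefined"
  using X_iff[of x] by blast

text \<open>Density of the torus points, shown by a curve from \<open>x\<close> into the torus: the
  vanishing coordinates of one block \<open>i\<close> become \<open>z\<close>, all coordinates of
  the other blocks move linearly from \<open>x v\<close> at \<open>y = 0\<close> to 1 at
  \<open>y = 1\<close>, and the trinomial becomes \<open>z^b = h(y)\<close>. A polynomial that is
  zero at all torus points is then zero on the whole curve, including \<open>x\<close>.\<close>

lemma nonvanishing_torus:
  assumes x: "x \<in> V" "eval_mpoly p x \<noteq> 0"
  obtains x' where "x' \<in> V" "eval_mpoly p x' \<noteq> 0" "\<And>v. v \<in> I \<Longrightarrow> x' v \<noteq> 0"
proof (cases "\<forall>v\<in>I. x v \<noteq> 0")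
  case True
  thus ?thesis using that x by blast
next
  case False
  note witness = that
  from False obtain i j0 where ij0: "(i, j0) \<in> I" "x (i, j0) = 0" by auto
  show ?thesis
  proof (rule ccontr)
    assume no: "\<not> thesis"
    have van: "eval_mpoly p x' = 0" if "x' \<in> V" "\<forall>v\<in>I. x' v \<noteq> 0" for x'
      using witness[of x'] that no by blast
    have i: "i \<in> {0,1,2}" "j0 \<in> {1..n i}" using ij0 by (auto simp: I_iff)
    define Zr where "Zr = {j\<in>{1..n i}. x (i, j) = 0}"
    define b where "b = (\<Sum>j\<in>Zr. l i j)"
    have "l i j0 \<le> b" unfolding b_def using i ij0 by (intro member_le_sum) (auto simp: Zr_def)
    hence b: "b > 0" using l_pos[OF i] by linarith
    define \<kappa> where "\<kappa> = (\<Prod>j\<in>{1..n i} - Zr. x (i, j) ^ l i j)"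
    have \<kappa>: "\<kappa> \<noteq> 0" by (auto simp: \<kappa>_def Zr_def)
    define A :: "nat \<times> nat \<Rightarrow> 'k poly" where
      "A v = (if v \<in> I \<and> fst v \<noteq> i then [:x v, 1 - x v:] else [:x v:])" for v
    define A' :: "nat \<times> nat \<Rightarrow> 'k poly" where
      "A' v = (if v \<in> I \<and> fst v = i \<and> x v = 0 then 1 else 0)" for v
    define h where "h = smult (- 1 / \<kappa>) (\<Sum>k\<in>{0,1,2} - {i}. \<Prod>j\<in>{1..n k}. A (k, j) ^ l k j)"
    let ?x = "\<lambda>y z v. poly (A v) y + poly (A' v) y * z"
    have h_eq: "poly h y = (\<Sum>k\<in>{0,1,2} - {i}. eval_mpoly (M k) (?x y z)) * (- 1 / \<kappa>)" for y z
    proof -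
      have "poly (A' (k, j)) y = 0" if "k \<noteq> i" for k j using that by (simp add: A'_def)
      hence "(\<Sum>k\<in>{0,1,2} - {i}. eval_mpoly (M k) (?x y z)) = (\<Sum>k\<in>{0,1,2} - {i}. \<Prod>j\<in>{1..n k}. poly (A (k, j)) y ^ l k j)"
        unfolding eval_M by (intro sum.cong prod.cong refl) auto
      thus ?thesis by (simp add: h_def poly_sum poly_prod)
    qed
    have Mi: "eval_mpoly (M i) (?x y z) = \<kappa> * z ^ b" for y z
    proof -
      have "eval_mpoly (M i) (?x y z) = (\<Prod>j\<in>{1..n i} - Zr. ?x y z (i, j) ^ l i j) * (\<Prod>j\<in>Zr. ?x y z (i, j) ^ l i j)"
        unfolding eval_M by (rule prod.subset_diff) (auto simp: Zr_def)
      also have "(\<Prod>j\<in>{1..n i} - Zr. ?x y z (i, j) ^ l i j) = \<kappa>"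
        unfolding \<kappa>_def by (intro prod.cong refl) (auto simp: A_def A'_def Zr_def I_iff)
      also have "(\<Prod>j\<in>Zr. ?x y z (i, j) ^ l i j) = (\<Prod>j\<in>Zr. z ^ l i j)"
        using i by (intro prod.cong refl) (auto simp: A_def A'_def Zr_def I_iff)
      also have "\<dots> = z ^ b" by (simp add: b_def power_sum)
      finally show ?thesis .
    qed
    have out: "?x y z v = undefined" if "v \<notin> I" for y z v
      using that V_outside[OF x(1)] by (simp add: A_def A'_def)
    have inX: "?x y z \<in> V" if "z ^ b = poly h y" for y z
    proof -
      have "(\<Sum>k\<in>{0,1,2}. eval_mpoly (M k) (?x y z))
         = eval_mpoly (M i) (?x y z) + (\<Sum>k\<in>{0,1,2} - {i}. eval_mpoly (M k) (?x y z))"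
        using i by (intro sum.remove) auto
      also have "\<dots> = 0" unfolding Mi that h_eq[of y z] using \<kappa> by simp
      finally show ?thesis using out by (simp add: X_iff)
    qed
    have x0: "?x 0 0 = x" by (auto simp: A_def fun_eq_iff)
    have h0: "poly h 0 = 0"
    proof -
      have "(\<Sum>k\<in>{0,1,2}. eval_mpoly (M k) x) = eval_mpoly (M i) x + (\<Sum>k\<in>{0,1,2} - {i}. eval_mpoly (M k) x)"
        using i by (intro sum.remove) auto
      moreover have "eval_mpoly (M i) x = 0" using Mi[of 0 0] x0 b by simp
      ultimately have "(\<Sum>k\<in>{0,1,2} - {i}. eval_mpoly (M k) x) = 0" using x by (simp add: X_iff)
      thus ?thesis using h_eq[of 0 0] x0 by simp
    qed
    \<comment> \<open>At \<open>y = 1\<close> both other monomials equal 1, so \<open>h\<close>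
      takes the value \<open>-2 / \<kappa>\<close> there and is not the zero polynomial.\<close>
    have "eval_mpoly (M k) (?x 1 0) = 1" if "k \<in> {0,1,2} - {i}" for k
      unfolding eval_M using that by (intro prod.neutral) (auto simp: A_def A'_def I_iff)
    hence "poly h 1 = of_nat (card ({0,1,2::nat} - {i})) * (- 1 / \<kappa>)"
      unfolding h_eq[of 1 0] by simp
    moreover have "card ({0,1,2::nat} - {i}) = 2" using i by auto
    ultimately have "poly h 1 \<noteq> 0" using \<kappa> by simp
    hence h: "h \<noteq> 0" by auto
    define F where "F = (\<Union>v\<in>I. {y. fst v \<noteq> i \<and> poly (A v) y = 0})"
    have "finite F" unfolding F_def
    proof (intro finite_UN_I finite_I)
      fix v assume v: "v \<in> I"
      have "poly (A v) 1 = 1" if "fst v \<noteq> i" using v that by (simp add: A_def)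
      hence "A v \<noteq> 0" if "fst v \<noteq> i" using that by auto
      thus "finite {y. fst v \<noteq> i \<and> poly (A v) y = 0}"
        using poly_roots_finite[of "A v"] by (cases "fst v = i") auto
    qed
    obtain c where c: "\<And>y z. z ^ b = poly h y \<Longrightarrow> eval_mpoly p (?x y z) = (\<Sum>i<b. poly (c i) y * z ^ i)"
      "\<And>Y Z. Z ^ b = fpoly h Y \<Longrightarrow>
         fps_eval (\<lambda>v. fpoly (A v) Y + fpoly (A' v) Y * Z) p = (\<Sum>i<b. fpoly (c i) Y * Z ^ i)"
      using curve_normal_form[OF b, of h p A A'] by blast
    have "c k = 0" if "k < b" for k
    proof (rule curve_vanishing[OF b h \<open>finite F\<close> _ that])
      fix y z assume yz: "y \<notin> F" "poly h y \<noteq> 0" "z ^ b = poly h y"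
      have "z \<noteq> 0" using yz b by (auto simp: power_0_left)
      have "?x y z v \<noteq> 0" if "v \<in> I" for v
      proof (cases "fst v = i")
        case True
        thus ?thesis using \<open>z \<noteq> 0\<close> that by (cases "x v = 0") (simp_all add: A_def A'_def)
      next
        case False
        moreover have "poly (A v) y \<noteq> 0" using yz(1) that False unfolding F_def by blast
        ultimately show ?thesis by (simp add: A'_def)
      qed
      hence "eval_mpoly p (?x y z) = 0" by (intro van inX[OF yz(3)]) blast
      thus "(\<Sum>i<b. poly (c i) y * z ^ i) = 0" using c(1)[OF yz(3)] by simp
    qed
    moreover have "eval_mpoly p (?x 0 0) = (\<Sum>i<b. poly (c i) 0 * 0 ^ i)"
      using c(1)[of 0 0] h0 b by simp
    ultimately have "eval_mpoly p x = 0" using x0 by simp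
    thus False using x by simp
  qed
qed

lemma irr_X: "irr V"
  unfolding irr_def
proof (intro allI impI)
  fix p q assume "\<exists>y\<in>V. eval_mpoly p y \<noteq> 0" "\<exists>y\<in>V. eval_mpoly q y \<noteq> 0"
  then obtain x y where xy: "x \<in> V" "y \<in> V" "eval_mpoly p x \<noteq> 0" "eval_mpoly q y \<noteq> 0" by auto
  obtain x' where x': "x' \<in> V" "eval_mpoly p x' \<noteq> 0" "\<And>v. v \<in> I \<Longrightarrow> x' v \<noteq> 0"
    using nonvanishing_torus[OF xy(1,3)] by blast
  obtain y' where y': "y' \<in> V" "eval_mpoly q y' \<noteq> 0" "\<And>v. v \<in> I \<Longrightarrow> y' v \<noteq> 0"
    using nonvanishing_torus[OF xy(2,4)] by blast
  let ?Y = "Yset {v\<in>I. snd v \<noteq> 1}"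
  have "x' \<in> ?Y" "y' \<in> ?Y" using x' y' by (auto simp: Yset_def)
  moreover have "irr ?Y" by (rule irr_Yset) (auto intro: finite_subset[OF _ finite_I])
  ultimately have "\<exists>z\<in>?Y. eval_mpoly p z \<noteq> 0 \<and> eval_mpoly q z \<noteq> 0"
    using x'(2) y'(2) unfolding irr_def by blast
  moreover have "?Y \<subseteq> V" by (auto simp: Yset_def)
  ultimately show "\<exists>y\<in>V. eval_mpoly p y \<noteq> 0 \<and> eval_mpoly q y \<noteq> 0" by blast
qed

end

section \<open>Ideals stable under a derivation\<close>

definition poly_ideal :: "('v, 'k::comm_ring_1) mpoly set \<Rightarrow> bool"
  where "poly_ideal Z \<longleftrightarrow> 0 \<in> Z \<and> (\<forall>p\<in>Z. \<forall>q\<in>Z. p + q \<in> Z) \<and> (\<forall>p\<in>Z. \<forall>q. q * p \<in> Z)"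

lemma poly_idealD:
  assumes "poly_ideal Z"
  shows "0 \<in> Z" "p \<in> Z \<Longrightarrow> q \<in> Z \<Longrightarrow> p + q \<in> Z" "p \<in> Z \<Longrightarrow> q * p \<in> Z" "p \<in> Z \<Longrightarrow> p * q \<in> Z"
    "p \<in> Z \<Longrightarrow> - p \<in> Z" "p \<in> Z \<Longrightarrow> q \<in> Z \<Longrightarrow> p - q \<in> Z"
proof -
  show "0 \<in> Z" and add: "p \<in> Z \<Longrightarrow> q \<in> Z \<Longrightarrow> p + q \<in> Z" and mult: "p \<in> Z \<Longrightarrow> q * p \<in> Z" for p q
    using assms by (auto simp: poly_ideal_def)
  show "p \<in> Z \<Longrightarrow> p * q \<in> Z" using mult[of p q] by (simp add: mult.commute)
  show neg: "p \<in> Z \<Longrightarrow> - p \<in> Z" for p using mult[of p "-1"] by simp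
  show "p \<in> Z \<Longrightarrow> q \<in> Z \<Longrightarrow> p - q \<in> Z" using add[of p "-q"] neg[of q] by simp
qed

lemma poly_ideal_sum:
  "poly_ideal Z \<Longrightarrow> (\<And>a. a \<in> A \<Longrightarrow> f a \<in> Z) \<Longrightarrow> sum f A \<in> Z"
  by (induction A rule: infinite_finite_induct) (auto intro: poly_idealD)

lemma funpow_closed: "(\<And>p. p \<in> Z \<Longrightarrow> D p \<in> Z) \<Longrightarrow> p \<in> Z \<Longrightarrow> (D ^^ k) p \<in> Z"
  by (induction k) auto

lemma funpow_closed_le:
  assumes "\<And>p. p \<in> Z \<Longrightarrow> D p \<in> Z" "(D ^^ k) p \<in> Z" "k \<le> m"
  shows "(D ^^ m) p \<in> Z"
proof -
  have "(D ^^ m) p = (D ^^ (m - k)) ((D ^^ k) p)"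
    using funpow_add[of "m - k" k D] assms(3) by simp
  thus ?thesis using funpow_closed[of Z D, OF assms(1,2), where k = "m - k"] by simp
qed

text \<open>In the Leibniz expansion of order \<open>i + j\<close> every term has at least
  \<open>i\<close> derivatives on \<open>p\<close> or at least \<open>j\<close> on the variable;
  nilpotency thus has to be checked on variables only.\<close>

lemma locally_nilpotent_mod:
  assumes Z: "poly_ideal Z" and D: "\<And>p. p \<in> Z \<Longrightarrow> mder \<delta> p \<in> Z"
    and v: "\<And>v. v \<in> S \<Longrightarrow> \<exists>k. (mder \<delta> ^^ k) (Var v) \<in> Z"
    and p: "p \<in> polys_in S"
  shows "\<exists>k. (mder \<delta> ^^ k) p \<in> Z"
  using p
proof (induction p rule: polys_in_induct)
  case (Cst c)
  show ?case using poly_idealD(1)[OF Z] by (intro exI[of _ 1]) simp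
next
  case (add p q)
  then obtain i j where ij: "(mder \<delta> ^^ i) p \<in> Z" "(mder \<delta> ^^ j) q \<in> Z" by blast
  hence "(mder \<delta> ^^ (i + j)) p \<in> Z" "(mder \<delta> ^^ (i + j)) q \<in> Z"
    using funpow_closed_le[where D = "mder \<delta>", OF D ij(1) le_add1]
      funpow_closed_le[where D = "mder \<delta>", OF D ij(2) le_add2] by auto
  thus ?case using poly_idealD(2)[OF Z] by (intro exI[of _ "i + j"]) (simp add: funpow_mder_add)
next
  case (Var p v)
  from Var v[of v] obtain i j where ij: "(mder \<delta> ^^ i) p \<in> Z" "(mder \<delta> ^^ j) (Var v) \<in> Z" by blast
  have "(mder \<delta> ^^ (i + j)) (p * Var v) \<in> Z"
    unfolding mder_Leibniz
  proof (rule poly_ideal_sum[OF Z], rule poly_idealD(3)[OF Z])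
    fix k assume "k \<in> {..i + j}"
    show "(mder \<delta> ^^ k) p * (mder \<delta> ^^ (i + j - k)) (Var v) \<in> Z"
    proof (cases "k \<ge> i")
      case True
      hence "(mder \<delta> ^^ k) p \<in> Z" using funpow_closed_le[where D = "mder \<delta>", OF D ij(1)] by blast
      thus ?thesis by (rule poly_idealD(4)[OF Z])
    next
      case False
      hence "(mder \<delta> ^^ (i + j - k)) (Var v) \<in> Z"
        by (intro funpow_closed_le[where D = "mder \<delta>", OF D ij(2)]) auto
      thus ?thesis by (rule poly_idealD(3)[OF Z])
    qed
  qed
  thus ?case by blast
qed

section \<open>Locally nilpotent derivations and orbits\<close>

text \<open>The orbit of the point \<open>x\<close> under the exponential of a derivation, as a ring homomorphism to
  the polynomials in the time parameter.\<close>

definition nil_at :: "('v \<Rightarrow> ('v, 'k::field_char_0) mpoly) \<Rightarrow> ('v \<Rightarrow> 'k) \<Rightarrow> bool"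
  where "nil_at \<delta> x \<longleftrightarrow> (\<forall>p. \<exists>k. \<forall>m\<ge>k. eval_mpoly ((mder \<delta> ^^ m) p) x = 0)"

definition orb :: "('v \<Rightarrow> ('v, 'k::field_char_0) mpoly) \<Rightarrow> ('v \<Rightarrow> 'k) \<Rightarrow> ('v, 'k) mpoly \<Rightarrow> 'k poly"
  where "orb \<delta> x p = Abs_poly (\<lambda>k. eval_mpoly ((mder \<delta> ^^ k) p) x / fact k)"

lemma coeff_orb:
  assumes "nil_at \<delta> x"
  shows "coeff (orb \<delta> x p) k = eval_mpoly ((mder \<delta> ^^ k) p) x / fact k"
proof -
  from assms obtain N where N: "\<forall>m\<ge>N. eval_mpoly ((mder \<delta> ^^ m) p) x = 0"
    unfolding nil_at_def by blast
  have "\<forall>\<^sub>\<infinity>k. eval_mpoly ((mder \<delta> ^^ k) p) x / fact k = 0"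
    unfolding MOST_nat_le using N by (intro exI[of _ N]) auto
  thus ?thesis unfolding orb_def by (subst Abs_poly_inverse) auto
qed

context
  fixes \<delta> :: "'v \<Rightarrow> ('v, 'k::field_char_0) mpoly" and x
  assumes nil: "nil_at \<delta> x"
begin

lemma orb_add: "orb \<delta> x (p + q) = orb \<delta> x p + orb \<delta> x q"
  by (rule poly_eqI) (simp add: coeff_orb[OF nil] funpow_mder_add add_divide_distrib)

lemma orb_Cst: "orb \<delta> x (Cst c) = [:c:]"
proof (rule poly_eqI)
  fix k
  have "(mder \<delta> ^^ Suc k) (Cst c) = 0" for k by (induction k) auto
  thus "coeff (orb \<delta> x (Cst c)) k = coeff [:c:] k"
    by (cases k) (auto simp: coeff_orb[OF nil])
qed

text \<open>The Leibniz rule divided by factorials is the Cauchy product.\<close>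

lemma orb_mult: "orb \<delta> x (p * q) = orb \<delta> x p * orb \<delta> x q"
proof (rule poly_eqI)
  fix k
  have "coeff (orb \<delta> x (p * q)) k = (\<Sum>i\<le>k. of_nat (k choose i) *
      (eval_mpoly ((mder \<delta> ^^ i) p) x * eval_mpoly ((mder \<delta> ^^ (k - i)) q) x)) / fact k"
  proof -
    have of_nat: "eval_mpoly (of_nat j) x = of_nat j" for j by (induction j) auto
    show ?thesis by (simp add: coeff_orb[OF nil] mder_Leibniz of_nat)
  qed
  also have "\<dots> = (\<Sum>i\<le>k. (eval_mpoly ((mder \<delta> ^^ i) p) x / fact i) *
      (eval_mpoly ((mder \<delta> ^^ (k - i)) q) x / fact (k - i)))"
    unfolding sum_divide_distrib
    by (intro sum.cong refl) (simp add: binomial_fact field_simps)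
  finally show "coeff (orb \<delta> x (p * q)) k = coeff (orb \<delta> x p * orb \<delta> x q) k"
    by (simp add: coeff_mult coeff_orb[OF nil])
qed

lemma orb_1: "orb \<delta> x 1 = 1"
  using orb_Cst[of 1] by (simp add: one_pCons)

lemma orb_0: "orb \<delta> x 0 = 0"
  using orb_Cst[of 0] by simp

lemma orb_power: "orb \<delta> x (p ^ k) = orb \<delta> x p ^ k"
  by (induction k) (auto simp: orb_1 orb_mult)

lemma orb_prod: "orb \<delta> x (prod f A) = (\<Prod>a\<in>A. orb \<delta> x (f a))"
  by (induction A rule: infinite_finite_induct) (auto simp: orb_1 orb_mult)

lemma orb_sum: "orb \<delta> x (sum f A) = (\<Sum>a\<in>A. orb \<delta> x (f a))"
  by (induction A rule: infinite_finite_induct) (auto simp: orb_0 orb_add)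

lemma orb_Cst_mult: "orb \<delta> x (Cst c * p) = smult c (orb \<delta> x p)"
  by (simp add: orb_mult orb_Cst)

lemma poly_orb_0: "poly (orb \<delta> x p) 0 = eval_mpoly p x"
  by (simp add: poly_0_coeff_0 coeff_orb[OF nil])

text \<open>Being a ring homomorphism, the orbit map is evaluation along the curve traced by the
  coordinates; thus the flow moves points.\<close>

lemma poly_orb: "poly (orb \<delta> x p) s = eval_mpoly p (\<lambda>v. poly (orb \<delta> x (Var v)) s)"
  by (induction p rule: mpoly_induct) (simp_all add: orb_Cst orb_add orb_mult)

end

context trinomial
begin

lemma J_ideal: "poly_ideal J"
  by (auto simp: poly_ideal_def J_def)

lemmas J_rules = poly_idealD[OF J_ideal]

lemma J_prime: "p * q \<in> J \<Longrightarrow> p \<in> J \<or> q \<in> J"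
proof (rule ccontr)
  assume pq: "p * q \<in> J" "\<not> (p \<in> J \<or> q \<in> J)"
  hence "\<exists>y\<in>V. eval_mpoly p y \<noteq> 0" "\<exists>y\<in>V. eval_mpoly q y \<noteq> 0" by (auto simp: J_def)
  hence "\<exists>y\<in>V. eval_mpoly p y \<noteq> 0 \<and> eval_mpoly q y \<noteq> 0" using irr_X unfolding irr_def by blast
  thus False using pq(1) by (auto simp: J_def)
qed

lemma J_mult_iff: "p * q \<in> J \<longleftrightarrow> p \<in> J \<or> q \<in> J"
  using J_prime[of p q] J_rules(3)[of q p] J_rules(4)[of p q] by auto

lemma torus_point: "\<exists>x\<in>V. \<forall>v\<in>I. x v \<noteq> 0"
proof -
  have l: "l 1 1 > 0" using l_pos[of 1 1] n1 by simp
  \<comment> \<open>With all other coordinates 1 the trinomial reads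
    \<open>1 + (-2) + 1 = 0\<close>.\<close>
  then obtain y where y: "y ^ l 1 1 = (-2 :: 'k)" using nth_root_exists by blast
  hence y0: "y \<noteq> 0" using l by (auto simp: power_0_left)
  define x where "x v = (if v = (1,1) then y else if v \<in> I then 1 else undefined)" for v
  have 1: "x v = 1" if "v \<in> I - {(1,1),(2,1)}" for v using that by (auto simp: x_def)
  have "eval_mpoly (M 0) x = 1"
    unfolding eval_M using 1 by (intro prod.neutral) (auto simp: I_iff)
  moreover have "eval_mpoly (M 1) x = -2" "eval_mpoly (M 2) x = 1"
    using prod_M_base[of 1 x, OF _ 1] prod_M_base[of 2 x, OF _ 1] y n2 by (auto simp: x_def I_iff)
  moreover have "x v = undefined" if "v \<notin> I" for v
    using that n1 by (auto simp: x_def I_iff)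
  ultimately have "x \<in> V" by (simp add: X_iff)
  moreover have "\<forall>v\<in>I. x v \<noteq> 0" using y0 by (auto simp: x_def)
  ultimately show ?thesis by blast
qed

lemma Var_notin_J: "v \<in> I \<Longrightarrow> Var v \<notin> J"
  using torus_point by (auto simp: J_def)

lemma Cst_in_J [simp]: "Cst c \<in> J \<longleftrightarrow> c = 0"
  using torus_point by (auto simp: J_def)

lemma one_notin_J [simp]: "1 \<notin> J"
  using Cst_in_J[of 1] by simp

lemma prod_notin_J: "finite A \<Longrightarrow> (\<And>a. a \<in> A \<Longrightarrow> f a \<notin> J) \<Longrightarrow> prod f A \<notin> J"
  by (induction A rule: finite_induct) (auto simp: J_mult_iff)

lemma power_in_J: "p ^ k \<in> J \<longleftrightarrow> p \<in> J \<and> k > 0"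
  by (induction k) (auto simp: J_mult_iff)

lemma generic_point:
  assumes "finite A" "\<And>p. p \<in> A \<Longrightarrow> p \<notin> J"
  shows "\<exists>x\<in>V. \<forall>p\<in>A. eval_mpoly p x \<noteq> 0"
proof -
  have "(\<Prod>p\<in>A. p) \<notin> J" by (rule prod_notin_J[OF assms])
  then obtain x where "x \<in> V" "eval_mpoly (\<Prod>p\<in>A. p) x \<noteq> 0" by (auto simp: J_def)
  thus ?thesis using assms(1) by (auto simp: prod_zero_iff)
qed

lemma trinomial_in_J: "(\<Sum>i\<in>{0,1,2}. M i) \<in> J"
  by (auto simp: J_def X_iff)

text \<open>A locally nilpotent derivation of \<open>K[V]\<close> lifted to polynomials: nilpotency
  is demanded modulo \<open>J\<close> only. The value 0 outside \<open>I\<close> fits the variables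
  that are constant on \<open>V\<close>.\<close>

definition lnd :: "(nat \<times> nat \<Rightarrow> (nat \<times> nat, 'k) mpoly) \<Rightarrow> bool"
  where "lnd \<delta> \<longleftrightarrow> (\<forall>v. \<delta> v \<in> polys_in I) \<and> (\<forall>v. v \<notin> I \<longrightarrow> \<delta> v = 0) \<and>
    (\<forall>p\<in>J. mder \<delta> p \<in> J) \<and> (\<forall>v\<in>I. \<exists>k. (mder \<delta> ^^ k) (Var v) \<in> J)"

lemma lnd_J: "lnd \<delta> \<Longrightarrow> p \<in> J \<Longrightarrow> mder \<delta> p \<in> J"
  by (simp add: lnd_def)

lemma lnd_outside: "lnd \<delta> \<Longrightarrow> v \<notin> I \<Longrightarrow> \<delta> v = 0"
  and lnd_polys_in: "lnd \<delta> \<Longrightarrow> \<delta> v \<in> polys_in I"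
  unfolding lnd_def by blast+

lemma lnd_funpow_J: "lnd \<delta> \<Longrightarrow> p \<in> J \<Longrightarrow> (mder \<delta> ^^ k) p \<in> J"
  by (rule funpow_closed[where Z = J]) (auto intro: lnd_J)

lemma lnd_funpow_le: "lnd \<delta> \<Longrightarrow> (mder \<delta> ^^ k) p \<in> J \<Longrightarrow> k \<le> m \<Longrightarrow> (mder \<delta> ^^ m) p \<in> J"
  by (rule funpow_closed_le[where Z = J]) (auto intro: lnd_J)

lemma lnd_nilpotent: "lnd \<delta> \<Longrightarrow> \<exists>k. (mder \<delta> ^^ k) p \<in> J"
proof (rule locally_nilpotent_mod[OF J_ideal lnd_J, where S = UNIV])
  fix v assume *: "lnd \<delta>"
  show "\<exists>k. (mder \<delta> ^^ k) (Var v) \<in> J"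
  proof (cases "v \<in> I")
    case False
    hence "(mder \<delta> ^^ 1) (Var v) \<in> J" using lnd_outside[OF *] J_rules(1) by simp
    thus ?thesis by blast
  qed (use * in \<open>simp add: lnd_def\<close>)
qed auto

lemma lnd_nil_at:
  assumes "lnd \<delta>" "x \<in> V"
  shows "nil_at \<delta> x"
  unfolding nil_at_def
proof
  fix p
  from lnd_nilpotent[OF assms(1)] obtain k where "(mder \<delta> ^^ k) p \<in> J" by blast
  hence "(mder \<delta> ^^ m) p \<in> J" if "m \<ge> k" for m using lnd_funpow_le[OF assms(1)] that by blast
  thus "\<exists>k. \<forall>m\<ge>k. eval_mpoly ((mder \<delta> ^^ m) p) x = 0" using assms(2) by (auto simp: J_def)
qed

text \<open>The degree function of a locally nilpotent derivation, given as a relation because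
  elements of \<open>J\<close> have no degree.\<close>

definition isdeg :: "(nat \<times> nat \<Rightarrow> (nat \<times> nat, 'k) mpoly) \<Rightarrow> (nat \<times> nat, 'k) mpoly \<Rightarrow> nat \<Rightarrow> bool"
  where "isdeg \<delta> p k \<longleftrightarrow> (mder \<delta> ^^ k) p \<notin> J \<and> (mder \<delta> ^^ Suc k) p \<in> J"

lemma isdeg_exists:
  assumes "lnd \<delta>" "p \<notin> J"
  shows "\<exists>k. isdeg \<delta> p k"
proof -
  define k where "k = (LEAST k. (mder \<delta> ^^ k) p \<in> J)"
  have "(mder \<delta> ^^ k) p \<in> J" unfolding k_def using lnd_nilpotent[OF assms(1)] by (rule LeastI_ex)
  moreover have "k \<noteq> 0" using calculation assms(2) by (cases k) auto
  then obtain k' where "k = Suc k'" by (cases k) auto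
  moreover have "(mder \<delta> ^^ k') p \<notin> J" using not_less_Least[of k' "\<lambda>k. (mder \<delta> ^^ k) p \<in> J"] \<open>k = Suc k'\<close>
    by (simp add: k_def)
  ultimately show ?thesis by (auto simp: isdeg_def)
qed

lemma isdeg_unique: "lnd \<delta> \<Longrightarrow> isdeg \<delta> p k \<Longrightarrow> isdeg \<delta> p m \<Longrightarrow> k = m"
  using lnd_funpow_le[of \<delta> "Suc k" p m] lnd_funpow_le[of \<delta> "Suc m" p k]
  unfolding isdeg_def by (cases k m rule: linorder_cases) (auto simp del: funpow.simps)

text \<open>At order \<open>i + j\<close> only the term with \<open>i\<close> derivatives on
  \<open>p\<close> survives modulo \<open>J\<close>; its binomial coefficient is nonzero and
  \<open>J\<close> is prime. One order higher nothing survives.\<close>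

lemma isdeg_mult:
  assumes "lnd \<delta>" "isdeg \<delta> p i" "isdeg \<delta> q j"
  shows "isdeg \<delta> (p * q) (i + j)"
proof -
  let ?D = "mder \<delta>"
  have p: "(?D ^^ k) p \<in> J" if "k > i" for k
    using lnd_funpow_le[OF assms(1), of "Suc i" p k] assms(2) that by (auto simp: isdeg_def)
  have q: "(?D ^^ k) q \<in> J" if "k > j" for k
    using lnd_funpow_le[OF assms(1), of "Suc j" q k] assms(3) that by (auto simp: isdeg_def)
  have term_in: "of_nat c * ((?D ^^ a) p * (?D ^^ b) q) \<in> J" if "a > i \<or> b > j" for a b and c :: nat
    using that p[of a] q[of b] by (auto simp: J_mult_iff)
  have "(?D ^^ Suc (i + j)) (p * q) \<in> J"
    unfolding mder_Leibniz by (intro poly_ideal_sum[OF J_ideal] term_in) auto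
  moreover have "(?D ^^ (i + j)) (p * q) \<notin> J"
  proof
    assume "(?D ^^ (i + j)) (p * q) \<in> J"
    moreover have "(?D ^^ (i + j)) (p * q) =
      of_nat ((i + j) choose i) * ((?D ^^ i) p * (?D ^^ j) q) +
      (\<Sum>k\<in>{..i + j} - {i}. of_nat ((i + j) choose k) * ((?D ^^ k) p * (?D ^^ (i + j - k)) q))"
      unfolding mder_Leibniz by (subst sum.remove[of _ i]) auto
    moreover have "(\<Sum>k\<in>{..i + j} - {i}. of_nat ((i + j) choose k) * ((?D ^^ k) p * (?D ^^ (i + j - k)) q)) \<in> J"
      by (intro poly_ideal_sum[OF J_ideal] term_in) auto
    ultimately have "of_nat ((i + j) choose i) * ((?D ^^ i) p * (?D ^^ j) q) \<in> J"
      using J_rules(6)[of "(?D ^^ (i + j)) (p * q)"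
        "\<Sum>k\<in>{..i + j} - {i}. of_nat ((i + j) choose k) * ((?D ^^ k) p * (?D ^^ (i + j - k)) q)"]
      by simp
    moreover have "(of_nat c :: (nat \<times> nat, 'k) mpoly) = Cst (of_nat c)" for c
      by (induction c) (auto simp: Cst_def single_add)
    ultimately show False
      using assms(2,3) by (auto simp: isdeg_def J_mult_iff)
  qed
  ultimately show ?thesis by (simp add: isdeg_def)
qed

lemma isdeg_Cst: "c \<noteq> 0 \<Longrightarrow> isdeg \<delta> (Cst c) 0"
  using J_rules(1) by (simp add: isdeg_def)

lemma isdeg_0_iff: "isdeg \<delta> p 0 \<longleftrightarrow> p \<notin> J \<and> mder \<delta> p \<in> J"
  by (simp add: isdeg_def)

lemma isdeg_power:
  assumes "lnd \<delta>" "isdeg \<delta> p k"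
  shows "isdeg \<delta> (p ^ m) (m * k)"
  by (induction m) (use assms isdeg_mult isdeg_Cst[of 1 \<delta>] in auto)

lemma isdeg_prod:
  assumes "lnd \<delta>" "finite A" "\<And>a. a \<in> A \<Longrightarrow> isdeg \<delta> (f a) (k a)"
  shows "isdeg \<delta> (prod f A) (\<Sum>a\<in>A. k a)"
  using assms(2,3) by (induction A rule: finite_induct) (use isdeg_Cst[of 1 \<delta>] isdeg_mult assms(1) in auto)

lemma isdeg_mod:
  assumes "lnd \<delta>" "p - q \<in> J" "isdeg \<delta> p k"
  shows "isdeg \<delta> q k"
proof -
  have *: "(mder \<delta> ^^ k) p - (mder \<delta> ^^ k) q \<in> J" for k
    using lnd_funpow_J[OF assms(1,2)] by (simp add: funpow_mder_diff)
  have "(mder \<delta> ^^ k) p \<in> J \<longleftrightarrow> (mder \<delta> ^^ k) q \<in> J" for k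
    using J_rules(2)[OF *[of k], of "(mder \<delta> ^^ k) q"] J_rules(6)[OF _ *[of k], of "(mder \<delta> ^^ k) p"] by auto
  thus ?thesis using assms(3) by (simp add: isdeg_def del: funpow.simps)
qed

text \<open>The kernel is factorially closed: degrees are natural numbers and add, so a factor of an
  element of degree 0 has degree 0.\<close>

lemma kernel_factor:
  assumes "lnd \<delta>" "p * q \<notin> J" "mder \<delta> (p * q) \<in> J"
  shows "mder \<delta> p \<in> J"
proof -
  have "p \<notin> J" "q \<notin> J" using assms(2) J_mult_iff by auto
  then obtain i j where ij: "isdeg \<delta> p i" "isdeg \<delta> q j"
    using isdeg_exists[OF assms(1), of p] isdeg_exists[OF assms(1), of q] by blast
  have "isdeg \<delta> (p * q) 0" using assms by (simp add: isdeg_0_iff)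
  hence "i + j = 0" using isdeg_mult[OF assms(1) ij] isdeg_unique[OF assms(1)] by blast
  thus ?thesis using ij(1) by (simp add: isdeg_0_iff)
qed

lemma orb_mod_J:
  assumes "lnd \<delta>" "x \<in> V" "p \<in> J"
  shows "orb \<delta> x p = 0"
  using lnd_funpow_J[OF assms(1,3)] assms(2)
  by (intro poly_eqI) (simp add: coeff_orb[OF lnd_nil_at[OF assms(1,2)]] J_def)

lemma orb_kernel:
  assumes "lnd \<delta>" "x \<in> V" "mder \<delta> p \<in> J"
  shows "orb \<delta> x p = [:eval_mpoly p x:]"
proof (rule poly_eqI)
  fix k
  have "(mder \<delta> ^^ Suc k) p \<in> J" for k
    using lnd_funpow_J[OF assms(1,3)] by (simp add: funpow_swap1)
  hence "eval_mpoly ((mder \<delta> ^^ Suc k) p) x = 0" for k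
    using assms(2) unfolding J_def by blast
  thus "coeff (orb \<delta> x p) k = coeff [:eval_mpoly p x:] k"
    by (cases k) (simp_all add: coeff_orb[OF lnd_nil_at[OF assms(1,2)]])
qed

lemma orb_trinomial:
  assumes "lnd \<delta>" "x \<in> V"
  shows "(\<Sum>i\<in>{0,1,2}. orb \<delta> x (M i)) = 0"
  using orb_mod_J[OF assms trinomial_in_J] unfolding orb_sum[OF lnd_nil_at[OF assms]] .

end

section \<open>Passage to the coordinate ring and the two explicit derivations\<close>

lemma mder_prod_kernel: "(\<And>a. a \<in> A \<Longrightarrow> mder \<delta> (f a) = 0) \<Longrightarrow> mder \<delta> (prod f A) = 0"
  by (induction A rule: infinite_finite_induct) auto

lemma mder_power: "mder \<delta> (p ^ k) = of_nat k * p ^ (k - 1) * mder \<delta> p"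
  by (cases k) (simp_all add: mder_power_Suc del: power_Suc of_nat_Suc)

lemma nilpotent_polys_in:
  fixes p :: "('v, 'k::comm_ring_1) mpoly"
  assumes "\<And>v. v \<in> S \<Longrightarrow> \<exists>k. (mder \<delta> ^^ k) (Var v) = 0" "p \<in> polys_in S"
  shows "\<exists>k. (mder \<delta> ^^ k) p = 0"
proof -
  have "poly_ideal {0 :: ('v, 'k) mpoly}" by (auto simp: poly_ideal_def)
  from locally_nilpotent_mod[OF this, of \<delta> S p] show ?thesis using assms by simp
qed

lemma polys_in_mono: "p \<in> polys_in S \<Longrightarrow> S \<subseteq> T \<Longrightarrow> p \<in> polys_in T"
  by (auto simp: polys_in_def)

context trinomial
begin

definition R :: "(nat \<times> nat, 'k) mpoly \<Rightarrow> (nat \<times> nat \<Rightarrow> 'k) \<Rightarrow> 'k"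
  where "R p = restrict (eval_mpoly p) V"

abbreviation A :: "('k, (nat \<times> nat \<Rightarrow> 'k) \<Rightarrow> 'k) module" where "A \<equiv> coordinate_ring I V"

lemma R_eq_iff: "R p = R q \<longleftrightarrow> p - q \<in> J"
proof -
  have "R p = R q \<longleftrightarrow> (\<forall>x\<in>V. eval_mpoly p x = eval_mpoly q x)"
    unfolding R_def by (metis (mono_tags, lifting) restrict_apply' restrict_ext)
  thus ?thesis by (simp add: J_def)
qed

lemma carrier_A: "carrier A = R ` polys_in I"
  by (simp add: coordinate_ring_def R_def)

lemma A_ops: "R p \<oplus>\<^bsub>A\<^esub> R q = R (p + q)" "R p \<otimes>\<^bsub>A\<^esub> R q = R (p * q)"
  "c \<odot>\<^bsub>A\<^esub> R p = R (Cst c * p)" "\<zero>\<^bsub>A\<^esub> = R 0"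
  by (auto simp: coordinate_ring_def R_def restrict_def)

lemma carrier_K: "carrier (ring_of_type_algebra :: 'k ring) = UNIV"
  by (simp add: ring_of_type_algebra_def)

lemma not_rigid_if_lnd:
  assumes "lnd \<delta>" "v \<in> I" "\<delta> v \<notin> J"
  shows "\<not> rigid I V"
proof -
  \<comment> \<open>The choice of representative does not matter, since \<open>mder \<delta>\<close>
    preserves \<open>J\<close>.\<close>
  define d where "d f = R (mder \<delta> (SOME p. p \<in> polys_in I \<and> f = R p))" for f
  have d: "d (R p) = R (mder \<delta> p)" if "p \<in> polys_in I" for p
  proof -
    define q where "q = (SOME q. q \<in> polys_in I \<and> R p = R q)"
    have "q \<in> polys_in I \<and> R p = R q" unfolding q_def by (rule someI[of _ p]) (use that in simp)
    hence "q - p \<in> J" using R_eq_iff[of q p] by simp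
    hence "mder \<delta> q - mder \<delta> p \<in> J" using lnd_J[OF assms(1)] by fastforce
    thus ?thesis unfolding d_def q_def[symmetric] by (simp add: R_eq_iff)
  qed
  have pin: "mder \<delta> p \<in> polys_in I" if "p \<in> polys_in I" for p
    by (rule mder_polys_in[OF that lnd_polys_in[OF assms(1)]])
  have dn: "(d ^^ k) (R p) = R ((mder \<delta> ^^ k) p) \<and> (mder \<delta> ^^ k) p \<in> polys_in I" if "p \<in> polys_in I" for k p
    by (induction k) (use that pin in \<open>auto simp: d\<close>)
  have "derivation (ring_of_type_algebra :: 'k ring) A d"
    unfolding derivation_def carrier_A carrier_K
    by (auto simp: d pin A_ops polys_in_add polys_in_mult)
  moreover have "\<exists>k>0. (d ^^ k) a = \<zero>\<^bsub>A\<^esub>" if "a \<in> carrier A" for a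
  proof -
    from that obtain p where p: "p \<in> polys_in I" "a = R p" by (auto simp: carrier_A)
    obtain k where "(mder \<delta> ^^ k) p \<in> J" using lnd_nilpotent[OF assms(1)] by blast
    hence "(mder \<delta> ^^ Suc k) p \<in> J" using lnd_funpow_le[OF assms(1), of k p "Suc k"] by simp
    hence "(d ^^ Suc k) a = \<zero>\<^bsub>A\<^esub>" using dn[OF p(1), of "Suc k"] p(2) R_eq_iff[of "(mder \<delta> ^^ Suc k) p" 0]
      by (simp add: A_ops del: funpow.simps)
    thus ?thesis by blast
  qed
  moreover have "d (R (Var v)) \<noteq> \<zero>\<^bsub>A\<^esub>" "R (Var v) \<in> carrier A"
    using assms by (auto simp: d A_ops R_eq_iff carrier_A)
  ultimately show ?thesis unfolding rigid_def LND_def by blast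
qed

text \<open>Each variable outside \<open>I\<close> is replaced by the constant
  \<open>undefined\<close>; the derivatives agree modulo \<open>J\<close> as well, because
  \<open>\<delta>\<close> kills those variables. This transports stability from
  \<open>polys_in I\<close>, where the abstract derivation is available, to all of
  \<open>J\<close>.\<close>

lemma outside_reduction:
  assumes "\<And>v. v \<notin> I \<Longrightarrow> \<delta> v = 0"
  shows "\<exists>p'\<in>polys_in I. p - p' \<in> J \<and> mder \<delta> p - mder \<delta> p' \<in> J"
proof (induction p rule: mpoly_induct)
  case (Cst c)
  show ?case by (rule bexI[of _ "Cst c"]) (simp_all add: J_rules)
next
  case (add p q)
  then obtain p' q' where "p' \<in> polys_in I" "q' \<in> polys_in I" and *: "p - p' \<in> J" "mder \<delta> p - mder \<delta> p' \<in> J"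
    "q - q' \<in> J" "mder \<delta> q - mder \<delta> q' \<in> J" by blast
  moreover have "p + q - (p' + q') \<in> J" "mder \<delta> (p + q) - mder \<delta> (p' + q') \<in> J"
    using J_rules(2)[OF *(1,3)] J_rules(2)[OF *(2,4)] by (simp_all add: algebra_simps)
  ultimately show ?case by (intro bexI[of _ "p' + q'"]) (auto intro: polys_in_add)
next
  case (Var p v)
  then obtain p' where p': "p' \<in> polys_in I" "p - p' \<in> J" "mder \<delta> p - mder \<delta> p' \<in> J" by blast
  show ?case
  proof (cases "v \<in> I")
    case True
    have "p * Var v - p' * Var v \<in> J" using J_rules(4)[OF p'(2), of "Var v"] by (simp add: algebra_simps)
    moreover have "(mder \<delta> p - mder \<delta> p') * Var v + (p - p') * \<delta> v \<in> J"
      by (intro J_rules p')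
    hence "mder \<delta> (p * Var v) - mder \<delta> (p' * Var v) \<in> J" by (simp add: algebra_simps)
    ultimately show ?thesis using True p'(1) by (intro bexI[of _ "p' * Var v"]) (auto intro: polys_in_mult)
  next
    case False
    have u: "Var v - Cst undefined \<in> J" using V_outside False by (auto simp: J_def)
    have "(p - p') * Var v + p' * (Var v - Cst undefined) \<in> J"
      by (intro J_rules(2-4) p' u)
    hence "p * Var v - p' * Cst undefined \<in> J" by (simp add: algebra_simps)
    moreover have "(mder \<delta> p - mder \<delta> p') * Var v + mder \<delta> p' * (Var v - Cst undefined) \<in> J"
      by (intro J_rules(2-4) p' u)
    hence "mder \<delta> (p * Var v) - mder \<delta> (p' * Cst undefined) \<in> J"
      using assms[OF False] by (simp add: algebra_simps)
    ultimately show ?thesis using p'(1) by (intro bexI[of _ "p' * Cst undefined"]) (auto intro: polys_in_mult)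
  qed
qed

lemma lnd_if_not_rigid:
  assumes "\<not> rigid I V"
  obtains \<delta> v where "lnd \<delta>" "v \<in> I" "\<delta> v \<notin> J"
proof -
  from assms obtain d f where d: "LND (ring_of_type_algebra :: 'k ring) A d"
    and f: "f \<in> carrier A" "d f \<noteq> \<zero>\<^bsub>A\<^esub>" by (auto simp: rigid_def)
  have closed: "d (R p) \<in> R ` polys_in I" if "p \<in> polys_in I" for p
    using d that by (auto simp: LND_def derivation_def carrier_A)
  have add: "d (R (p + q)) = d (R p) \<oplus>\<^bsub>A\<^esub> d (R q)" if "p \<in> polys_in I" "q \<in> polys_in I" for p q
    using d that by (auto simp: LND_def derivation_def carrier_A A_ops(1)[symmetric])
  have mult: "d (R (p * q)) = (d (R p) \<otimes>\<^bsub>A\<^esub> R q) \<oplus>\<^bsub>A\<^esub> (R p \<otimes>\<^bsub>A\<^esub> d (R q))"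
    if "p \<in> polys_in I" "q \<in> polys_in I" for p q
    using d that by (auto simp: LND_def derivation_def carrier_A A_ops(2)[symmetric])
  have smult: "d (R (Cst c * p)) = c \<odot>\<^bsub>A\<^esub> d (R p)" if "p \<in> polys_in I" for c p
    using d that by (auto simp: LND_def derivation_def carrier_A carrier_K A_ops(3)[symmetric])
  have "\<exists>q. q \<in> polys_in I \<and> d (R (Var v)) = R q" if "v \<in> I" for v
    using closed[of "Var v"] that by auto
  then obtain D where D: "\<And>v. v \<in> I \<Longrightarrow> D v \<in> polys_in I \<and> d (R (Var v)) = R (D v)" by metis
  define \<delta> where "\<delta> v = (if v \<in> I then D v else 0)" for v
  have \<delta>: "\<delta> v \<in> polys_in I" for v using D by (simp add: \<delta>_def)
  have \<delta>0: "\<delta> v = 0" if "v \<notin> I" for v using that by (simp add: \<delta>_def)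
  have d1: "d (R 1) = R 0"
  proof -
    obtain e where e: "d (R 1) = R e" using closed[of 1] by auto
    have "R e = R (e + e)" using mult[of 1 1] by (simp add: e A_ops)
    hence "e - (e + e) \<in> J" using R_eq_iff by blast
    hence "e - 0 \<in> J" using J_rules(5) by fastforce
    thus ?thesis using e R_eq_iff[of e 0] by simp
  qed
  have dR: "d (R p) = R (mder \<delta> p)" if "p \<in> polys_in I" for p
    using that
  proof (induction p rule: polys_in_induct)
    case (Cst c)
    have "d (R (Cst c * 1)) = R (Cst c * 0)" using smult[of 1 c] d1 A_ops(3) by simp
    thus ?case by simp
  next
    case (add p q)
    thus ?case using \<open>\<And>p q. _ \<Longrightarrow> _ \<Longrightarrow> d (R (p + q)) = _\<close> by (simp add: A_ops)
  next
    case (Var p v)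
    have "d (R (Var v)) = R (\<delta> v)" using D Var by (simp add: \<delta>_def)
    thus ?case using Var mult[of p "Var v"] by (simp add: A_ops)
  qed
  have pin: "mder \<delta> p \<in> polys_in I" if "p \<in> polys_in I" for p
    by (rule mder_polys_in[OF that \<delta>])
  have dn: "(d ^^ k) (R p) = R ((mder \<delta> ^^ k) p) \<and> (mder \<delta> ^^ k) p \<in> polys_in I" if "p \<in> polys_in I" for k p
    by (induction k) (use that pin in \<open>auto simp: dR\<close>)
  have "mder \<delta> p \<in> J" if "p \<in> J" for p
  proof -
    obtain p' where p': "p' \<in> polys_in I" "p - p' \<in> J" "mder \<delta> p - mder \<delta> p' \<in> J"
      using outside_reduction[of \<delta> p] \<delta>0 by blast
    have "p' \<in> J" using J_rules(6)[OF that p'(2)] by simp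
    hence "R p' = R 0" by (simp add: R_eq_iff)
    hence "R (mder \<delta> p') = R (mder \<delta> 0)" using dR[OF p'(1)] dR[of 0] by simp
    hence "mder \<delta> p' \<in> J" by (simp add: R_eq_iff)
    thus ?thesis using J_rules(2)[OF p'(3)] by fastforce
  qed
  moreover have "\<exists>k. (mder \<delta> ^^ k) (Var v) \<in> J" if "v \<in> I" for v
  proof -
    have "R (Var v) \<in> carrier A" using that by (auto simp: carrier_A)
    then obtain k where "(d ^^ k) (R (Var v)) = \<zero>\<^bsub>A\<^esub>" using d unfolding LND_def by blast
    hence "R ((mder \<delta> ^^ k) (Var v)) = R 0" using dn[of "Var v" k] that by (simp add: A_ops)
    thus ?thesis by (auto simp: R_eq_iff)
  qed
  ultimately have lnd: "lnd \<delta>" using \<delta> \<delta>0 unfolding lnd_def by blast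
  have "\<exists>v\<in>I. \<delta> v \<notin> J"
  proof (rule ccontr)
    assume "\<not> ?thesis"
    hence z: "\<delta> v \<in> J" for v using \<delta>0[of v] J_rules(1) by (cases "v \<in> I") auto
    have "mder \<delta> p \<in> J" for p
    proof (induction p rule: mpoly_induct)
      case (Var p v)
      show ?case unfolding mder_mult mder_Var by (intro J_rules(2) J_rules(4)[OF Var] J_rules(3)[OF z])
    qed (simp_all add: J_rules)
    moreover obtain p where "p \<in> polys_in I" "f = R p" using f by (auto simp: carrier_A)
    ultimately show False using f(2) dR[of p] by (auto simp: A_ops R_eq_iff)
  qed
  thus thesis using that lnd by blast
qed

text \<open>Stability of the vanishing ideal \<open>J\<close> is geometric: the trinomial is
  constant along the flow, so the orbit of a point of \<open>V\<close> stays in \<open>V\<close>.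
  Hence for \<open>p\<close> in \<open>J\<close> the orbit polynomial is zero, and its linear
  coefficient is the value of the derivative of \<open>p\<close>.\<close>

lemma lnd_triangular:
  assumes pin: "\<And>v. \<delta> v \<in> polys_in I" and out: "\<And>v. v \<notin> I \<Longrightarrow> \<delta> v = 0"
    and nil: "\<And>v. \<exists>k. (mder \<delta> ^^ k) (Var v) = 0"
    and F: "mder \<delta> (\<Sum>i\<in>{0,1,2}. M i) = 0"
  shows "lnd \<delta>"
proof -
  have nilp: "\<exists>k. (mder \<delta> ^^ k) p = 0" for p
    by (rule nilpotent_polys_in[of UNIV, OF nil]) simp
  have nil_at: "nil_at \<delta> x" for x
    unfolding nil_at_def
  proof
    fix p obtain k where k: "(mder \<delta> ^^ k) p = 0" using nilp by blast
    have "(mder \<delta> ^^ m) p = 0" if "m \<ge> k" for m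
      using funpow_closed_le[of "{0}" "mder \<delta>" k p m] that k by auto
    thus "\<exists>k. \<forall>m\<ge>k. eval_mpoly ((mder \<delta> ^^ m) p) x = 0" by (intro exI[of _ k]) simp
  qed
  have const: "orb \<delta> x p = [:eval_mpoly p x:]" if "mder \<delta> p = 0" for x p
  proof (rule poly_eqI)
    fix k show "coeff (orb \<delta> x p) k = coeff [:eval_mpoly p x:] k"
      by (cases k) (simp_all add: coeff_orb[OF nil_at] funpow_swap1 that)
  qed
  have "mder \<delta> p \<in> J" if p: "p \<in> J" for p
    unfolding J_def
  proof safe
    fix x assume x: "x \<in> V"
    have in_V: "(\<lambda>v. poly (orb \<delta> x (Var v)) s) \<in> V" for s
    proof -
      have "eval_mpoly (\<Sum>i\<in>{0,1,2}. M i) (\<lambda>v. poly (orb \<delta> x (Var v)) s) = poly (orb \<delta> x (\<Sum>i\<in>{0,1,2}. M i)) s"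
        by (rule poly_orb[OF nil_at, symmetric])
      also have "\<dots> = 0" unfolding const[OF F] using x by (simp add: X_iff)
      finally show ?thesis using const[of "Var _" x] V_outside[OF x] out by (simp add: X_iff)
    qed
    have "poly (orb \<delta> x p) s = 0" for s
      unfolding poly_orb[OF nil_at, of x p] using p in_V by (auto simp: J_def)
    hence "orb \<delta> x p = 0" using poly_all_0_iff_0 by blast
    hence "coeff (orb \<delta> x p) 1 = 0" by simp
    thus "eval_mpoly (mder \<delta> p) x = 0" unfolding coeff_orb[OF nil_at] by simp
  qed
  moreover have "\<exists>k. (mder \<delta> ^^ k) (Var v) \<in> J" for v
    using nil[of v] J_rules(1) by metis
  ultimately show ?thesis using pin out unfolding lnd_def by blast
qed

definition Mrest :: "nat \<Rightarrow> nat \<Rightarrow> (nat \<times> nat, 'k) mpoly"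
  where "Mrest i a = (\<Prod>j\<in>{1..n i} - {a}. Var (i, j) ^ l i j)"

text \<open>The partial derivative of \<open>M i\<close> in the variable
  \<open>(i, a)\<close>.\<close>

definition dM :: "nat \<Rightarrow> nat \<Rightarrow> (nat \<times> nat, 'k) mpoly"
  where "dM i a = of_nat (l i a) * Var (i, a) ^ (l i a - 1) * Mrest i a"

lemma M_split: "a \<in> {1..n i} \<Longrightarrow> M i = Var (i, a) ^ l i a * Mrest i a"
  unfolding M_def Mrest_def by (rule prod.remove) auto

lemma polys_in_of_nat: "(of_nat k :: (nat \<times> nat, 'k) mpoly) \<in> polys_in S"
  by (induction k) (auto intro: polys_in_add)

lemma Mrest_polys_in: "(\<And>j. j \<in> {1..n i} \<Longrightarrow> j \<noteq> a \<Longrightarrow> (i, j) \<in> S) \<Longrightarrow> Mrest i a \<in> polys_in S"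
  unfolding Mrest_def by (intro polys_in_prod polys_in_power) auto

lemma dM_polys_in: "(\<And>j. j \<in> {1..n i} \<Longrightarrow> (i, j) \<in> S) \<Longrightarrow> a \<in> {1..n i} \<Longrightarrow> dM i a \<in> polys_in S"
  unfolding dM_def by (intro polys_in_mult polys_in_power polys_in_of_nat Mrest_polys_in) auto

lemma mder_M:
  assumes "a \<in> {1..n i}" "\<And>j. j \<in> {1..n i} \<Longrightarrow> j \<noteq> a \<Longrightarrow> \<delta> (i, j) = 0"
  shows "mder \<delta> (M i) = dM i a * \<delta> (i, a)"
proof -
  have "mder \<delta> (Mrest i a) = 0"
    unfolding Mrest_def using assms(2) by (intro mder_prod_kernel) (auto simp: mder_power)
  thus ?thesis unfolding M_split[OF assms(1)] dM_def by (simp add: mder_power mult_ac)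
qed

lemma mder_M_0:
  assumes "\<And>j. j \<in> {1..n i} \<Longrightarrow> \<delta> (i, j) = 0"
  shows "mder \<delta> (M i) = 0"
  unfolding M_def using assms by (intro mder_prod_kernel) (auto simp: mder_power)

lemma monomial_notin_J: "(\<And>j. j \<in> B \<Longrightarrow> j \<in> {1..n i}) \<Longrightarrow> i \<in> {0,1,2} \<Longrightarrow> finite B \<Longrightarrow> (\<Prod>j\<in>B. Var (i, j) ^ e j) \<notin> J"
  by (intro prod_notin_J) (auto simp: power_in_J Var_notin_J I_iff)

lemma M_notin_J: "i \<in> {0,1,2} \<Longrightarrow> M i \<notin> J"
  unfolding M_def by (intro monomial_notin_J) auto

text \<open>A Jacobian derivation in the variables \<open>(i, a)\<close> and \<open>(j, 1)\<close>:
  each goes, up to sign, to the partial derivative of the trinomial in the other, so the trinomial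
  is killed. As \<open>l i a = 1\<close>, the partial derivative in \<open>(i, a)\<close> involves
  neither variable, which makes the derivation triangular.\<close>

lemma not_rigid_linear:
  assumes ia: "i \<in> {0,1,2}" "a \<in> {1..n i}" "l i a = 1"
  shows "\<not> rigid I V"
proof -
  obtain j where j: "j \<in> {0,1,2}" "j \<noteq> i" "1 \<in> {1..n j}"
  proof (cases "i = 1")
    case True
    thus ?thesis using that[of 2] n2 by auto
  next
    case False
    thus ?thesis using that[of 1] n1 by auto
  qed
  define \<delta> where "\<delta> v = (if v = (i, a) then - dM j 1 else if v = (j, 1) then Mrest i a else 0)" for v
  let ?S = "I - {(i, a)}"
  have rest: "Mrest i a \<in> polys_in (I - {(i, a), (j, 1)})"
    using ia j by (intro Mrest_polys_in) (auto simp: I_iff)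
  have rest0: "mder \<delta> (Mrest i a) = 0"
    unfolding Mrest_def by (intro mder_prod_kernel) (use j in \<open>auto simp: mder_power \<delta>_def\<close>)
  have dMp: "dM j 1 \<in> polys_in ?S"
    using ia j by (intro dM_polys_in) (auto simp: I_iff)
  have nil1: "\<exists>k. (mder \<delta> ^^ k) (Var v) = 0" if "v \<noteq> (i, a)" for v
  proof (cases "v = (j, 1)")
    case True
    have "(mder \<delta> ^^ 2) (Var v) = 0" using True j rest0 by (simp add: \<delta>_def numeral_2_eq_2)
    thus ?thesis by blast
  next
    case False
    have "(mder \<delta> ^^ 1) (Var v) = 0" using that False by (simp add: \<delta>_def)
    thus ?thesis by blast
  qed
  obtain k where k: "(mder \<delta> ^^ k) (dM j 1) = 0"
    using nilpotent_polys_in[OF nil1 dMp] by blast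
  have "(mder \<delta> ^^ k) (- dM j 1) = 0" using k funpow_mder_diff[of k \<delta> 0 "dM j 1"] by simp
  hence "(mder \<delta> ^^ Suc k) (Var (i, a)) = 0" by (simp add: funpow_swap1 \<delta>_def)
  hence nil: "\<exists>k. (mder \<delta> ^^ k) (Var v) = 0" for v
    using nil1[of v] by (cases "v = (i, a)") (blast | simp only:)+
  have "lnd \<delta>"
  proof (rule lnd_triangular[OF _ _ nil])
    show "\<delta> v \<in> polys_in I" for v
      using polys_in_mono[OF rest] polys_in_mono[OF dMp] by (simp add: \<delta>_def)
    show "\<delta> v = 0" if "v \<notin> I" for v
      using that ia j by (auto simp: \<delta>_def I_iff)
    have "(\<Sum>k\<in>{0,1,2}. mder \<delta> (M k)) = (\<Sum>k\<in>{i,j}. mder \<delta> (M k))"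
    proof (intro sum.mono_neutral_right ballI)
      fix k assume "k \<in> {0,1,2} - {i,j}"
      thus "mder \<delta> (M k) = 0" by (intro mder_M_0) (auto simp: \<delta>_def)
    qed (use ia j in auto)
    also have "\<dots> = mder \<delta> (M i) + mder \<delta> (M j)" using j by simp
    also have "mder \<delta> (M i) = dM i a * (- dM j 1)"
      by (subst mder_M[OF ia(2)]) (use j in \<open>auto simp: \<delta>_def\<close>)
    also have "mder \<delta> (M j) = dM j 1 * Mrest i a"
      by (subst mder_M[OF j(3)]) (use j in \<open>auto simp: \<delta>_def\<close>)
    also have "dM i a = Mrest i a" using ia by (simp add: dM_def)
    finally show "mder \<delta> (\<Sum>i\<in>{0,1,2}. M i) = 0" by (simp add: mder_sum mult_ac del: sum.insert)
  qed
  moreover have "Mrest i a \<notin> J"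
    unfolding Mrest_def by (rule monomial_notin_J) (use ia in auto)
  hence "\<delta> (j, 1) \<notin> J" using j by (simp add: \<delta>_def)
  moreover have "(j, 1) \<in> I" using j by (simp add: I_iff)
  ultimately show ?thesis using not_rigid_if_lnd by blast
qed

text \<open>Here \<open>M i + M j = (A x)^2 + (B y)^2 = U (A x - \<iota> B y)\<close> with
  \<open>\<iota>^2 = -1\<close>. The derivation kills \<open>U\<close> and sends the other factor to
  \<open>-2 A B Q\<close>; the image of \<open>(k, 1)\<close> is chosen so that the derivative of
  \<open>M k\<close> cancels the resulting \<open>-2 A B Q U\<close>. The assumption on
  \<open>n 0\<close> provides a variable in block \<open>k\<close>.\<close>

lemma not_rigid_quadratic:
  assumes n0: "n 0 \<noteq> 0" and ij: "i \<in> {0,1,2}" "j \<in> {0,1,2}" "i \<noteq> j" "a \<in> {1..n i}" "b \<in> {1..n j}"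
    and two: "l i a = 2" "l j b = 2"
    and ev: "\<And>u. u \<in> {1..n i} \<Longrightarrow> even (l i u)" "\<And>u. u \<in> {1..n j} \<Longrightarrow> even (l j u)"
  shows "\<not> rigid I V"
proof -
  define k where "k = 3 - i - j"
  have k: "k \<in> {0,1,2}" "k \<noteq> i" "k \<noteq> j" "{0,1,2} = {i,j,k}" using ij unfolding k_def by auto
  have c: "1 \<in> {1..n k}" using k(1) n0 n1 n2 by auto
  obtain \<iota> :: 'k where \<iota>: "\<iota> ^ 2 = -1" using nth_root_exists[of 2 "-1 :: 'k"] by auto
  define H where "H i a = (\<Prod>u\<in>{1..n i} - {a}. Var (i, u) ^ (l i u div 2) :: (nat \<times> nat, 'k) mpoly)" for i a
  let ?A = "H i a" and ?B = "H j b" and ?x = "Var (i, a)" and ?y = "Var (j, b)" and ?i = "Cst \<iota>"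
  define U where "U = ?A * ?x + ?i * (?B * ?y)"
  let ?Q = "dM k 1"
  have ii: "?i * ?i = -1"
  proof -
    have "?i * ?i = Cst (\<iota> * \<iota>)" by (simp add: Cst_def mult_single)
    also have "\<iota> * \<iota> = -1" using \<iota> by (simp add: power2_eq_square)
    finally show ?thesis by (simp add: Cst_def single_uminus)
  qed
  define \<delta> where "\<delta> v = (if v = (i, a) then - (?B * ?Q) else if v = (j, b) then - (?i * (?A * ?Q))
    else if v = (k, 1) then 2 * (?A * ?B * U) else 0)" for v
  have \<delta>s: "\<delta> (i, a) = - (?B * ?Q)" "\<delta> (j, b) = - (?i * (?A * ?Q))" "\<delta> (k, 1) = 2 * (?A * ?B * U)"
    using ij k(1-3) by (auto simp: \<delta>_def)
  have A0: "mder \<delta> ?A = 0" unfolding H_def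
    by (intro mder_prod_kernel) (use ij k(1-3) in \<open>auto simp: mder_power \<delta>_def\<close>)
  have B0: "mder \<delta> ?B = 0" unfolding H_def
    by (intro mder_prod_kernel) (use ij k(1-3) in \<open>auto simp: mder_power \<delta>_def\<close>)
  have "mder \<delta> U = - (?A * ?B * ?Q) - (?i * ?i) * (?A * ?B * ?Q)"
    unfolding U_def by (simp add: A0 B0 \<delta>s algebra_simps)
  hence U0: "mder \<delta> U = 0" unfolding ii by simp
  have two0: "mder \<delta> (2 * p) = 2 * mder \<delta> p" for p
    using mder_add[of \<delta> p p] by (simp only: mult_2)
  have sq: "M i = ?x ^ 2 * ?A ^ 2" "M j = ?y ^ 2 * ?B ^ 2"
  proof -
    have "M i = Var (i, a) ^ 2 * H i a ^ 2"
      if "a \<in> {1..n i}" "l i a = 2" "\<And>u. u \<in> {1..n i} \<Longrightarrow> even (l i u)" for i a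
    proof -
      have "Mrest i a = H i a ^ 2"
        unfolding Mrest_def H_def prod_power_distrib
        using that(3) by (intro prod.cong refl) (auto simp flip: power_mult)
      thus ?thesis using M_split[OF that(1)] that(2) by simp
    qed
    thus "M i = ?x ^ 2 * ?A ^ 2" "M j = ?y ^ 2 * ?B ^ 2" using ij two ev by blast+
  qed
  let ?S = "I - {(i, a), (j, b)}"
  have pA: "?A \<in> polys_in ?S" "?B \<in> polys_in ?S" "?Q \<in> polys_in ?S"
  proof -
    show "?A \<in> polys_in ?S" "?B \<in> polys_in ?S" unfolding H_def
      using ij by (intro polys_in_prod polys_in_power; auto simp: I_iff)+
    show "?Q \<in> polys_in ?S" using k(1-3) c by (intro dM_polys_in) (auto simp: I_iff)
  qed
  have nil1: "\<exists>m. (mder \<delta> ^^ m) (Var v) = 0" if "v \<noteq> (i, a)" "v \<noteq> (j, b)" for v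
  proof (cases "v = (k, 1)")
    case True
    have "(mder \<delta> ^^ 2) (Var v) = mder \<delta> (2 * (?A * ?B * U))" using True \<delta>s by (simp add: numeral_2_eq_2)
    also have "\<dots> = 0" unfolding two0 by (simp add: A0 B0 U0)
    finally show ?thesis by blast
  next
    case False
    have "(mder \<delta> ^^ 1) (Var v) = 0" using that False by (simp add: \<delta>_def)
    thus ?thesis by blast
  qed
  have nil2: "\<exists>m. (mder \<delta> ^^ m) p = 0" if "p \<in> polys_in ?S" for p
    by (rule nilpotent_polys_in[OF nil1 that]) auto
  have nil: "\<exists>m. (mder \<delta> ^^ m) (Var v) = 0" for v
  proof (cases "v = (i, a) \<or> v = (j, b)")
    case True
    hence "\<delta> v \<in> polys_in ?S"
      using pA \<delta>s by (auto intro!: polys_in_mult)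
    then obtain m where "(mder \<delta> ^^ m) (\<delta> v) = 0" using nil2 by blast
    hence "(mder \<delta> ^^ Suc m) (Var v) = 0" by (simp add: funpow_swap1)
    thus ?thesis by blast
  qed (use nil1 in blast)
  have pAI: "?A \<in> polys_in I" "?B \<in> polys_in I" "?Q \<in> polys_in I" 
    using pA[THEN polys_in_mono, of I] by auto
  have "lnd \<delta>"
  proof (rule lnd_triangular[OF _ _ nil])
    have "U \<in> polys_in I" unfolding U_def using ij
      by (intro polys_in_add polys_in_mult pAI) (auto simp: I_iff)
    hence "2 * (?A * ?B * U) \<in> polys_in I" unfolding mult_2 by (intro polys_in_add polys_in_mult pAI)
    thus "\<delta> v \<in> polys_in I" for v
      using pAI by (auto simp: \<delta>_def intro!: polys_in_mult)
    show "\<delta> v = 0" if "v \<notin> I" for v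
      using that ij k(1-3) c by (auto simp: \<delta>_def I_iff)
    have "(\<Sum>k\<in>{0,1,2}. mder \<delta> (M k)) = mder \<delta> (M i) + (mder \<delta> (M j) + mder \<delta> (M k))"
      unfolding k(4) using ij k(1-3) by simp
    also have "mder \<delta> (M k) = ?Q * (2 * (?A * ?B * U))"
      by (subst mder_M[OF c]) (use ij k(1-3) in \<open>auto simp: \<delta>_def\<close>)
    also have "mder \<delta> (M i) = - (2 * ?x * ?A ^ 2 * ?B * ?Q)"
      unfolding sq by (simp add: mder_power A0 \<delta>s algebra_simps)
    also have "mder \<delta> (M j) = - (2 * ?i * ?y * ?A * ?B ^ 2 * ?Q)"
      unfolding sq by (simp add: mder_power B0 \<delta>s algebra_simps)
    finally show "mder \<delta> (\<Sum>i\<in>{0,1,2}. M i) = 0"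
      by (simp add: mder_sum U_def algebra_simps power2_eq_square del: sum.insert)
  qed
  \<comment> \<open>If \<open>U\<close> were in \<open>J\<close>, so would be its multiple
    \<open>M i + M j\<close>, and hence \<open>M k\<close>.\<close>
  moreover have "\<delta> (k, 1) \<notin> J"
  proof
    assume "\<delta> (k, 1) \<in> J"
    moreover have "?A \<notin> J" unfolding H_def by (rule monomial_notin_J) (use ij in auto)
    moreover have "?B \<notin> J" unfolding H_def by (rule monomial_notin_J) (use ij in auto)
    moreover have "(2 :: (nat \<times> nat, 'k) mpoly) \<notin> J"
    proof -
      have "(2 :: (nat \<times> nat, 'k) mpoly) = Cst 2" by (simp add: Cst_def)
      thus ?thesis using Cst_in_J[of 2] by (simp only:) simp
    qed
    ultimately have "U \<in> J" unfolding \<delta>s by (simp add: J_mult_iff)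
    hence "U * (?A * ?x - ?i * (?B * ?y)) \<in> J" by (rule J_rules)
    also have "U * (?A * ?x - ?i * (?B * ?y)) = (?A * ?x) ^ 2 - (?i * (?B * ?y)) ^ 2"
    proof -
      have "(p + q) * (p - q) = p ^ 2 - q ^ 2" for p q :: "(nat \<times> nat, 'k) mpoly"
        by (simp add: power2_eq_square algebra_simps)
      thus ?thesis unfolding U_def .
    qed
    also have "\<dots> = ?x ^ 2 * ?A ^ 2 - (?i * ?i) * (?y ^ 2 * ?B ^ 2)"
      by (simp only: power_mult_distrib power2_eq_square mult_ac)
    also have "\<dots> = M i + M j" unfolding ii sq by simp
    finally have "M i + M j \<in> J" .
    moreover have "M i + M j + M k \<in> J"
      using trinomial_in_J ij k(1-3) unfolding k(4) by (simp add: add_ac)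
    ultimately have "M k \<in> J" using J_rules(6)[of "M i + M j + M k" "M i + M j"] by simp
    thus False using M_notin_J k(1) by blast
  qed
  moreover have "(k, 1) \<in> I" using k(1-3) c by (simp add: I_iff)
  ultimately show ?thesis using not_rigid_if_lnd by blast
qed

end

section \<open>Homogenization\<close>

text \<open>The relation of exponents is stated additively because exponent vectors have only
  truncated subtraction.\<close>

lemma keys_mder:
  assumes "m' \<in> Poly_Mapping.keys (mder \<delta> p)"
  obtains m v k where "m \<in> Poly_Mapping.keys p" "k \<in> Poly_Mapping.keys (\<delta> v)"
    "m' + Poly_Mapping.single v 1 = m + k"
proof -
  from assms have "m' \<in> (\<Union>m\<in>Poly_Mapping.keys p. Poly_Mapping.keys (Cst (Poly_Mapping.lookup p m) * dmon \<delta> m))"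
    unfolding mder_def by (rule subsetD[OF keys_sum])
  then obtain m where m: "m \<in> Poly_Mapping.keys p" "m' \<in> Poly_Mapping.keys (Cst (Poly_Mapping.lookup p m) * dmon \<delta> m)"
    by blast
  have "m' \<in> Poly_Mapping.keys (dmon \<delta> m)"
    using m(2) keys_mult[of "Cst (Poly_Mapping.lookup p m)" "dmon \<delta> m"] by (auto simp: Cst_def split: if_splits)
  hence "m' \<in> (\<Union>v\<in>Poly_Mapping.keys m. Poly_Mapping.keys
      (Poly_Mapping.single (m - Poly_Mapping.single v 1) (of_nat (Poly_Mapping.lookup m v)) * \<delta> v))"
    unfolding dmon_def by (rule subsetD[OF keys_sum])
  then obtain v where v: "v \<in> Poly_Mapping.keys m" "m' \<in> Poly_Mapping.keys
      (Poly_Mapping.single (m - Poly_Mapping.single v 1) (of_nat (Poly_Mapping.lookup m v)) * \<delta> v)"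
    by blast
  then obtain k where k: "k \<in> Poly_Mapping.keys (\<delta> v)" "m' = m - Poly_Mapping.single v 1 + k"
    using keys_mult[of "Poly_Mapping.single (m - Poly_Mapping.single v 1) (of_nat (Poly_Mapping.lookup m v))" "\<delta> v"]
    by (auto split: if_splits)
  have "Poly_Mapping.lookup m v \<noteq> 0" using v(1) by (simp add: in_keys_iff)
  hence "m - Poly_Mapping.single v 1 + Poly_Mapping.single v 1 = m"
    by (intro poly_mapping_eqI) (auto simp: lookup_add lookup_minus lookup_single when_def)
  hence "m' + Poly_Mapping.single v 1 = m + k" unfolding k(2) by (metis add.commute add.left_commute)
  thus thesis using that m k by blast
qed

lemma mder_delta_diff: "mder (\<lambda>v. \<delta> v - \<delta>' v) p = mder \<delta> p - mder \<delta>' p"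
proof (induction p rule: mpoly_induct)
  case (add p q)
  show ?case unfolding mder_add add by simp
next
  case (Var p v)
  show ?case unfolding mder_mult mder_Var Var by (simp add: algebra_simps)
qed simp

text \<open>\<open>P\<close> may be zero, when all of \<open>p\<close> has weight below
  \<open>u\<close>; this keeps the notion stable under derivations.\<close>

definition lead :: "('v \<Rightarrow> int) \<Rightarrow> int \<Rightarrow> ('v, 'k::comm_ring_1) mpoly \<Rightarrow> ('v, 'k) mpoly \<Rightarrow> bool"
  where "lead w u p P \<longleftrightarrow> (\<forall>m\<in>Poly_Mapping.keys P. wt w m = u) \<and> (\<forall>m\<in>Poly_Mapping.keys (p - P). wt w m < u)"

lemma lead_wcomp:
  assumes "lead w u p P"
  shows "P = wcomp w u p"
proof (rule poly_mapping_eqI)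
  fix m
  show "Poly_Mapping.lookup P m = Poly_Mapping.lookup (wcomp w u p) m"
  proof (cases "wt w m = u")
    case True
    hence "m \<notin> Poly_Mapping.keys (p - P)" using assms by (auto simp: lead_def)
    thus ?thesis using True by (simp add: in_keys_iff lookup_minus lookup_wcomp)
  next
    case False
    hence "m \<notin> Poly_Mapping.keys P" using assms by (auto simp: lead_def)
    thus ?thesis using False by (simp add: in_keys_iff lookup_wcomp)
  qed
qed

lemma lead_self: "(\<And>m. m \<in> Poly_Mapping.keys p \<Longrightarrow> wt w m = u) \<Longrightarrow> lead w u p p"
  by (simp add: lead_def)

text \<open>Every term of the difference of the two derivatives has lost weight, either in the
  argument or in the values of the derivation.\<close>

lemma lead_mder:
  assumes p: "lead w u p P" and \<delta>: "\<And>v. lead w (w v + \<epsilon>) (\<delta> v) (\<delta>' v)"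
  shows "lead w (u + \<epsilon>) (mder \<delta> p) (mder \<delta>' P)"
  unfolding lead_def
proof safe
  fix m' assume "m' \<in> Poly_Mapping.keys (mder \<delta>' P)"
  then obtain m v k where "m \<in> Poly_Mapping.keys P" "k \<in> Poly_Mapping.keys (\<delta>' v)"
    and *: "m' + Poly_Mapping.single v 1 = m + k" by (rule keys_mder)
  hence "wt w m = u" "wt w k = w v + \<epsilon>" using p \<delta>[of v] by (auto simp: lead_def)
  moreover have "wt w m' + w v = wt w m + wt w k" using arg_cong[OF *, of "wt w"] by simp
  ultimately show "wt w m' = u + \<epsilon>" by simp
next
  fix m' assume m': "m' \<in> Poly_Mapping.keys (mder \<delta> p - mder \<delta>' P)"
  have eq: "mder \<delta> p - mder \<delta>' P = mder \<delta> (p - P) + mder (\<lambda>v. \<delta> v - \<delta>' v) P"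
    by (simp add: mder_delta_diff)
  have \<delta>le: "wt w k \<le> w v + \<epsilon>" if "k \<in> Poly_Mapping.keys (\<delta> v)" for k v
  proof -
    have "\<delta> v = (\<delta> v - \<delta>' v) + \<delta>' v" by simp
    hence "k \<in> Poly_Mapping.keys (\<delta> v - \<delta>' v) \<union> Poly_Mapping.keys (\<delta>' v)"
      using that keys_add[of "\<delta> v - \<delta>' v" "\<delta>' v"] by auto
    thus ?thesis using \<delta>[of v] by (auto simp: lead_def intro: less_imp_le)
  qed
  from m' have "m' \<in> Poly_Mapping.keys (mder \<delta> (p - P)) \<union> Poly_Mapping.keys (mder (\<lambda>v. \<delta> v - \<delta>' v) P)"
    unfolding eq by (rule subsetD[OF keys_add])
  then consider "m' \<in> Poly_Mapping.keys (mder \<delta> (p - P))" | "m' \<in> Poly_Mapping.keys (mder (\<lambda>v. \<delta> v - \<delta>' v) P)"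
    by blast
  thus "wt w m' < u + \<epsilon>"
  proof cases
    case 1
    then obtain m v k where "m \<in> Poly_Mapping.keys (p - P)" "k \<in> Poly_Mapping.keys (\<delta> v)"
      and *: "m' + Poly_Mapping.single v 1 = m + k" by (rule keys_mder)
    hence "wt w m < u" "wt w k \<le> w v + \<epsilon>" using p \<delta>le by (auto simp: lead_def)
    moreover have "wt w m' + w v = wt w m + wt w k" using arg_cong[OF *, of "wt w"] by simp
    ultimately show ?thesis by simp
  next
    case 2
    then obtain m v k where "m \<in> Poly_Mapping.keys P" "k \<in> Poly_Mapping.keys (\<delta> v - \<delta>' v)"
      and *: "m' + Poly_Mapping.single v 1 = m + k" by (rule keys_mder)
    hence "wt w m = u" "wt w k < w v + \<epsilon>" using p \<delta>[of v] by (auto simp: lead_def)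
    moreover have "wt w m' + w v = wt w m + wt w k" using arg_cong[OF *, of "wt w"] by simp
    ultimately show ?thesis by simp
  qed
qed

context trinomial
begin

definition hom :: "(nat \<times> nat \<Rightarrow> (nat \<times> nat, 'k) mpoly) \<Rightarrow> (nat \<times> nat \<Rightarrow> int) \<Rightarrow> bool"
  where "hom \<delta> w \<longleftrightarrow> (\<exists>\<epsilon>. \<forall>v. \<forall>m\<in>Poly_Mapping.keys (\<delta> v). wt w m = w v + \<epsilon>)"

lemma J_if_wcomp: "(\<And>u. wcomp w u p \<in> J) \<Longrightarrow> p \<in> J"
  by (subst wcomp_sum[of w p, symmetric]) (rule poly_ideal_sum[OF J_ideal])

text \<open>The classical passage to the leading component, complicated by working modulo
  \<open>J\<close>: components of \<open>\<delta>\<close> of higher degree may be nonzero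
  polynomials that lie in \<open>J\<close>. They are discarded first; as \<open>J\<close> is graded,
  stability and nilpotency then pass to the leading component.\<close>

lemma homogenize_step:
  assumes lnd: "lnd \<delta>" and nz: "v0 \<in> I" "\<delta> v0 \<notin> J" and w: "admissible w"
  obtains \<delta>' v' where "lnd \<delta>'" "v' \<in> I" "\<delta>' v' \<notin> J" "hom \<delta>' w"
    "\<And>v. Poly_Mapping.keys (\<delta>' v) \<subseteq> Poly_Mapping.keys (\<delta> v)"
proof -
  \<comment> \<open>The weight shifts of the components that are nonzero modulo \<open>J\<close>;
    their maximum is the degree of the leading component.\<close>
  define E where "E = {u - w v |u v. v \<in> I \<and> wcomp w u (\<delta> v) \<notin> J}"
  have "E \<subseteq> (\<lambda>(v, m). wt w m - w v) ` (SIGMA v:I. Poly_Mapping.keys (\<delta> v))"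
  proof
    fix e assume "e \<in> E"
    then obtain u v where e: "e = u - w v" "v \<in> I" "wcomp w u (\<delta> v) \<notin> J" by (auto simp: E_def)
    hence "wcomp w u (\<delta> v) \<noteq> 0" using J_rules(1) by metis
    hence "Poly_Mapping.keys (wcomp w u (\<delta> v)) \<noteq> {}" by simp
    then obtain m where "m \<in> Poly_Mapping.keys (\<delta> v)" "wt w m = u" unfolding keys_wcomp by auto
    thus "e \<in> (\<lambda>(v, m). wt w m - w v) ` (SIGMA v:I. Poly_Mapping.keys (\<delta> v))"
      using e by (intro image_eqI[of _ _ "(v, m)"]) auto
  qed
  hence finE: "finite E" by (rule finite_subset) (simp add: finite_I)
  obtain u0 where "wcomp w u0 (\<delta> v0) \<notin> J" using nz(2) J_if_wcomp by blast
  hence "u0 - w v0 \<in> E" using nz(1) unfolding E_def by blast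
  hence neE: "E \<noteq> {}" by blast
  define \<epsilon> where "\<epsilon> = Max E"
  have top: "wcomp w u (\<delta> v) \<in> J" if "u > w v + \<epsilon>" for u v
  proof (cases "v \<in> I")
    case True
    show ?thesis
    proof (rule ccontr)
      assume "wcomp w u (\<delta> v) \<notin> J"
      hence "u - w v \<in> E" using True unfolding E_def by blast
      hence "u - w v \<le> \<epsilon>" unfolding \<epsilon>_def using finE by simp
      thus False using that by simp
    qed
  next
    case False
    thus ?thesis using lnd_outside[OF lnd False] J_rules(1) by (simp add: wcomp_def)
  qed
  \<comment> \<open>\<open>\<delta>1\<close> agrees with \<open>\<delta>\<close> modulo
    \<open>J\<close> and has no term of shift above \<open>\<epsilon>\<close>, so
    \<open>\<delta>'\<close> is its leading component as polynomials.\<close>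
  define \<delta>1 where "\<delta>1 v = (\<Sum>u\<in>{u\<in>wt w ` Poly_Mapping.keys (\<delta> v). u \<le> w v + \<epsilon>}. wcomp w u (\<delta> v))" for v
  define \<delta>' where "\<delta>' v = wcomp w (w v + \<epsilon>) (\<delta> v)" for v
  have diff: "\<delta> v - \<delta>1 v \<in> J" for v
  proof -
    have "\<delta> v = (\<Sum>u\<in>wt w ` Poly_Mapping.keys (\<delta> v). wcomp w u (\<delta> v))" by (rule wcomp_sum[symmetric])
    also have "\<dots> = (\<Sum>u\<in>wt w ` Poly_Mapping.keys (\<delta> v) - {u\<in>wt w ` Poly_Mapping.keys (\<delta> v). u \<le> w v + \<epsilon>}. wcomp w u (\<delta> v)) + \<delta>1 v"
      unfolding \<delta>1_def by (rule sum.subset_diff) auto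
    finally have "\<delta> v - \<delta>1 v = (\<Sum>u\<in>wt w ` Poly_Mapping.keys (\<delta> v) - {u\<in>wt w ` Poly_Mapping.keys (\<delta> v). u \<le> w v + \<epsilon>}. wcomp w u (\<delta> v))"
      by (subst diff_eq_eq)
    also have "\<dots> \<in> J" by (rule poly_ideal_sum[OF J_ideal], rule top) auto
    finally show ?thesis .
  qed
  have D_diff: "mder \<delta> p - mder \<delta>1 p \<in> J" for p
    unfolding mder_delta_diff[symmetric]
  proof (induction p rule: mpoly_induct)
    case (Var p v)
    show ?case unfolding mder_mult mder_Var by (intro J_rules(2) J_rules(4)[OF Var] J_rules(3)[OF diff])
  qed (simp_all add: J_rules)
  have D1_J: "mder \<delta>1 p \<in> J" if "p \<in> J" for p
    using J_rules(6)[OF lnd_J[OF lnd that] D_diff[of p]] by simp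
  have D1_pow: "(mder \<delta> ^^ k) p - (mder \<delta>1 ^^ k) p \<in> J" for k p
  proof (induction k)
    case 0
    show ?case using J_rules(1) by simp
  next
    case (Suc k)
    have "(mder \<delta> ((mder \<delta> ^^ k) p) - mder \<delta>1 ((mder \<delta> ^^ k) p)) + mder \<delta>1 ((mder \<delta> ^^ k) p - (mder \<delta>1 ^^ k) p) \<in> J"
      by (intro J_rules(2) D_diff D1_J Suc)
    thus ?case by simp
  qed
  have keys1: "Poly_Mapping.keys (\<delta>1 v) \<subseteq> {m. wt w m \<le> w v + \<epsilon>}" for v
    unfolding \<delta>1_def by (rule subset_trans[OF keys_sum]) (auto simp: keys_wcomp)
  have look1: "Poly_Mapping.lookup (\<delta>1 v) m = (if wt w m \<le> w v + \<epsilon> then Poly_Mapping.lookup (\<delta> v) m else 0)" for v m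
  proof -
    have "Poly_Mapping.lookup (\<delta>1 v) m = (\<Sum>u\<in>{u\<in>wt w ` Poly_Mapping.keys (\<delta> v). u \<le> w v + \<epsilon>}.
        if u = wt w m then Poly_Mapping.lookup (\<delta> v) m else 0)"
      unfolding \<delta>1_def lookup_sum lookup_wcomp by (intro sum.cong) auto
    thus ?thesis by (auto simp: in_keys_iff)
  qed
  have lead: "lead w (w v + \<epsilon>) (\<delta>1 v) (\<delta>' v)" for v
    unfolding lead_def \<delta>'_def keys_wcomp
    by (auto simp: in_keys_iff lookup_minus lookup_wcomp look1 split: if_splits)
  have lead_pow: "lead w (w v + int k * \<epsilon>) ((mder \<delta>1 ^^ k) (Var v)) ((mder \<delta>' ^^ k) (Var v))" for k v
  proof (induction k)
    case 0
    show ?case by (auto simp: Var_def intro!: lead_self split: if_splits)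
  next
    case (Suc k)
    from lead_mder[OF Suc lead] show ?case by (simp add: algebra_simps)
  qed
  have D'_J: "mder \<delta>' p \<in> J" if "p \<in> J" for p
  proof -
    have "mder \<delta>' (wcomp w u p) \<in> J" for u
    proof -
      have "lead w u (wcomp w u p) (wcomp w u p)" by (rule lead_self) (simp add: keys_wcomp)
      from lead_wcomp[OF lead_mder[OF this lead]]
      show ?thesis using J_wcomp[OF w] D1_J[OF J_wcomp[OF w that]] by metis
    qed
    hence "(\<Sum>u\<in>wt w ` Poly_Mapping.keys p. mder \<delta>' (wcomp w u p)) \<in> J"
      by (intro poly_ideal_sum[OF J_ideal])
    thus ?thesis unfolding mder_sum[symmetric] wcomp_sum .
  qed
  have keys': "Poly_Mapping.keys (\<delta>' v) \<subseteq> Poly_Mapping.keys (\<delta> v)" for v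
    by (auto simp: \<delta>'_def keys_wcomp)
  have "\<delta>' v \<in> polys_in I" for v
    using keys'[of v] lnd_polys_in[OF lnd, of v] by (auto simp: polys_in_def)
  moreover have "\<delta>' v = 0" if "v \<notin> I" for v
    using lnd_outside[OF lnd that] by (simp add: \<delta>'_def wcomp_def)
  moreover have "\<exists>k. (mder \<delta>' ^^ k) (Var v) \<in> J" for v
  proof -
    obtain k where k: "(mder \<delta> ^^ k) (Var v) \<in> J" using lnd_nilpotent[OF lnd] by blast
    have "(mder \<delta>1 ^^ k) (Var v) \<in> J" using J_rules(6)[OF k D1_pow[of k "Var v"]] by simp
    hence "(mder \<delta>' ^^ k) (Var v) \<in> J" using lead_wcomp[OF lead_pow[of v k]] J_wcomp[OF w] by metis
    thus ?thesis by blast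
  qed
  ultimately have "lnd \<delta>'" using D'_J unfolding lnd_def by blast
  moreover have "\<exists>v\<in>I. \<delta>' v \<notin> J"
  proof -
    have "\<epsilon> \<in> E" unfolding \<epsilon>_def using finE neE by (rule Max_in)
    then obtain u v where uv: "\<epsilon> = u - w v" "v \<in> I" "wcomp w u (\<delta> v) \<notin> J" by (auto simp: E_def)
    have "\<delta>' v = wcomp w u (\<delta> v)" using uv(1) by (simp add: \<delta>'_def)
    thus ?thesis using uv(2,3) by metis
  qed
  moreover have "hom \<delta>' w" unfolding hom_def
    by (rule exI[of _ \<epsilon>]) (simp add: \<delta>'_def keys_wcomp)
  ultimately show thesis using that keys' by blast
qed

text \<open>Taking a component only removes monomials, so homogeneity for the weights treated before
  survives.\<close>

lemma homogenize:
  assumes "finite W" "\<And>w. w \<in> W \<Longrightarrow> admissible w"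
    and "lnd \<delta>" "v \<in> I" "\<delta> v \<notin> J"
  shows "\<exists>\<delta>' v'. lnd \<delta>' \<and> v' \<in> I \<and> \<delta>' v' \<notin> J \<and> (\<forall>w\<in>W. hom \<delta>' w)"
  using assms(1,2)
proof (induction W rule: finite_induct)
  case empty
  thus ?case using assms by blast
next
  case (insert w W)
  have "\<exists>\<delta>' v'. lnd \<delta>' \<and> v' \<in> I \<and> \<delta>' v' \<notin> J \<and> (\<forall>w\<in>W. hom \<delta>' w)"
    by (rule insert.IH) (rule insert.prems, simp)
  then obtain \<delta>1 v1 where 1: "lnd \<delta>1" "v1 \<in> I" "\<delta>1 v1 \<notin> J" "\<forall>w\<in>W. hom \<delta>1 w" by blast
  have "admissible w" by (rule insert.prems) simp
  from homogenize_step[OF 1(1-3) this]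
  obtain \<delta>' v' where 2: "lnd \<delta>'" "v' \<in> I" "\<delta>' v' \<notin> J" "hom \<delta>' w"
    "\<And>v. Poly_Mapping.keys (\<delta>' v) \<subseteq> Poly_Mapping.keys (\<delta>1 v)" by metis
  have "hom \<delta>' w'" if "w' \<in> W" for w'
  proof -
    from 1(4) that obtain \<epsilon> where "\<forall>v. \<forall>m\<in>Poly_Mapping.keys (\<delta>1 v). wt w' m = w' v + \<epsilon>"
      unfolding hom_def by blast
    hence "\<forall>v. \<forall>m\<in>Poly_Mapping.keys (\<delta>' v). wt w' m = w' v + \<epsilon>" using 2(5) by blast
    thus ?thesis unfolding hom_def by blast
  qed
  hence "\<forall>x\<in>insert w W. hom \<delta>' x" using 2(4) by simp
  thus ?case using 2(1-3) by (intro exI conjI)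
qed

end

section \<open>The Mason--Stothers inequality\<close>

text \<open>The Wronskian \<open>W\<close> is, up to sign, the same for any two of the three
  polynomials, so every \<open>g\<close> divides it; coprimality lets their product divide it. Its
  degree is at most \<open>degree m0 + degree m1 - 1\<close>.\<close>

lemma mason_stothers_radical:
  fixes m0 m1 m2 :: "'k::{alg_closed_field, field_char_0} poly"
  assumes sum: "m0 + m1 + m2 = 0"
    and dvd: "g0 dvd m0" "g0 dvd pderiv m0" "g1 dvd m1" "g1 dvd pderiv m1" "g2 dvd m2" "g2 dvd pderiv m2"
    and nz: "m0 \<noteq> 0" "m1 \<noteq> 0" "m2 \<noteq> 0"
    and coprime: "\<And>a. \<not> (poly m0 a = 0 \<and> poly m1 a = 0)"
    and nonconst: "\<not> (degree m0 = 0 \<and> degree m1 = 0)"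
  shows "degree g0 + degree g1 + degree g2 + 1 \<le> degree m0 + degree m1"
proof -
  define W where "W = m0 * pderiv m1 - m1 * pderiv m0"
  have m2: "m2 = - (m0 + m1)" using minus_unique[OF sum] by simp
  have W2: "W = m2 * pderiv m0 - m0 * pderiv m2"
    by (simp add: W_def m2 pderiv_minus pderiv_add pderiv_diff algebra_simps)
  have W_nz: "W \<noteq> 0"
  proof
    assume "W = 0"
    hence eq: "m0 * pderiv m1 = m1 * pderiv m0" by (simp add: W_def)
    \<comment> \<open>At a root of \<open>p\<close> the left side vanishes at least to the order of
      \<open>p\<close>, the right side to exactly one order less, as \<open>q\<close> is nonzero
      there.\<close>
    have H: False if pq: "p * pderiv q = q * pderiv p" "degree p > 0" "q \<noteq> 0"
      "\<And>a. \<not> (poly p a = 0 \<and> poly q a = 0)" for p q :: "'k poly"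
    proof -
      obtain a where a: "poly p a = 0" using alg_closed_imp_poly_has_root[OF pq(2)] by blast
      have p0: "p \<noteq> 0" "pderiv p \<noteq> 0" using pq(2) pderiv_eq_0_iff[of p] by auto
      have oq: "order a q = 0" using pq(4)[of a] a by (intro order_0I) auto
      have "q * pderiv p \<noteq> 0" using p0 pq(3) by simp
      hence "order a (q * pderiv p) = order a (pderiv p)" by (simp add: order_mult oq)
      moreover have "p * pderiv q \<noteq> 0" using \<open>q * pderiv p \<noteq> 0\<close> pq(1) by simp
      hence "order a (p * pderiv q) \<ge> order a p" by (simp add: order_mult)
      moreover have "order a p = Suc (order a (pderiv p))"
        using order_pderiv[of p a] p0 a by simp
      ultimately show False using pq(1) by simp
    qed
    show False
    proof (cases "degree m0 = 0")
      case True
      hence "degree m1 > 0" using nonconst by simp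
      show False by (rule H[OF eq[symmetric] \<open>degree m1 > 0\<close> nz(1)]) (use coprime in auto)
    next
      case False
      hence "degree m0 > 0" by simp
      show False by (rule H[OF eq \<open>degree m0 > 0\<close> nz(2)]) (use coprime in auto)
    qed
  qed
  have g: "g0 \<noteq> 0" "g1 \<noteq> 0" "g2 \<noteq> 0" using dvd nz by auto
  have gW: "g0 dvd W" "g1 dvd W" "g2 dvd W"
  proof -
    show "g0 dvd W" "g1 dvd W" unfolding W_def using dvd by auto
    show "g2 dvd W" unfolding W2 using dvd by auto
  qed
  have "order a (g0 * g1 * g2) \<le> order a W" for a
  proof -
    have o: "order a g0 \<le> order a m0" "order a g1 \<le> order a m1" "order a g2 \<le> order a m2"
      using dvd nz by (auto intro: dvd_imp_order_le)
    have oW: "order a g0 \<le> order a W" "order a g1 \<le> order a W" "order a g2 \<le> order a W"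
      using gW W_nz by (auto intro: dvd_imp_order_le)
    have z: "order a m = 0" if "poly m a \<noteq> 0" for m using that by (rule order_0I)
    have p2: "poly m2 a = - (poly m0 a + poly m1 a)" by (simp add: m2)
    have oG: "order a (g0 * g1 * g2) = order a g0 + order a g1 + order a g2"
      using g by (simp add: order_mult)
    show ?thesis
    proof (cases "poly m0 a = 0")
      case True
      hence "poly m1 a \<noteq> 0" "poly m2 a \<noteq> 0" using coprime[of a] p2 by auto
      thus ?thesis using z[of m1] z[of m2] o oW oG by simp
    next
      case m0: False
      show ?thesis
      proof (cases "poly m1 a = 0")
        case True
        hence "poly m2 a \<noteq> 0" using m0 p2 by simp
        thus ?thesis using z[OF m0] z[of m2] o oW oG by simp
      next
        case False
        thus ?thesis using z[OF m0] z[of m1] o oW oG by simp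
      qed
    qed
  qed
  hence "g0 * g1 * g2 dvd W" using g W_nz by (intro alg_closed_dvdI) auto
  hence "degree (g0 * g1 * g2) \<le> degree W" using W_nz by (rule dvd_imp_degree_le)
  hence "degree g0 + degree g1 + degree g2 \<le> degree W" using g by (simp add: degree_mult_eq)
  also have "degree W \<le> degree m0 + degree m1 - 1"
  proof -
    have *: "degree (p * pderiv q) \<le> degree p + degree q - 1" for p q :: "'k poly"
    proof (cases "degree q = 0")
      case True
      hence "pderiv q = 0" using pderiv_eq_0_iff by blast
      thus ?thesis by simp
    next
      case False
      have "degree (p * pderiv q) \<le> degree p + degree (pderiv q)" by (rule degree_mult_le)
      thus ?thesis using False by (simp add: degree_pderiv)
    qed
    show ?thesis unfolding W_def
      using *[of m0 m1] *[of m1 m0] by (intro degree_diff_le) (auto simp: add.commute)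
  qed
  finally show ?thesis using nonconst by linarith
qed

lemma power_pred_dvd_pderiv: "p ^ (k - 1) dvd pderiv (p ^ k :: 'k::field_char_0 poly)"
  by (cases k) (auto simp: pderiv_power_Suc dvd_smult simp del: power_Suc)

text \<open>Lowering all exponents by one gives the divisor used in Mason--Stothers; the cofactor is
  the product of the bases, whose degree takes the place of the number of distinct roots.\<close>

lemma prod_power_pred_dvd:
  fixes t :: "'j \<Rightarrow> 'k::field_char_0 poly"
  assumes "finite B"
  shows "(\<Prod>j\<in>B. t j ^ (e j - 1)) dvd (\<Prod>j\<in>B. t j ^ e j)"
    and "(\<Prod>j\<in>B. t j ^ (e j - 1)) dvd pderiv (\<Prod>j\<in>B. t j ^ e j)"
proof -
  show 1: "(\<Prod>j\<in>B. t j ^ (e j - 1)) dvd (\<Prod>j\<in>B. t j ^ e j)" for B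
    by (intro prod_dvd_prod) (auto intro: le_imp_power_dvd)
  show "(\<Prod>j\<in>B. t j ^ (e j - 1)) dvd pderiv (\<Prod>j\<in>B. t j ^ e j)"
    using assms
  proof (induction B rule: finite_induct)
    case (insert b B)
    have "t b ^ (e b - 1) * (\<Prod>j\<in>B. t j ^ (e j - 1)) dvd
      t b ^ e b * pderiv (\<Prod>j\<in>B. t j ^ e j) + (\<Prod>j\<in>B. t j ^ e j) * pderiv (t b ^ e b)"
    proof (rule dvd_add)
      show "t b ^ (e b - 1) * (\<Prod>j\<in>B. t j ^ (e j - 1)) dvd t b ^ e b * pderiv (\<Prod>j\<in>B. t j ^ e j)"
        by (intro mult_dvd_mono insert.IH le_imp_power_dvd) simp
      show "t b ^ (e b - 1) * (\<Prod>j\<in>B. t j ^ (e j - 1)) dvd (\<Prod>j\<in>B. t j ^ e j) * pderiv (t b ^ e b)"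
        unfolding mult.commute[of "\<Prod>j\<in>B. t j ^ e j"] by (intro mult_dvd_mono 1 power_pred_dvd_pderiv)
    qed
    thus ?case using insert by (simp add: pderiv_mult)
  qed simp
qed

text \<open>The three blocks are pairwise coprime since their sum vanishes.\<close>

lemma mason_stothers_blocks:
  fixes t :: "nat \<Rightarrow> 'j \<Rightarrow> 'k::{alg_closed_field, field_char_0} poly" and e :: "nat \<Rightarrow> 'j \<Rightarrow> nat"
    and B :: "nat \<Rightarrow> 'j set"
  defines "m \<equiv> \<lambda>i. \<Prod>j\<in>B i. t i j ^ e i j"
  assumes fin: "\<And>i. i \<in> {0,1,2} \<Longrightarrow> finite (B i)"
    and t: "\<And>i j. i \<in> {0,1,2} \<Longrightarrow> j \<in> B i \<Longrightarrow> t i j \<noteq> 0"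
    and e: "\<And>i j. i \<in> {0,1,2} \<Longrightarrow> j \<in> B i \<Longrightarrow> e i j > 0"
    and sum: "m 0 + m 1 + m 2 = 0"
    and coprime: "\<And>a. \<not> (poly (m 0) a = 0 \<and> poly (m 1) a = 0)"
    and k: "k \<in> {0,1,2}" "degree (m k) > 0"
    and max: "\<And>i. i \<in> {0,1,2} \<Longrightarrow> degree (m i) \<le> degree (m k)"
  shows "degree (m k) + 1 \<le> (\<Sum>i\<in>{0,1,2}. \<Sum>j\<in>B i. degree (t i j))"
proof -
  define g where "g i = (\<Prod>j\<in>B i. t i j ^ (e i j - 1))" for i
  define S where "S i = (\<Sum>j\<in>B i. degree (t i j))" for i
  have m0: "m i \<noteq> 0" if "i \<in> {0,1,2}" for i
    unfolding m_def using t[OF that] fin[OF that] by auto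
  have dg: "degree (m i) = degree (g i) + S i" if i: "i \<in> {0,1,2}" for i
  proof -
    have "t i j ^ e i j = t i j ^ (e i j - 1) * t i j" if "j \<in> B i" for j
      using e[OF i that] by (cases "e i j") auto
    hence "m i = g i * (\<Prod>j\<in>B i. t i j)"
      unfolding m_def g_def prod.distrib[symmetric] by (intro prod.cong) auto
    moreover have "g i \<noteq> 0" "(\<Prod>j\<in>B i. t i j) \<noteq> 0"
      unfolding g_def using t[OF i] fin[OF i] by auto
    ultimately show ?thesis
      using t[OF i] by (simp add: degree_mult_eq degree_prod_eq_sum_degree S_def)
  qed
  have gd: "g i dvd m i" "g i dvd pderiv (m i)" if "i \<in> {0,1,2}" for i
    unfolding g_def m_def using prod_power_pred_dvd[OF fin[OF that]] by auto
  \<comment> \<open>The inequality is taken for the two blocks other than \<open>k\<close>: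
    subtracted from the sum of all three degrees it leaves \<open>degree (m k)\<close>.\<close>
  have ms: "degree (g 0) + degree (g 1) + degree (g 2) + 1 \<le> degree (m i) + degree (m j)"
    if "i \<in> {0,1,2}" "j \<in> {0,1,2}" "i \<noteq> j" "i \<noteq> k" "j \<noteq> k" for i j
  proof -
    have ijk: "{0,1,2} = {i,j,k}" using that k by auto
    have m_sum: "m i + m j + m k = 0"
    proof -
      have "(\<Sum>i\<in>{0,1,2}. m i) = m i + m j + m k" unfolding ijk using that by (simp add: add_ac)
      thus ?thesis using sum by (simp add: add_ac)
    qed
    have g_sum: "degree (g 0) + degree (g 1) + degree (g 2) = degree (g i) + degree (g j) + degree (g k)"
    proof -
      have "(\<Sum>i\<in>{0,1,2}. degree (g i)) = degree (g i) + degree (g j) + degree (g k)"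
        unfolding ijk using that by simp
      thus ?thesis by simp
    qed
    have cop: "\<not> (poly (m i) a = 0 \<and> poly (m j) a = 0)" for a
    proof
      assume z: "poly (m i) a = 0 \<and> poly (m j) a = 0"
      hence "poly (m k) a = 0" using arg_cong[OF m_sum, of "\<lambda>p. poly p a"] by simp
      hence "\<forall>i\<in>{0,1,2}. poly (m i) a = 0" unfolding ijk using z by simp
      thus False using coprime[of a] by simp
    qed
    have nc: "\<not> (degree (m i) = 0 \<and> degree (m j) = 0)"
    proof
      assume "degree (m i) = 0 \<and> degree (m j) = 0"
      hence "degree (m i + m j) = 0" using degree_add_le[of "m i" 0 "m j"] by simp
      moreover have "m k = - (m i + m j)" using minus_unique[OF m_sum] by simp
      ultimately show False using k(2) by (metis degree_minus less_irrefl)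
    qed
    show ?thesis unfolding g_sum
      by (rule mason_stothers_radical[OF m_sum _ _ _ _ _ _ _ _ _ cop nc]) (use gd m0 that k in auto)
  qed
  obtain i j where ij: "i \<in> {0,1,2}" "j \<in> {0,1,2}" "i \<noteq> j" "i \<noteq> k" "j \<noteq> k"
  proof -
    consider "k = 0" | "k = 1" | "k = 2" using k(1) by auto
    thus thesis by cases (use that[of 1 2] that[of 0 2] that[of 0 1] in auto)
  qed
  have ijk: "{0,1,2} = {i,j,k}" using ij k by auto
  have "(\<Sum>i\<in>{0,1,2}. degree (m i)) = degree (m i) + degree (m j) + degree (m k)"
    unfolding ijk using ij by simp
  moreover have "(\<Sum>i\<in>{0,1,2}. degree (m i)) = (\<Sum>i\<in>{0,1,2}. degree (g i)) + (\<Sum>i\<in>{0,1,2}. S i)"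
    unfolding sum.distrib[symmetric] by (intro sum.cong dg refl)
  moreover have "(\<Sum>i\<in>{0,1,2}. degree (g i)) + 1 \<le> degree (m i) + degree (m j)"
    using ms[OF ij] by simp
  ultimately show ?thesis unfolding S_def by linarith
qed

section \<open>Homogeneous elements, kernel elements and degree bounds along orbits\<close>

lemma prod_single: "(\<Prod>a\<in>A. Poly_Mapping.single (f a) (1 :: 'k::comm_ring_1)) = Poly_Mapping.single (\<Sum>a\<in>A. f a) 1"
  by (induction A rule: infinite_finite_induct) (auto simp: mult_single)

lemma Var_power: "Var v ^ k = Poly_Mapping.single (Poly_Mapping.single v k) 1"
  by (induction k) (auto simp: Var_def mult_single single_add[symmetric])

lemma eval_zero_if_keys:
  assumes "\<And>m. m \<in> Poly_Mapping.keys p \<Longrightarrow> \<exists>v. Poly_Mapping.lookup m v \<noteq> 0 \<and> y v = 0"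
  shows "eval_mpoly p y = 0"
  unfolding eval_mpoly_def
proof (intro sum.neutral ballI)
  fix m assume "m \<in> Poly_Mapping.keys p"
  then obtain v where "Poly_Mapping.lookup m v \<noteq> 0" "y v = 0" using assms by blast
  hence "(\<Prod>v\<in>Poly_Mapping.keys m. y v ^ Poly_Mapping.lookup m v) = 0"
    by (intro prod_zero bexI[of _ v]) (auto simp: in_keys_iff power_0_left)
  thus "Poly_Mapping.lookup p m * (\<Prod>v\<in>Poly_Mapping.keys m. y v ^ Poly_Mapping.lookup m v) = 0" by simp
qed

context trinomial
begin

definition mexp :: "nat \<Rightarrow> (nat \<times> nat) \<Rightarrow>\<^sub>0 nat"
  where "mexp i = (\<Sum>j\<in>{1..n i}. Poly_Mapping.single (i, j) (l i j))"

lemma M_single: "M i = Poly_Mapping.single (mexp i) 1"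
  unfolding M_def mexp_def Var_power by (rule prod_single)

lemma lookup_mexp: "Poly_Mapping.lookup (mexp i) (i', j) = (if i' = i \<and> j \<in> {1..n i} then l i j else 0)"
proof -
  have "Poly_Mapping.lookup (mexp i) (i', j) = (\<Sum>k\<in>{1..n i}. if k = j then (if i = i' then l i j else 0) else 0)"
    unfolding mexp_def lookup_sum lookup_single when_def by (intro sum.cong) auto
  thus ?thesis by auto
qed

lemma wt_sum: "wt w (sum f B) = (\<Sum>a\<in>B. wt w (f a))"
  by (induction B rule: infinite_finite_induct) auto

lemma wt_mexp: "wt w (mexp i) = (\<Sum>j\<in>{1..n i}. int (l i j) * w (i, j))"
  unfolding mexp_def wt_sum by simp

text \<open>Finitely many weights that span all admissible ones over the rationals, so that
  homogenising for them is a finite process.\<close>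

definition weights :: "(nat \<times> nat \<Rightarrow> int) set"
  where "weights = (\<Union>i\<in>{0,1,2}. \<Union>a\<in>{1..n i}. blk i a ` ({1..n i} - {a})) \<union> crs ` (\<Pi>\<^sub>E i\<in>{0,1,2}. {1..n i})"

lemma blk_in_weights: "i \<in> {0,1,2} \<Longrightarrow> a \<in> {1..n i} \<Longrightarrow> b \<in> {1..n i} \<Longrightarrow> a \<noteq> b \<Longrightarrow> blk i a b \<in> weights"
  unfolding weights_def by blast

lemma crs_in_weights: "a \<in> (\<Pi>\<^sub>E i\<in>{0,1,2}. {1..n i}) \<Longrightarrow> crs a \<in> weights"
  unfolding weights_def by blast

lemma finite_weights: "finite weights"
  unfolding weights_def by (intro finite_UnI finite_UN_I finite_imageI finite_PiE) auto

lemma admissible_weights: "w \<in> weights \<Longrightarrow> admissible w"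
  unfolding weights_def
proof (elim UnE UN_E imageE)
  fix i a b
  assume "i \<in> {0,1,2}" "a \<in> {1..n i}" "w = blk i a b" "b \<in> {1..n i} - {a}"
  thus "admissible w" using admissible_blk[of i a b] by simp
next
  fix a assume "a \<in> (\<Pi>\<^sub>E i\<in>{0,1,2}. {1..n i})" "w = crs a"
  thus "admissible w" using admissible_crs[of a] PiE_mem[of a "{0,1,2}" "\<lambda>i. {1..n i}"] by simp
qed

lemma wt_mexp_eq:
  assumes "w \<in> weights" "i \<in> {0,1,2}" "j \<in> {0,1,2}"
  shows "wt w (mexp i) = wt w (mexp j)"
proof -
  from admissible_weights[OF assms(1)] obtain k where "\<forall>i\<in>{0,1,2}. (\<Sum>j\<in>{1..n i}. int (l i j) * w (i, j)) = k"
    unfolding admissible_def by blast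
  thus ?thesis using assms unfolding wt_mexp by metis
qed

text \<open>Equality of degrees up to torsion. For exponent vectors supported in \<open>I\<close>,
  with three nonempty blocks, it says that \<open>m - m'\<close> is a rational, possibly not
  integral, combination of the vectors \<open>mexp i\<close> with coefficient sum zero.\<close>

definition same :: "((nat \<times> nat) \<Rightarrow>\<^sub>0 nat) \<Rightarrow> ((nat \<times> nat) \<Rightarrow>\<^sub>0 nat) \<Rightarrow> bool"
  where "same m m' \<longleftrightarrow> (\<forall>w\<in>weights. wt w m = wt w m')"

lemma same_mexp: "i \<in> {0,1,2} \<Longrightarrow> j \<in> {0,1,2} \<Longrightarrow> same (mexp i) (mexp j)"
  unfolding same_def using wt_mexp_eq by blast

definition homog :: "((nat \<times> nat) \<Rightarrow>\<^sub>0 nat) \<Rightarrow> (nat \<times> nat, 'k) mpoly \<Rightarrow> bool"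
  where "homog k p \<longleftrightarrow> p \<in> polys_in I \<and> (\<forall>m\<in>Poly_Mapping.keys p. same m k)"

lemma homog_add: "homog k p \<Longrightarrow> homog k q \<Longrightarrow> homog k (p + q)"
  unfolding homog_def using keys_add[of p q] by (auto intro: polys_in_add)

lemma homog_Cst_mult: "homog k p \<Longrightarrow> homog k (Cst c * p)"
  unfolding homog_def using keys_mult[of "Cst c" p] by (auto simp: Cst_def intro: polys_in_mult polys_in_const split: if_splits)

lemma mexp_keys: "i \<in> {0,1,2} \<Longrightarrow> Poly_Mapping.keys (mexp i) \<subseteq> I"
proof
  fix v assume "i \<in> {0,1,2}" "v \<in> Poly_Mapping.keys (mexp i)"
  thus "v \<in> I" by (cases v) (auto simp: in_keys_iff lookup_mexp I_iff split: if_splits)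
qed

lemma homog_M: "i \<in> {0,1,2} \<Longrightarrow> j \<in> {0,1,2} \<Longrightarrow> homog (mexp j) (M i)"
  unfolding M_single homog_def polys_in_def using mexp_keys same_mexp by auto

lemma same_mult_weight:
  assumes "same m m'" "i \<in> {0,1,2}" "a \<in> {1..n i}" "b \<in> {1..n i}"
  shows "(int (Poly_Mapping.lookup m (i, a)) - int (Poly_Mapping.lookup m' (i, a))) * int (l i b)
       = (int (Poly_Mapping.lookup m (i, b)) - int (Poly_Mapping.lookup m' (i, b))) * int (l i a)"
proof (cases "a = b")
  case False
  have *: "wt (blk i a b) k = int (Poly_Mapping.lookup k (i, a)) * int (l i b) - int (Poly_Mapping.lookup k (i, b)) * int (l i a)" for k
  proof -
    have "wt (blk i a b) k = (\<Sum>v\<in>Poly_Mapping.keys k \<union> {(i,a),(i,b)}. int (Poly_Mapping.lookup k v) * blk i a b v)"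
      by (rule wt_superset) auto
    also have "\<dots> = (\<Sum>v\<in>{(i,a),(i,b)}. int (Poly_Mapping.lookup k v) * blk i a b v)"
      by (rule sum.mono_neutral_right) (auto simp: blk_def)
    finally show ?thesis using False by (simp add: blk_def)
  qed
  have "wt (blk i a b) m = wt (blk i a b) m'"
    using assms blk_in_weights[OF assms(2-4) False] by (simp add: same_def)
  thus ?thesis unfolding * by (simp add: algebra_simps)
qed simp

lemma wt_crs:
  "wt (crs a) m = (\<Sum>i\<in>{0,1,2}. int (Poly_Mapping.lookup m (i, a i)) * (\<Prod>k\<in>{0,1,2} - {i}. int (l k (a k))))"
proof -
  let ?Z = "(\<lambda>i. (i, a i)) ` {0,1,2}"
  have "wt (crs a) m = (\<Sum>v\<in>Poly_Mapping.keys m \<union> ?Z. int (Poly_Mapping.lookup m v) * crs a v)"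
    by (rule wt_superset) auto
  also have "\<dots> = (\<Sum>v\<in>?Z. int (Poly_Mapping.lookup m v) * crs a v)"
    by (rule sum.mono_neutral_right) (auto simp: crs_def)
  also have "\<dots> = (\<Sum>i\<in>{0,1,2}. int (Poly_Mapping.lookup m (i, a i)) * crs a (i, a i))"
    by (rule sum.reindex_cong[where l = "\<lambda>i. (i, a i)"]) (auto simp: inj_on_def)
  also have "\<dots> = (\<Sum>i\<in>{0,1,2}. int (Poly_Mapping.lookup m (i, a i)) * (\<Prod>k\<in>{0,1,2} - {i}. int (l k (a k))))"
    by (intro sum.cong refl) (auto simp: crs_def)
  finally show ?thesis .
qed

text \<open>At this point a combination \<open>c1 * M 0 - c0 * M 1\<close> has the value
  \<open>c1\<close>, so it lies outside \<open>J\<close> when \<open>c1\<close> is nonzero.\<close>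

lemma plane_point: "\<exists>x\<in>V. eval_mpoly (M 0) x = 1 \<and> eval_mpoly (M 1) x = 0"
proof -
  have l: "l 1 1 > 0" "l 2 1 > 0" using l_pos[of 1 1] l_pos[of 2 1] n1 n2 by auto
  then obtain z where z: "z ^ l 2 1 = (-1 :: 'k)" using nth_root_exists by blast
  define x where "x v = (if v = (1,1) then 0 else if v = (2,1) then z else if v \<in> I then 1 else undefined)" for v
  have 1: "x v = 1" if "v \<in> I - {(1,1),(2,1)}" for v using that by (auto simp: x_def)
  have "eval_mpoly (M 0) x = 1"
    unfolding eval_M using 1 by (intro prod.neutral) (auto simp: I_iff)
  moreover have "eval_mpoly (M 1) x = 0" "eval_mpoly (M 2) x = -1"
    using prod_M_base[of 1 x, OF _ 1] prod_M_base[of 2 x, OF _ 1] z l by (auto simp: x_def)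
  moreover have "x v = undefined" if "v \<notin> I" for v
    using that n1 n2 by (auto simp: x_def I_iff)
  ultimately have "x \<in> V" by (simp add: X_iff)
  thus ?thesis using \<open>eval_mpoly (M 0) x = 1\<close> \<open>eval_mpoly (M 1) x = 0\<close> by blast
qed

end

locale homogeneous_lnd = trinomial n l V
  for n :: "nat \<Rightarrow> nat" and l :: "nat \<Rightarrow> nat \<Rightarrow> nat"
    and V :: "(nat \<times> nat \<Rightarrow> 'k::{alg_closed_field, field_char_0}) set" +
  fixes \<delta> :: "nat \<times> nat \<Rightarrow> (nat \<times> nat, 'k) mpoly" and v0
  assumes l2: "\<And>i j. i \<in> {0,1,2} \<Longrightarrow> j \<in> {1..n i} \<Longrightarrow> l i j \<ge> 2"
    and lnd: "lnd \<delta>" and v0: "v0 \<in> I" "\<delta> v0 \<notin> J"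
    and hom: "\<And>w. w \<in> weights \<Longrightarrow> hom \<delta> w"
begin

abbreviation D where "D \<equiv> mder \<delta>"

definition eps :: "(nat \<times> nat \<Rightarrow> int) \<Rightarrow> int"
  where "eps w = (SOME \<epsilon>. \<forall>v. \<forall>m\<in>Poly_Mapping.keys (\<delta> v). wt w m = w v + \<epsilon>)"

lemma eps: "w \<in> weights \<Longrightarrow> m \<in> Poly_Mapping.keys (\<delta> v) \<Longrightarrow> wt w m = w v + eps w"
  using someI_ex[OF hom[of w, unfolded hom_def]] unfolding eps_def by blast

lemma wt_D:
  assumes "w \<in> weights" "\<And>m. m \<in> Poly_Mapping.keys p \<Longrightarrow> wt w m = u" "m' \<in> Poly_Mapping.keys (D p)"
  shows "wt w m' = u + eps w"
proof -
  from assms(3) obtain m v k where "m \<in> Poly_Mapping.keys p" "k \<in> Poly_Mapping.keys (\<delta> v)"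
    and *: "m' + Poly_Mapping.single v 1 = m + k" by (rule keys_mder)
  hence "wt w m = u" "wt w k = w v + eps w" using assms eps by auto
  moreover have "wt w m' + w v = wt w m + wt w k" using arg_cong[OF *, of "wt w"] by simp
  ultimately show ?thesis by simp
qed

lemma wt_D_funpow:
  assumes "w \<in> weights" "\<And>m. m \<in> Poly_Mapping.keys p \<Longrightarrow> wt w m = u" "m' \<in> Poly_Mapping.keys ((D ^^ k) p)"
  shows "wt w m' = u + int k * eps w"
  using assms(3)
proof (induction k arbitrary: m')
  case (Suc k)
  have "m' \<in> Poly_Mapping.keys (D ((D ^^ k) p))" using Suc.prems by simp
  from wt_D[OF assms(1) Suc.IH this] show ?case by (simp add: algebra_simps)
qed (use assms(2) in auto)

lemma D_polys_in: "p \<in> polys_in I \<Longrightarrow> D p \<in> polys_in I"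
  using mder_polys_in lnd_polys_in[OF lnd] by blast

lemma D_funpow_polys_in: "p \<in> polys_in I \<Longrightarrow> (D ^^ k) p \<in> polys_in I"
  by (induction k) (auto intro: D_polys_in)

lemma homog_D_funpow:
  assumes "homog m0 p" "m1 \<in> Poly_Mapping.keys ((D ^^ k) p)"
  shows "homog m1 ((D ^^ k) p)"
  unfolding homog_def same_def
proof (intro conjI ballI)
  show "(D ^^ k) p \<in> polys_in I" using assms(1) D_funpow_polys_in by (simp add: homog_def)
  fix m w assume *: "m \<in> Poly_Mapping.keys ((D ^^ k) p)" "w \<in> weights"
  have p: "wt w m' = wt w m0" if "m' \<in> Poly_Mapping.keys p" for m'
    using assms(1) that *(2) by (simp add: homog_def same_def)
  show "wt w m = wt w m1"
    using wt_D_funpow[OF *(2) p *(1)] wt_D_funpow[OF *(2) p assms(2)] by simp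
qed

lemma kernel_mult: "D p \<in> J \<Longrightarrow> D q \<in> J \<Longrightarrow> D (p * q) \<in> J"
  unfolding mder_mult by (intro J_rules(2) J_rules(3,4))

lemma kernel_power: "D p \<in> J \<Longrightarrow> D (p ^ k) \<in> J"
  by (induction k) (simp_all only: power_0 power_Suc mder_1 J_rules kernel_mult)

lemma kernel_prod: "(\<And>a. a \<in> S \<Longrightarrow> D (f a) \<in> J) \<Longrightarrow> D (prod f S) \<in> J"
  by (induction S rule: infinite_finite_induct) (auto simp: J_rules simp del: mder_mult intro!: kernel_mult)

lemma notin_J_nonzero: "p \<notin> J \<Longrightarrow> Poly_Mapping.keys p \<noteq> {}"
  using J_rules(1) by auto

lemma single_key_eq:
  assumes "Poly_Mapping.keys p \<subseteq> {m}"
  shows "p = Poly_Mapping.single m (Poly_Mapping.lookup p m)"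
proof (rule poly_mapping_eqI)
  fix k show "Poly_Mapping.lookup p k = Poly_Mapping.lookup (Poly_Mapping.single m (Poly_Mapping.lookup p m)) k"
    using assms by (cases "k = m") (auto simp: lookup_single in_keys_iff when_def)
qed

text \<open>The weight \<open>crs a\<close> is positive exactly on the three chosen variables; if every homogeneous
  kernel element had weight zero, then \<open>M 0\<close> and \<open>M 1\<close> would have the same degree with respect to
  the derivation and proportional top derivatives.\<close>

lemma kernel_element_in_ideal:
  assumes a: "a \<in> (\<Pi>\<^sub>E i\<in>{0,1,2}. {1..n i})"
  shows "\<exists>b k. homog k b \<and> b \<notin> J \<and> D b \<in> J \<and>
    (\<forall>m\<in>Poly_Mapping.keys b. \<exists>i\<in>{0,1,2}. Poly_Mapping.lookup m (i, a i) \<noteq> 0)"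
proof (rule ccontr)
  assume no: "\<not> ?thesis"
  let ?w = "crs a"
  have w: "?w \<in> weights" using a by (rule crs_in_weights)
  have ai: "a i \<in> {1..n i}" if "i \<in> {0,1,2}" for i using PiE_mem[OF a that] .
  have la: "0 < int (l i (a i))" if "i \<in> {0,1,2}" for i using l_pos[OF that ai[OF that]] by simp
  define q where "q = (\<Prod>i\<in>{0,1,2}. int (l i (a i)))"
  have q: "q > 0" unfolding q_def by (rule prod_pos) (rule la)
  have wM: "wt ?w (mexp i) = q" if "i \<in> {0,1,2}" for i
    unfolding wt_mexp q_def using sum_crs[of i a, OF that ai[OF that]] .
  \<comment> \<open>By the negated claim some monomial of \<open>b\<close> avoids the three chosen
    variables, on which alone \<open>?w\<close> is supported; by homogeneity the other monomials
    have the same weight.\<close>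
  have zero: "wt ?w m = 0" if b: "homog k b" "b \<notin> J" "D b \<in> J" and m: "m \<in> Poly_Mapping.keys b" for b k m
  proof -
    have "\<not> (\<forall>m\<in>Poly_Mapping.keys b. \<exists>i\<in>{0,1,2}. Poly_Mapping.lookup m (i, a i) \<noteq> 0)"
    proof
      assume "\<forall>m\<in>Poly_Mapping.keys b. \<exists>i\<in>{0,1,2}. Poly_Mapping.lookup m (i, a i) \<noteq> 0"
      with b have "\<exists>b k. homog k b \<and> b \<notin> J \<and> D b \<in> J \<and>
        (\<forall>m\<in>Poly_Mapping.keys b. \<exists>i\<in>{0,1,2}. Poly_Mapping.lookup m (i, a i) \<noteq> 0)"
        by (intro exI conjI)
      thus False using no by (rule notE[rotated])
    qed
    then obtain m' where m': "m' \<in> Poly_Mapping.keys b" "\<forall>i\<in>{0,1,2}. Poly_Mapping.lookup m' (i, a i) = 0"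
      by auto
    have "wt ?w m' = 0" unfolding wt_crs by (rule sum.neutral) (use m'(2) in auto)
    moreover have "wt ?w m = wt ?w m'" using b(1) m m'(1) w by (simp add: homog_def same_def)
    ultimately show ?thesis by simp
  qed
  \<comment> \<open>The last derivative outside \<open>J\<close> is a kernel element and so has
    weight 0; since \<open>q > 0\<close>, this determines the degree \<open>e\<close>.\<close>
  have deg: "q + int e * eps ?w = 0" if p: "homog (mexp 0) p" "isdeg \<delta> p e" for p e
  proof -
    have nz: "(D ^^ e) p \<notin> J" "D ((D ^^ e) p) \<in> J" using p(2) by (simp_all add: isdeg_def)
    then obtain m where m: "m \<in> Poly_Mapping.keys ((D ^^ e) p)" using notin_J_nonzero by blast
    have "wt ?w m = 0" by (rule zero[OF homog_D_funpow[OF p(1) m] nz m])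
    moreover have "wt ?w m = q + int e * eps ?w"
    proof (rule wt_D_funpow[OF w _ m])
      fix m' assume "m' \<in> Poly_Mapping.keys p"
      hence "wt ?w m' = wt ?w (mexp 0)" using p(1) w by (simp add: homog_def same_def)
      thus "wt ?w m' = q" using wM[of 0] by simp
    qed
    ultimately show ?thesis by simp
  qed
  have hM: "homog (mexp 0) (M 0)" "homog (mexp 0) (M 1)" by (simp_all add: homog_M)
  obtain e e' where e: "isdeg \<delta> (M 0) e" "isdeg \<delta> (M 1) e'"
    using isdeg_exists[OF lnd M_notin_J, of 0] isdeg_exists[OF lnd M_notin_J, of 1] by auto
  have "int e * eps ?w = int e' * eps ?w"
    using deg[OF hM(1) e(1)] deg[OF hM(2) e(2)] by linarith
  moreover have eps0: "eps ?w \<noteq> 0" using deg[OF hM(1) e(1)] q by auto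
  ultimately have ee: "e' = e" by simp
  let ?b = "\<lambda>i. (D ^^ e) (M i)"
  have b: "?b 0 \<notin> J" "?b 1 \<notin> J" "D (?b 0) \<in> J" "D (?b 1) \<in> J" using e ee by (simp_all add: isdeg_def)
  obtain m where m: "m \<in> Poly_Mapping.keys (?b 0)" using notin_J_nonzero[OF b(1)] by blast
  \<comment> \<open>Weight 0 excludes the chosen variables; proportionality inside each block then
    makes the exponent vectors equal, so both top derivatives are multiples of one monomial.\<close>
  have keys: "Poly_Mapping.keys (?b i) \<subseteq> {m}" if i: "i \<in> {0,1}" for i
  proof
    fix m' assume m': "m' \<in> Poly_Mapping.keys (?b i)"
    have hi: "homog (mexp 0) (M i)" "?b i \<notin> J" "D (?b i) \<in> J" using i b hM by auto
    have wt0: "wt w k = wt w (mexp 0)" if "k \<in> Poly_Mapping.keys (M j)" "w \<in> weights" "j \<in> {0,1}" for w k j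
      using hM that by (auto simp: homog_def same_def)
    have same: "same m' m" unfolding same_def
    proof
      fix w assume w: "w \<in> weights"
      have "wt w m' = wt w (mexp 0) + int e * eps w"
        by (rule wt_D_funpow[OF w wt0[OF _ w i] m'])
      moreover have "wt w m = wt w (mexp 0) + int e * eps w"
        by (rule wt_D_funpow[OF w wt0[OF _ w, of _ 0] m]) auto
      ultimately show "wt w m' = wt w m" by simp
    qed
    have z: "Poly_Mapping.lookup k (j, a j) = 0" if "wt ?w k = 0" "j \<in> {0,1,2}" for k j
    proof -
      have "\<forall>j\<in>{0,1,2}. int (Poly_Mapping.lookup k (j, a j)) * (\<Prod>k\<in>{0,1,2} - {j}. int (l k (a k))) = 0"
        using that(1) unfolding wt_crs by (subst (asm) sum_nonneg_eq_0_iff) (auto intro!: mult_nonneg_nonneg prod_nonneg simp del: sum.insert)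
      moreover have "(\<Prod>k\<in>{0,1,2} - {j}. int (l k (a k))) > 0"
        by (rule prod_pos, rule la) simp
      moreover have "int (Poly_Mapping.lookup k (j, a j)) * (\<Prod>k\<in>{0,1,2} - {j}. int (l k (a k))) = 0"
        using calculation(1) that(2) by (rule bspec)
      ultimately show ?thesis by (metis mult_eq_0_iff less_irrefl of_nat_eq_0_iff)
    qed
    have w0: "wt ?w m = 0" "wt ?w m' = 0"
      using zero[OF homog_D_funpow[OF hM(1) m] b(1,3) m] zero[OF homog_D_funpow[OF hi(1) m'] hi(2,3) m'] by auto
    have inI: "Poly_Mapping.keys m \<subseteq> I" "Poly_Mapping.keys m' \<subseteq> I"
      using homog_D_funpow[OF hM(1) m] homog_D_funpow[OF hi(1) m'] m m' by (auto simp: homog_def polys_in_def)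
    have "m' = m"
    proof (rule poly_mapping_eqI)
      fix v show "Poly_Mapping.lookup m' v = Poly_Mapping.lookup m v"
      proof (cases "v \<in> I")
        case False
        hence "v \<notin> Poly_Mapping.keys m" "v \<notin> Poly_Mapping.keys m'" using inI by auto
        thus ?thesis by (simp add: in_keys_iff)
      next
        case True
        obtain j c where v: "v = (j, c)" by (cases v)
        hence j: "j \<in> {0,1,2}" "c \<in> {1..n j}" using True by (auto simp: I_iff)
        from same_mult_weight[OF same j ai[OF j(1)]]
        have "(int (Poly_Mapping.lookup m' v) - int (Poly_Mapping.lookup m v)) * int (l j (a j)) = 0"
          using z[OF w0(1) j(1)] z[OF w0(2) j(1)] v by simp
        thus ?thesis using l_pos[OF j(1) ai[OF j(1)]] by simp
      qed
    qed
    thus "m' \<in> {m}" by simp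
  qed
  define c0 c1 where "c0 = Poly_Mapping.lookup (?b 0) m" and "c1 = Poly_Mapping.lookup (?b 1) m"
  have bs: "?b 0 = Poly_Mapping.single m c0" "?b 1 = Poly_Mapping.single m c1"
    unfolding c0_def c1_def by (rule single_key_eq[OF keys], simp)+
  have c1: "c1 \<noteq> 0" using bs(2) b(2) J_rules(1) by auto
  \<comment> \<open>The coefficients make the \<open>e\<close>-th derivatives cancel, whereas
    \<open>deg\<close> forces \<open>r\<close> to have degree \<open>e\<close> as well.\<close>
  define r where "r = Cst c1 * M 0 + Cst (- c0) * M 1"
  have hr: "homog (mexp 0) r" unfolding r_def by (intro homog_add homog_Cst_mult hM)
  have Dr: "(D ^^ e) r = 0"
    unfolding r_def funpow_mder_add funpow_mder_Cst_mult bs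
    by (simp add: Cst_def mult_single single_add[symmetric] mult.commute)
  have rJ: "r \<notin> J"
  proof
    assume "r \<in> J"
    obtain x where "x \<in> V" "eval_mpoly (M 0) x = 1" "eval_mpoly (M 1) x = 0" using plane_point by blast
    moreover have "eval_mpoly r x = c1" using calculation by (simp add: r_def)
    ultimately show False using \<open>r \<in> J\<close> c1 by (auto simp: J_def)
  qed
  obtain e'' where e'': "isdeg \<delta> r e''" using isdeg_exists[OF lnd rJ] by blast
  hence "int e'' * eps ?w = int e * eps ?w" using deg[OF hr e''] deg[OF hM(1) e(1)] by linarith
  hence "e'' = e" using eps0 by simp
  thus False using e'' Dr J_rules(1) by (simp add: isdeg_def)
qed
lemma orb_M: "x \<in> V \<Longrightarrow> orb \<delta> x (M i) = (\<Prod>j\<in>{1..n i}. orb \<delta> x (Var (i, j)) ^ l i j)"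
  unfolding M_def by (simp add: orb_prod[OF lnd_nil_at[OF lnd]] orb_power[OF lnd_nil_at[OF lnd]])

lemma orb_nonzero: "x \<in> V \<Longrightarrow> eval_mpoly p x \<noteq> 0 \<Longrightarrow> orb \<delta> x p \<noteq> 0"
  using poly_orb_0[OF lnd_nil_at[OF lnd], of x p] by auto

lemma degree_orb_M:
  assumes x: "x \<in> V" "\<And>v. v \<in> I \<Longrightarrow> x v \<noteq> 0" and i: "i \<in> {0,1,2}"
  shows "degree (orb \<delta> x (M i)) = (\<Sum>j\<in>{1..n i}. l i j * degree (orb \<delta> x (Var (i, j))))"
proof -
  have nz: "orb \<delta> x (Var (i, j)) \<noteq> 0" if "j \<in> {1..n i}" for j
    by (rule orb_nonzero[OF x(1)]) (use x(2) that i in \<open>simp add: I_iff\<close>)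
  show ?thesis unfolding orb_M[OF x(1)]
    by (subst degree_prod_eq_sum_degree) (use nz in \<open>auto simp: degree_power_eq\<close>)
qed

lemma generic_torus_point:
  assumes "finite B" "\<And>p. p \<in> B \<Longrightarrow> p \<notin> J"
  shows "\<exists>x. x \<in> V \<and> (\<forall>v\<in>I. x v \<noteq> 0) \<and> (\<forall>p\<in>B. eval_mpoly p x \<noteq> 0) \<and> eval_mpoly (\<delta> v0) x \<noteq> 0"
proof -
  have "\<exists>x\<in>V. \<forall>p\<in>B \<union> Var ` I \<union> {\<delta> v0}. eval_mpoly p x \<noteq> 0"
  proof (rule generic_point)
    show "finite (B \<union> Var ` I \<union> {\<delta> v0})" using assms(1) finite_I by simp
    show "p \<notin> J" if "p \<in> B \<union> Var ` I \<union> {\<delta> v0}" for p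
      using that assms(2) v0(2) Var_notin_J by blast
  qed
  then obtain x where x: "x \<in> V" "\<forall>p\<in>B \<union> Var ` I \<union> {\<delta> v0}. eval_mpoly p x \<noteq> 0" by blast
  have "x v \<noteq> 0" if "v \<in> I" for v
  proof -
    have "eval_mpoly (Var v) x \<noteq> 0" using x(2) that by blast
    thus ?thesis by simp
  qed
  thus ?thesis using x by blast
qed

lemma mason_stothers_orbit:
  assumes x: "x \<in> V" "\<And>v. v \<in> I \<Longrightarrow> x v \<noteq> 0" "eval_mpoly (\<delta> v0) x \<noteq> 0"
    and coprime: "\<And>a. \<not> (poly (orb \<delta> x (M 0)) a = 0 \<and> poly (orb \<delta> x (M 1)) a = 0)"
  obtains d where "d > 0" "\<And>i. i \<in> {0,1,2} \<Longrightarrow> degree (orb \<delta> x (M i)) \<le> d"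
    "d + 1 \<le> (\<Sum>i\<in>{0,1,2}. \<Sum>j\<in>{1..n i}. degree (orb \<delta> x (Var (i, j))))"
proof -
  let ?deg = "\<lambda>i. degree (orb \<delta> x (M i))"
  note nil = lnd_nil_at[OF lnd x(1)]
  obtain i0 j0 where v: "v0 = (i0, j0)" by (cases v0)
  have ij: "i0 \<in> {0,1,2}" "j0 \<in> {1..n i0}" using v0 v by (auto simp: I_iff)
  \<comment> \<open>The linear coefficient is the value of \<open>\<delta> v0\<close> at
    \<open>x\<close>, so the orbit is not constant.\<close>
  have "coeff (orb \<delta> x (Var v0)) 1 \<noteq> 0" using x(3) by (simp add: coeff_orb[OF nil])
  hence dv: "degree (orb \<delta> x (Var (i0, j0))) \<ge> 1" unfolding v by (rule le_degree)
  have "l i0 j0 * degree (orb \<delta> x (Var (i0, j0))) \<le> ?deg i0"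
  proof -
    have "?deg i0 = (\<Sum>j\<in>{1..n i0}. l i0 j * degree (orb \<delta> x (Var (i0, j))))"
      by (rule degree_orb_M[OF x(1) x(2) ij(1)])
    thus ?thesis using member_le_sum[OF ij(2), of "\<lambda>j. l i0 j * degree (orb \<delta> x (Var (i0, j)))"] by simp
  qed
  hence pos: "?deg i0 > 0" using l_pos[OF ij] dv by (metis Suc_le_eq less_le_trans nat_0_less_mult_iff One_nat_def)
  have "Max (?deg ` {0,1,2}) \<in> ?deg ` {0,1,2}" by (rule Max_in) auto
  then obtain k where "Max (?deg ` {0,1,2}) = ?deg k" "k \<in> {0,1,2}" by (rule imageE)
  hence k: "k \<in> {0,1,2}" "?deg k = Max (?deg ` {0,1,2})" by simp_all
  have max: "?deg i \<le> ?deg k" if "i \<in> {0,1,2}" for i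
    unfolding k(2) using that by (intro Max_ge) auto
  have kpos: "?deg k > 0" using pos max[OF ij(1)] by linarith
  have "(\<Sum>i\<in>{0,1,2}. orb \<delta> x (M i)) = 0" by (rule orb_trinomial[OF lnd x(1)])
  hence sum: "orb \<delta> x (M 0) + orb \<delta> x (M 1) + orb \<delta> x (M 2) = 0" by (simp add: add_ac)
  have nz: "orb \<delta> x (Var (i, j)) \<noteq> 0" if "i \<in> {0,1,2}" "j \<in> {1..n i}" for i j
    by (rule orb_nonzero[OF x(1)]) (use x(2) that in \<open>simp add: I_iff\<close>)
  have "?deg k + 1 \<le> (\<Sum>i\<in>{0,1,2}. \<Sum>j\<in>{1..n i}. degree (orb \<delta> x (Var (i, j))))"
    using mason_stothers_blocks[of "\<lambda>i. {1..n i}" "\<lambda>i j. orb \<delta> x (Var (i, j))" l k,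
        folded orb_M[OF x(1)], OF _ nz l_pos sum coprime k(1) kpos max] by simp
  thus thesis using that[of "?deg k"] kpos max by blast
qed

lemma sum_degree_bound:
  assumes x: "x \<in> V" "\<And>v. v \<in> I \<Longrightarrow> x v \<noteq> 0" and i: "i \<in> {0,1,2}"
    and \<mu>: "\<And>j. j \<in> {1..n i} \<Longrightarrow> \<mu> \<le> l i j"
  shows "\<mu> * (\<Sum>j\<in>{1..n i}. degree (orb \<delta> x (Var (i, j)))) \<le> degree (orb \<delta> x (M i))"
proof -
  have "degree (orb \<delta> x (M i)) = (\<Sum>j\<in>{1..n i}. l i j * degree (orb \<delta> x (Var (i, j))))"
    by (rule degree_orb_M[OF x(1) x(2) i])
  moreover have "\<mu> * (\<Sum>j\<in>{1..n i}. degree (orb \<delta> x (Var (i, j)))) \<le> (\<Sum>j\<in>{1..n i}. l i j * degree (orb \<delta> x (Var (i, j))))"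
    unfolding sum_distrib_left by (intro sum_mono mult_right_mono \<mu>) auto
  ultimately show ?thesis by simp
qed

text \<open>If \<open>M k\<close> were constant along the orbit, there would be no common root,
  block \<open>k\<close> would contribute nothing to the sum of degrees, and the two other blocks at
  most \<open>d / 2\<close> each, as all exponents are at least 2. Mason--Stothers demands
  \<open>d + 1\<close>.\<close>

lemma M_not_in_kernel:
  assumes k: "k \<in> {0,1,2}"
  shows "D (M k) \<notin> J"
proof
  assume ker: "D (M k) \<in> J"
  obtain x where x: "x \<in> V" "\<And>v. v \<in> I \<Longrightarrow> x v \<noteq> 0" "eval_mpoly (\<delta> v0) x \<noteq> 0"
    using generic_torus_point[of "{}"] by blast
  let ?S = "\<lambda>i. \<Sum>j\<in>{1..n i}. degree (orb \<delta> x (Var (i, j)))"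
  have Mk: "orb \<delta> x (M k) = [:eval_mpoly (M k) x:]" by (rule orb_kernel[OF lnd x(1) ker])
  have Mk0: "eval_mpoly (M k) x \<noteq> 0"
    unfolding eval_M using x(2) k by (auto simp: I_iff)
  have cop: "\<not> (poly (orb \<delta> x (M 0)) a = 0 \<and> poly (orb \<delta> x (M 1)) a = 0)" for a
  proof
    assume z: "poly (orb \<delta> x (M 0)) a = 0 \<and> poly (orb \<delta> x (M 1)) a = 0"
    have "poly (\<Sum>i\<in>{0,1,2}. orb \<delta> x (M i)) a = 0" by (simp only: orb_trinomial[OF lnd x(1)] poly_0)
    hence "poly (orb \<delta> x (M 2)) a = 0" using z by simp
    hence "\<forall>i\<in>{0,1,2}. poly (orb \<delta> x (M i)) a = 0" using z by simp
    thus False using k Mk Mk0 by auto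
  qed
  obtain d where d: "d > 0" "\<And>i. i \<in> {0,1,2} \<Longrightarrow> degree (orb \<delta> x (M i)) \<le> d"
    "d + 1 \<le> (\<Sum>i\<in>{0,1,2}. ?S i)"
    using mason_stothers_orbit[OF x cop] by blast
  have S2: "2 * ?S i \<le> d" if "i \<in> {0,1,2}" for i
    using sum_degree_bound[OF x(1,2) that l2[OF that]] d(2)[OF that] by simp
  have "2 * ?S k \<le> 0" using sum_degree_bound[OF x(1,2) k l2[OF k]] Mk by simp
  hence "(\<Sum>i\<in>{0,1,2}. ?S i) = (\<Sum>i\<in>{0,1,2} - {k}. ?S i)"
    using k by (subst sum.remove[of _ k]) auto
  moreover have "2 * (\<Sum>i\<in>{0,1,2} - {k}. ?S i) \<le> (\<Sum>i\<in>{0,1,2} - {k}. d)"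
    by (subst sum_distrib_left, rule sum_mono, rule S2) auto
  moreover have "(\<Sum>i\<in>{0,1,2::nat} - {k}. d) = 2 * d"
  proof -
    have "card ({0,1,2::nat} - {k}) = 2" using k by auto
    thus ?thesis by simp
  qed
  ultimately show False using d(3) by linarith
qed

text \<open>An empty block gives the monomial 1, which lies in the kernel.\<close>

lemma n0_pos: "n 0 \<noteq> 0"
proof
  assume "n 0 = 0"
  hence "D (M 0) \<in> J" using J_rules(1) by (simp add: M_def)
  thus False using M_not_in_kernel[of 0] by simp
qed

text \<open>The inequality for the reciprocals of \<open>\<mu> 0\<close>, \<open>\<mu> 1\<close>,
  \<open>\<mu> 2\<close> with denominators cleared, whence the alternative of a zero product. Block
  \<open>i\<close> contributes at most \<open>d / \<mu> i\<close> to a sum of degrees that exceeds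
  \<open>d\<close>.\<close>

lemma platonic:
  assumes \<mu>: "\<And>i j. i \<in> {0,1,2} \<Longrightarrow> j \<in> {1..n i} \<Longrightarrow> \<mu> i \<le> l i j"
  shows "\<mu> 0 * \<mu> 1 * \<mu> 2 < \<mu> 1 * \<mu> 2 + \<mu> 0 * \<mu> 2 + \<mu> 0 * (\<mu> 1 :: nat) \<or> \<mu> 0 * \<mu> 1 * \<mu> 2 = 0"
proof -
  let ?P = "\<Pi>\<^sub>E i\<in>{0,1,2}. {1..n i}"
  define b where "b a = (SOME b. \<exists>k. homog k b \<and> b \<notin> J \<and> D b \<in> J \<and>
    (\<forall>m\<in>Poly_Mapping.keys b. \<exists>i\<in>{0,1,2}. Poly_Mapping.lookup m (i, a i) \<noteq> 0))" for a
  have b: "b a \<notin> J \<and> D (b a) \<in> J \<and> (\<forall>m\<in>Poly_Mapping.keys (b a). \<exists>i\<in>{0,1,2}. Poly_Mapping.lookup m (i, a i) \<noteq> 0)"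
    if "a \<in> ?P" for a
    using someI_ex[OF kernel_element_in_ideal[OF that]] unfolding b_def[symmetric] by (elim exE) simp
  have "finite (b ` ?P)" by (intro finite_imageI finite_PiE) auto
  then obtain x where x: "x \<in> V" "\<And>v. v \<in> I \<Longrightarrow> x v \<noteq> 0" "eval_mpoly (\<delta> v0) x \<noteq> 0"
    and bx: "\<And>p. p \<in> b ` ?P \<Longrightarrow> eval_mpoly p x \<noteq> 0"
    using generic_torus_point[of "b ` ?P"] b by blast
  note nil = lnd_nil_at[OF lnd x(1)]
  \<comment> \<open>At a common root some variable of every block vanishes, hence so does the kernel
    element \<open>b a\<close> of that choice, which however is a nonzero constant along the
    orbit.\<close>
  have cop: "\<not> (poly (orb \<delta> x (M 0)) s = 0 \<and> poly (orb \<delta> x (M 1)) s = 0)" for s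
  proof
    assume z: "poly (orb \<delta> x (M 0)) s = 0 \<and> poly (orb \<delta> x (M 1)) s = 0"
    have "poly (\<Sum>i\<in>{0,1,2}. orb \<delta> x (M i)) s = 0" by (simp only: orb_trinomial[OF lnd x(1)] poly_0)
    hence "poly (orb \<delta> x (M 2)) s = 0" using z by simp
    hence all: "poly (orb \<delta> x (M i)) s = 0" if "i \<in> {0,1,2}" for i using z that by auto
    have "\<exists>j\<in>{1..n i}. poly (orb \<delta> x (Var (i, j))) s = 0" if "i \<in> {0,1,2}" for i
      using all[OF that] unfolding orb_M[OF x(1)] poly_prod poly_power by (auto simp: prod_zero_iff)
    then obtain a' where a': "\<And>i. i \<in> {0,1,2} \<Longrightarrow> a' i \<in> {1..n i} \<and> poly (orb \<delta> x (Var (i, a' i))) s = 0"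
      by metis
    define a where "a = restrict a' {0,1,2}"
    have a: "a \<in> ?P" "\<And>i. i \<in> {0,1,2} \<Longrightarrow> poly (orb \<delta> x (Var (i, a i))) s = 0"
      using a' by (auto simp: a_def)
    have "poly (orb \<delta> x (b a)) s = 0"
      unfolding poly_orb[OF nil, of "b a" s]
    proof (rule eval_zero_if_keys)
      fix m assume "m \<in> Poly_Mapping.keys (b a)"
      then obtain i where "i \<in> {0,1,2}" "Poly_Mapping.lookup m (i, a i) \<noteq> 0" using b[OF a(1)] by blast
      thus "\<exists>v. Poly_Mapping.lookup m v \<noteq> 0 \<and> poly (orb \<delta> x (Var v)) s = 0"
        using a(2) by (intro exI[of _ "(i, a i)"]) simp
    qed
    moreover have "orb \<delta> x (b a) = [:eval_mpoly (b a) x:]"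
      using orb_kernel[OF lnd x(1)] b[OF a(1)] by blast
    ultimately have "eval_mpoly (b a) x = 0" by simp
    thus False using bx[of "b a"] a(1) by blast
  qed
  let ?S = "\<lambda>i. \<Sum>j\<in>{1..n i}. degree (orb \<delta> x (Var (i, j)))"
  obtain d where d: "d > 0" "\<And>i. i \<in> {0,1,2} \<Longrightarrow> degree (orb \<delta> x (M i)) \<le> d"
    "d + 1 \<le> (\<Sum>i\<in>{0,1,2}. ?S i)"
    using mason_stothers_orbit[OF x cop] by blast
  have S: "\<mu> i * ?S i \<le> d" if "i \<in> {0,1,2}" for i
    using sum_degree_bound[OF x(1,2) that \<mu>[OF that]] d(2)[OF that] by simp
  define s0 s1 s2 where "s0 = ?S 0" and "s1 = ?S 1" and "s2 = ?S 2"
  have s: "\<mu> 0 * s0 \<le> d" "\<mu> 1 * s1 \<le> d" "\<mu> 2 * s2 \<le> d" "d < s0 + s1 + s2"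
    using S[of 0] S[of 1] S[of 2] d(3) by (simp_all add: s0_def s1_def s2_def)
  show ?thesis
  proof (rule ccontr)
    assume neg: "\<not> ?thesis"
    hence pos: "\<mu> 0 * \<mu> 1 * \<mu> 2 > 0" and le: "\<mu> 1 * \<mu> 2 + \<mu> 0 * \<mu> 2 + \<mu> 0 * \<mu> 1 \<le> \<mu> 0 * \<mu> 1 * \<mu> 2" by auto
    have "\<mu> 0 * \<mu> 1 * \<mu> 2 * d < \<mu> 0 * \<mu> 1 * \<mu> 2 * (s0 + s1 + s2)"
      using pos s(4) by (simp only: mult_less_cancel1)
    also have "\<dots> = (\<mu> 0 * s0) * (\<mu> 1 * \<mu> 2) + (\<mu> 1 * s1) * (\<mu> 0 * \<mu> 2) + (\<mu> 2 * s2) * (\<mu> 0 * \<mu> 1)"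
      by (simp add: algebra_simps)
    also have "\<dots> \<le> d * (\<mu> 1 * \<mu> 2) + d * (\<mu> 0 * \<mu> 2) + d * (\<mu> 0 * \<mu> 1)"
      by (intro add_mono mult_right_mono s) auto
    also have "\<dots> = (\<mu> 1 * \<mu> 2 + \<mu> 0 * \<mu> 2 + \<mu> 0 * \<mu> 1) * d" by (simp add: algebra_simps)
    also have "\<dots> \<le> \<mu> 0 * \<mu> 1 * \<mu> 2 * d" using le by (rule mult_right_mono) simp
    finally show False by simp
  qed
qed

end

section \<open>Linear forms in the kernel\<close>

text \<open>Take a prime \<open>p\<close> dividing \<open>a\<close> and \<open>c\<close>, and a
  prime \<open>q\<close> dividing \<open>b\<close> and \<open>c\<close>. If they differ,
  \<open>p * q\<close> divides \<open>C\<close> and the reciprocals sum to at most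
  \<open>1/2 + 1/3 + 1/6 = 1\<close>. If they agree, \<open>1/3 + 1/3 + 1/3\<close> forces
  \<open>p = 2\<close>, so \<open>A\<close>, \<open>B\<close>, \<open>C\<close> are even, and
  \<open>1/4 + 1/4 + 1/2\<close> forces two of them to be 2.\<close>

lemma platonic_pair:
  fixes a b c A B C :: nat
  assumes dvd: "a dvd A" "b dvd B" "c dvd C" and two: "A \<ge> 2" "B \<ge> 2" "C \<ge> 2"
    and ineq: "A * B * C < B * C + A * C + A * B"
    and nc: "\<not> coprime a c" "\<not> coprime b c"
  shows "(a = 2 \<and> A = 2 \<and> b = 2 \<and> B = 2) \<or> (a = 2 \<and> A = 2 \<and> c = 2 \<and> C = 2) \<or> (b = 2 \<and> B = 2 \<and> c = 2 \<and> C = 2)"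
proof -
  have prime: "\<exists>p. prime p \<and> p dvd x \<and> p dvd y" if "\<not> coprime x y" "x > 0 \<or> y > 0" for x y :: nat
  proof -
    have "gcd x y \<noteq> 1" using that by (simp add: coprime_iff_gcd_eq_1)
    then obtain p where "prime p" "p dvd gcd x y" using prime_factor_nat by blast
    thus ?thesis by auto
  qed
  have pos: "a > 0" "b > 0" "c > 0"
    using dvd two dvd_pos_nat[of A a] dvd_pos_nat[of B b] dvd_pos_nat[of C c] by linarith+
  obtain p where p: "prime p" "p dvd a" "p dvd c" using prime[OF nc(1)] pos by blast
  obtain q where q: "prime q" "q dvd b" "q dvd c" using prime[OF nc(2)] pos by blast
  have pq: "p \<le> A" "q \<le> B" "p \<ge> 2" "q \<ge> 2"
    using dvd_imp_le[OF dvd_trans[OF p(2) dvd(1)]] dvd_imp_le[OF dvd_trans[OF q(2) dvd(2)]]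
      two p(1) q(1) by (simp_all add: prime_ge_2_nat)
  have ineqs: "A * C * B < C * B + A * B + A * C" "B * C * A < C * A + B * A + B * C"
    "B * A * C < A * C + B * C + B * A"
    using ineq by (simp_all add: mult_ac add_ac)
  show ?thesis
  proof (cases "p = q")
    case False
    hence "coprime p q" using p q primes_coprime by blast
    hence "p * q dvd C" using dvd_trans[OF p(3) dvd(3)] dvd_trans[OF q(3) dvd(3)] by (rule divides_mult[rotated 2])
    hence C: "p * q \<le> C" using two by (intro dvd_imp_le) auto
    have False
    proof -
      have main: False if "x \<ge> 2" "y \<ge> 3" "z \<ge> 6" "x * y * z < y * z + x * z + x * y" for x y z :: nat
      proof -
        have "2 * (y * z) \<le> x * y * z" using mult_le_mono1[OF that(1), of "y * z"] by (simp only: mult_ac)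
        moreover have "3 * (x * z) \<le> x * y * z" using mult_le_mono1[OF that(2), of "x * z"] by (simp only: mult_ac)
        moreover have "6 * (x * y) \<le> x * y * z" using mult_le_mono1[OF that(3), of "x * y"] by (simp only: mult_ac)
        ultimately show False using that(4) by linarith
      qed
      show False
      proof (cases "p = 2")
        case True
        hence "q \<ge> 3" using False pq by simp
        moreover have "C \<ge> 6" using C True \<open>q \<ge> 3\<close> by simp
        ultimately show False using main[OF two(1) _ _ ineq] pq by simp
      next
        case p2: False
        hence "p \<ge> 3" using pq by simp
        moreover have "p * q \<ge> 3 * 2" using \<open>p \<ge> 3\<close> pq(4) by (rule mult_le_mono)
        hence "C \<ge> 6" using C by simp
        ultimately show False using main[OF two(2) _ _ ineqs(3)] pq by simp
      qed
    qed
    thus ?thesis ..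
  next
    case True
    have d: "p dvd A" "p dvd B" "p dvd C"
      using dvd_trans[OF p(2) dvd(1)] dvd_trans[OF q(2) dvd(2)] dvd_trans[OF p(3) dvd(3)] True by simp_all
    have ge: "A \<ge> p" "B \<ge> p" "C \<ge> p"
      using dvd_imp_le[OF d(1)] dvd_imp_le[OF d(2)] dvd_imp_le[OF d(3)] two by simp_all
    have main: False if "x \<ge> 4" "y \<ge> 4" "z \<ge> 2" "x * y * z < y * z + x * z + x * y" for x y z :: nat
    proof -
      have "4 * (y * z) \<le> x * y * z" using mult_le_mono1[OF that(1), of "y * z"] by (simp only: mult_ac)
        moreover have "4 * (x * z) \<le> x * y * z" using mult_le_mono1[OF that(2), of "x * z"] by (simp only: mult_ac)
        moreover have "2 * (x * y) \<le> x * y * z" using mult_le_mono1[OF that(3), of "x * y"] by (simp only: mult_ac)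
        ultimately show False using that(4) by linarith
    qed
    have "p = 2"
    proof (rule ccontr)
      assume "p \<noteq> 2"
      hence "A \<ge> 3" "B \<ge> 3" "C \<ge> 3" using ge pq by auto
      hence "3 * (B * C) \<le> A * B * C" "3 * (A * C) \<le> A * B * C" "3 * (A * B) \<le> A * B * C"
        using mult_le_mono1[of 3 A "B * C"] mult_le_mono1[of 3 B "A * C"] mult_le_mono1[of 3 C "A * B"]
        by (simp_all only: mult_ac)
      thus False using ineq by linarith
    qed
    have small: "x = 2 \<or> x \<ge> 4" if "p dvd x" "x \<ge> 2" for x
    proof -
      have "x \<noteq> 3" using that \<open>p = 2\<close> by auto
      thus ?thesis using that by linarith
    qed
    have eq2: "x = 2" if "p dvd x" "x dvd y" "y = 2" for x y :: nat
    proof -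
      have "x \<noteq> 0" "x \<le> 2" "x \<noteq> 1" using that \<open>p = 2\<close> by (auto dest: dvd_imp_le)
      thus ?thesis by simp
    qed
    have "\<not> (A \<ge> 4 \<and> B \<ge> 4)" "\<not> (A \<ge> 4 \<and> C \<ge> 4)" "\<not> (B \<ge> 4 \<and> C \<ge> 4)"
      using main[OF _ _ two(3) ineq] main[OF _ _ two(2) ineqs(1)] main[OF _ _ two(1) ineqs(2)] by blast+
    hence "(A = 2 \<and> B = 2) \<or> (A = 2 \<and> C = 2) \<or> (B = 2 \<and> C = 2)"
      using small[OF d(1) two(1)] small[OF d(2) two(2)] small[OF d(3) two(3)] by argo
    moreover have "A = 2 \<Longrightarrow> a = 2" "B = 2 \<Longrightarrow> b = 2" "C = 2 \<Longrightarrow> c = 2"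
      using eq2[OF p(2) dvd(1)] eq2[OF _ dvd(2)] eq2[OF p(3) dvd(3)] q(2) True by simp_all
    ultimately show ?thesis by argo
  qed
qed

text \<open>If no \<open>d k\<close> is coprime to both others, at least two of the three pairs have
  a common factor; two pairs share an index, which plays the part of \<open>c\<close> in
  \<open>platonic_pair\<close>.\<close>

lemma platonic_coprime:
  fixes d \<mu> :: "nat \<Rightarrow> nat"
  assumes dvd: "\<And>i. i \<in> {0,1,2} \<Longrightarrow> d i dvd \<mu> i" and two: "\<And>i. i \<in> {0,1,2} \<Longrightarrow> \<mu> i \<ge> 2"
    and ineq: "\<mu> 0 * \<mu> 1 * \<mu> 2 < \<mu> 1 * \<mu> 2 + \<mu> 0 * \<mu> 2 + \<mu> 0 * \<mu> 1"
  shows "(\<exists>i\<in>{0,1,2}. \<exists>j\<in>{0,1,2}. i \<noteq> j \<and> d i = 2 \<and> \<mu> i = 2 \<and> d j = 2 \<and> \<mu> j = 2) \<or>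
    (\<exists>k\<in>{0,1,2}. \<exists>i\<in>{0,1,2}. \<exists>j\<in>{0,1,2}. i \<noteq> j \<and> i \<noteq> k \<and> j \<noteq> k \<and> coprime (d k) (d i) \<and> coprime (d k) (d j))"
    (is "?L \<or> ?R")
proof (rule ccontr)
  assume neg: "\<not> (?L \<or> ?R)"
  have dv: "d 0 dvd \<mu> 0" "d 1 dvd \<mu> 1" "d 2 dvd \<mu> 2" and tw: "\<mu> 0 \<ge> 2" "\<mu> 1 \<ge> 2" "\<mu> 2 \<ge> 2"
    using dvd two by auto
  have no2: "\<not> (d i = 2 \<and> \<mu> i = 2 \<and> d j = 2 \<and> \<mu> j = 2)" if "i \<in> {0,1,2}" "j \<in> {0,1,2}" "i \<noteq> j" for i j
    using neg that by blast
  have n2: "\<not> (d 0 = 2 \<and> \<mu> 0 = 2 \<and> d 1 = 2 \<and> \<mu> 1 = 2)" "\<not> (d 0 = 2 \<and> \<mu> 0 = 2 \<and> d 2 = 2 \<and> \<mu> 2 = 2)"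
    "\<not> (d 1 = 2 \<and> \<mu> 1 = 2 \<and> d 2 = 2 \<and> \<mu> 2 = 2)"
    by (rule no2; simp)+
  have nc: "\<not> coprime (d k) (d i) \<or> \<not> coprime (d k) (d j)"
    if "k \<in> {0,1,2}" "i \<in> {0,1,2}" "j \<in> {0,1,2}" "i \<noteq> j" "i \<noteq> k" "j \<noteq> k" for i j k
    using neg that by blast
  have c: "\<not> coprime (d 0) (d 1) \<or> \<not> coprime (d 0) (d 2)" "\<not> coprime (d 1) (d 0) \<or> \<not> coprime (d 1) (d 2)"
    "\<not> coprime (d 2) (d 0) \<or> \<not> coprime (d 2) (d 1)"
    by (rule nc; simp)+
  consider "\<not> coprime (d 1) (d 0)" "\<not> coprime (d 2) (d 0)" | "\<not> coprime (d 0) (d 1)" "\<not> coprime (d 2) (d 1)"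
    | "\<not> coprime (d 0) (d 2)" "\<not> coprime (d 1) (d 2)"
    using c coprime_commute[of "d 0" "d 1"] coprime_commute[of "d 0" "d 2"] coprime_commute[of "d 1" "d 2"] by argo
  thus False
  proof cases
    case 1
    from platonic_pair[OF dv(2,3,1) tw(2,3,1) _ this] ineq n2 show False by (auto simp: algebra_simps)
  next
    case 2
    from platonic_pair[OF dv(1,3,2) tw(1,3,2) _ this] ineq n2 show False by (auto simp: algebra_simps)
  next
    case 3
    from platonic_pair[OF dv(1,2,3) tw(1,2,3) _ this] ineq n2 show False by (auto simp: algebra_simps)
  qed
qed

section \<open>Rational multipliers and binary forms\<close>

lemma Ints_mult_Gcd:
  fixes \<alpha> :: rat
  assumes "\<And>x. x \<in> S \<Longrightarrow> \<alpha> * of_nat x \<in> \<int>"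
  shows "\<alpha> * of_nat (Gcd S) \<in> \<int>"
proof -
  obtain P Q where PQ: "quotient_of \<alpha> = (P, Q)" by fastforce
  have \<alpha>: "\<alpha> = of_int P / of_int Q" "Q > 0" "coprime P Q"
    using quotient_of_div[OF PQ] quotient_of_denom_pos[OF PQ] quotient_of_coprime[OF PQ] by auto
  \<comment> \<open>The reduced denominator of \<open>\<alpha>\<close> divides every element of
    \<open>S\<close>, and therefore their gcd.\<close>
  have "nat Q dvd x" if x: "x \<in> S" for x
  proof -
    obtain y where y: "\<alpha> * of_nat x = of_int y" using assms[OF x] by (auto elim: Ints_cases)
    hence "of_int (P * int x) = (of_int (y * Q) :: rat)" using y \<alpha>(1,2) by (simp add: field_simps)
    hence "P * int x = y * Q" by (simp only: of_int_eq_iff)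
    hence "Q dvd P * int x" by simp
    hence "Q dvd int x" using \<alpha>(3) by (simp add: coprime_dvd_mult_right_iff coprime_commute)
    thus ?thesis using \<alpha>(2) by (simp add: nat_dvd_iff)
  qed
  hence "nat Q dvd Gcd S" by (rule Gcd_greatest)
  then obtain r where "Gcd S = nat Q * r" by blast
  hence "\<alpha> * of_nat (Gcd S) = of_int (P * int r)" using \<alpha> by (simp add: field_simps)
  thus ?thesis by (metis Ints_of_int)
qed

lemma Ints_mult_gcd:
  fixes \<alpha> :: rat
  assumes "\<alpha> * of_nat x \<in> \<int>" "\<alpha> * of_nat y \<in> \<int>"
  shows "\<alpha> * of_nat (gcd x y) \<in> \<int>"
  using Ints_mult_Gcd[of "{x, y}" \<alpha>] assms by auto

text \<open>The binary form of degree \<open>h\<close> with dehomogenisation \<open>q\<close>,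
  provided that \<open>degree q \<le> h\<close>; each degree that \<open>q\<close> lacks is a factor
  \<open>W\<close>.\<close>

definition bform :: "('v, 'k) mpoly \<Rightarrow> ('v, 'k::field) mpoly \<Rightarrow> 'k poly \<Rightarrow> nat \<Rightarrow> ('v, 'k) mpoly"
  where "bform U W q h = (\<Sum>r\<le>h. Cst (coeff q r) * U ^ r * W ^ (h - r))"

lemma Cst_add: "Cst (a + b) = Cst a + Cst b" and Cst_mult: "Cst (a * b) = Cst a * Cst b"
  and Cst_uminus: "Cst (- a) = - Cst a"
  by (simp_all add: Cst_def single_add mult_single single_uminus)

lemma bform_add: "bform U W (p + q) h = bform U W p h + bform U W q h"
  by (simp add: bform_def Cst_add algebra_simps sum.distrib)

lemma bform_smult: "bform U W (smult c q) h = Cst c * bform U W q h"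
  by (simp add: bform_def Cst_mult algebra_simps sum_distrib_left)

lemma bform_0 [simp]: "bform U W 0 h = 0"
  by (simp add: bform_def)

lemma bform_pCons_0: "bform U W (pCons 0 q) (Suc h) = U * bform U W q h"
  unfolding bform_def by (subst sum.atMost_Suc_shift) (simp add: sum_distrib_left algebra_simps)

lemma bform_Suc:
  assumes "degree q \<le> h"
  shows "bform U W q (Suc h) = W * bform U W q h"
proof -
  have "coeff q (Suc h) = 0" using assms by (simp add: coeff_eq_0)
  hence "bform U W q (Suc h) = (\<Sum>r\<le>h. Cst (coeff q r) * U ^ r * W ^ (Suc h - r))"
    by (simp add: bform_def)
  also have "\<dots> = (\<Sum>r\<le>h. W * (Cst (coeff q r) * U ^ r * W ^ (h - r)))"
    by (intro sum.cong refl) (simp add: Suc_diff_le mult_ac)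
  finally show ?thesis by (simp add: bform_def sum_distrib_left)
qed

definition is_form :: "('v, 'k) mpoly \<Rightarrow> ('v, 'k::field) mpoly \<Rightarrow> nat \<Rightarrow> ('v, 'k) mpoly \<Rightarrow> bool"
  where "is_form U W h F \<longleftrightarrow> (\<exists>q. degree q \<le> h \<and> F = bform U W q h)"

lemma is_form_add: "is_form U W h F \<Longrightarrow> is_form U W h G \<Longrightarrow> is_form U W h (F + G)"
  unfolding is_form_def using bform_add degree_add_le by metis

lemma is_form_Cst_mult: "is_form U W h F \<Longrightarrow> is_form U W h (Cst c * F)"
  unfolding is_form_def using bform_smult degree_smult_le le_trans by metis

lemma is_form_0: "is_form U W h 0"
  unfolding is_form_def by (rule exI[of _ 0]) simp

lemma is_form_sum: "(\<And>a. a \<in> S \<Longrightarrow> is_form U W h (f a)) \<Longrightarrow> is_form U W h (sum f S)"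
  by (induction S rule: infinite_finite_induct) (auto intro: is_form_0 is_form_add)

lemma is_form_1: "is_form U W 0 1"
  unfolding is_form_def by (rule exI[of _ 1]) (simp add: bform_def)

lemma is_form_mult_U: "is_form U W h F \<Longrightarrow> is_form U W (Suc h) (U * F)"
proof -
  assume "is_form U W h F"
  then obtain q where q: "degree q \<le> h" "F = bform U W q h" by (auto simp: is_form_def)
  have "degree (pCons 0 q) \<le> Suc h" using q(1) by (simp add: degree_pCons_le le_trans[OF degree_pCons_le])
  thus ?thesis unfolding is_form_def using q(2) bform_pCons_0[of U W q h] by metis
qed

lemma is_form_mult_W: "is_form U W h F \<Longrightarrow> is_form U W (Suc h) (W * F)"
proof -
  assume "is_form U W h F"
  then obtain q where q: "degree q \<le> h" "F = bform U W q h" by (auto simp: is_form_def)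
  have "degree q \<le> Suc h" using q(1) by simp
  thus ?thesis unfolding is_form_def using q(2) bform_Suc[OF q(1), of U W] by metis
qed

lemma is_form_power_U: "is_form U W h F \<Longrightarrow> is_form U W (a + h) (U ^ a * F)"
  by (induction a) (use is_form_mult_U in \<open>auto simp: mult.assoc\<close>)

lemma is_form_power_W: "is_form U W h F \<Longrightarrow> is_form U W (a + h) (W ^ a * F)"
  by (induction a) (use is_form_mult_W in \<open>auto simp: mult.assoc\<close>)

text \<open>The shape of a monomial in \<open>U\<close>, \<open>W\<close> and \<open>M k\<close>
  after \<open>M k\<close> has been eliminated by the trinomial relation.\<close>

lemma is_form_trinomial: "is_form U W (a + b + g * c) (U ^ a * W ^ b * (- (U ^ g + W ^ g)) ^ c)"
proof -
  have "is_form U W (g * c) ((- (U ^ g + W ^ g)) ^ c)"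
  proof (induction c)
    case 0
    show ?case using is_form_1 by simp
  next
    case (Suc c)
    let ?F = "(- (U ^ g + W ^ g)) ^ c"
    have "is_form U W (g + g * c) (Cst (-1) * (U ^ g * ?F + W ^ g * ?F))"
      by (intro is_form_Cst_mult is_form_add is_form_power_U is_form_power_W Suc)
    moreover have "Cst (-1) * (U ^ g * ?F + W ^ g * ?F) = (- (U ^ g + W ^ g)) ^ Suc c"
      unfolding Cst_uminus Cst_1 power_Suc by (simp only: minus_mult_left[symmetric] mult_1 distrib_right[symmetric])
    ultimately show ?case by (simp del: power_Suc)
  qed
  hence "is_form U W (a + (b + g * c)) (U ^ a * (W ^ b * (- (U ^ g + W ^ g)) ^ c))"
    by (intro is_form_power_U is_form_power_W)
  thus ?thesis by (simp only: mult.assoc add.assoc)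
qed

definition lin :: "('v, 'k) mpoly \<Rightarrow> ('v, 'k::field) mpoly \<Rightarrow> 'k \<Rightarrow> 'k \<Rightarrow> ('v, 'k) mpoly"
  where "lin U W \<alpha> \<beta> = Cst \<alpha> * U + Cst \<beta> * W"

text \<open>A root of the dehomogenised polynomial splits off a linear form, a degree drop splits
  off \<open>W\<close>; over an algebraically closed field one of the two always happens.\<close>

lemma is_form_splits:
  fixes U W :: "('v, 'k::alg_closed_field) mpoly"
  assumes "is_form U W h F" "F \<noteq> 0"
  shows "\<exists>c \<alpha> \<beta>. c \<noteq> 0 \<and> (\<forall>r<h. \<alpha> r \<noteq> 0 \<or> \<beta> r \<noteq> 0) \<and> F = Cst c * (\<Prod>r<h. lin U W (\<alpha> r) (\<beta> r))"
  using assms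
proof (induction h arbitrary: F)
  case 0
  then obtain q where "degree q \<le> 0" "F = Cst (coeff q 0)" by (auto simp: is_form_def bform_def)
  moreover have "coeff q 0 \<noteq> 0" using calculation 0 by auto
  ultimately show ?case by auto
next
  case (Suc h)
  then obtain q where q: "degree q \<le> Suc h" "F = bform U W q (Suc h)" by (auto simp: is_form_def)
  have "\<exists>q' \<alpha>' \<beta>'. degree q' \<le> h \<and> (\<alpha>' \<noteq> 0 \<or> \<beta>' \<noteq> 0) \<and> F = lin U W \<alpha>' \<beta>' * bform U W q' h"
  proof (cases "degree q \<le> h")
    case True
    have "F = lin U W 0 1 * bform U W q h" using bform_Suc[OF True, of U W] q(2) by (simp add: lin_def)
    thus ?thesis using True by (intro exI[of _ q] exI[of _ 0] exI[of _ 1]) simp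
  next
    case False
    hence "degree q > 0" by simp
    then obtain \<rho> where "poly q \<rho> = 0" using alg_closed_imp_poly_has_root by blast
    then obtain q' where q': "q = [:-\<rho>, 1:] * q'" by (auto simp: poly_eq_0_iff_dvd dvd_def)
    have "q' \<noteq> 0" using q' False by auto
    hence "degree q = Suc (degree q')" unfolding q' by (subst degree_mult_eq) auto
    hence d: "degree q' \<le> h" using q(1) by simp
    have "q = pCons 0 q' + smult (-\<rho>) q'" unfolding q' by simp
    hence "F = U * bform U W q' h + Cst (-\<rho>) * bform U W q' (Suc h)"
      unfolding q(2) by (simp only: bform_add bform_smult bform_pCons_0)
    also have "\<dots> = lin U W 1 (-\<rho>) * bform U W q' h"
      unfolding bform_Suc[OF d] lin_def by (simp add: algebra_simps)
    finally show ?thesis using d by (intro exI[of _ q'] exI[of _ 1] exI[of _ "-\<rho>"]) simp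
  qed
  then obtain q' \<alpha>' \<beta>' where q': "degree q' \<le> h" "\<alpha>' \<noteq> 0 \<or> \<beta>' \<noteq> 0" "F = lin U W \<alpha>' \<beta>' * bform U W q' h" by blast
  have "is_form U W h (bform U W q' h)" "bform U W q' h \<noteq> 0"
    using q' Suc.prems by (auto simp: is_form_def)
  from Suc.IH[OF this] obtain c \<alpha> \<beta> where c: "c \<noteq> 0" "\<forall>r<h. \<alpha> r \<noteq> 0 \<or> \<beta> r \<noteq> 0"
    "bform U W q' h = Cst c * (\<Prod>r<h. lin U W (\<alpha> r) (\<beta> r))" by blast
  have "F = Cst c * (\<Prod>r<Suc h. lin U W ((\<alpha>(h := \<alpha>')) r) ((\<beta>(h := \<beta>')) r))"
    unfolding q'(3) c(3) by (simp add: mult_ac)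
  moreover have "\<forall>r<Suc h. (\<alpha>(h := \<alpha>')) r \<noteq> 0 \<or> (\<beta>(h := \<beta>')) r \<noteq> 0"
    using c(2) q'(2) by (simp add: less_Suc_eq)
  ultimately show ?case using c(1) by blast
qed

section \<open>Homogeneous elements as monomials times binary forms\<close>

context trinomial
begin

definition dd :: "nat \<Rightarrow> nat" where "dd t = Gcd (l t ` {1..n t})"

lemma dd_dvd: "u \<in> {1..n t} \<Longrightarrow> dd t dvd l t u"
  unfolding dd_def by (rule Gcd_dvd) simp

lemma J_power_diff: "p - q \<in> J \<Longrightarrow> p ^ c - q ^ c \<in> J"
proof (induction c)
  case 0
  show ?case using J_rules(1) by simp
next
  case (Suc c)
  have "p * (p ^ c - q ^ c) + (p - q) * q ^ c \<in> J" using Suc by (intro J_rules(2) J_rules(3)[of "p ^ c - q ^ c"] J_rules(4)[of "p - q"])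
  thus ?case by (simp add: algebra_simps)
qed

end

locale forms = homogeneous_lnd n l V \<delta> v0
  for n :: "nat \<Rightarrow> nat" and l :: "nat \<Rightarrow> nat \<Rightarrow> nat"
    and V :: "(nat \<times> nat \<Rightarrow> 'k::{alg_closed_field, field_char_0}) set"
    and \<delta> :: "nat \<times> nat \<Rightarrow> (nat \<times> nat, 'k) mpoly" and v0 +
  fixes i j k :: nat
  assumes i: "i \<in> {0,1,2}" and j: "j \<in> {0,1,2}" and k: "k \<in> {0,1,2}"
    and ij: "i \<noteq> j" and ik: "i \<noteq> k" and jk: "j \<noteq> k"
    and coprime_ki: "coprime (dd k) (dd i)" and coprime_kj: "coprime (dd k) (dd j)"
begin

definition g :: nat where "g = gcd (dd i) (dd j)"

definition U :: "(nat \<times> nat, 'k) mpoly" where "U = (\<Prod>u\<in>{1..n i}. Var (i, u) ^ (l i u div g))"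
definition W :: "(nat \<times> nat, 'k) mpoly" where "W = (\<Prod>u\<in>{1..n j}. Var (j, u) ^ (l j u div g))"

lemma ijk: "{0,1,2} = {i,j,k}"
  using i j k ij ik jk by auto

lemma n_pos: "t \<in> {0,1,2} \<Longrightarrow> 1 \<in> {1..n t}"
  using n0_pos n1 n2 by auto

lemma g_dvd: "u \<in> {1..n i} \<Longrightarrow> g dvd l i u" "u \<in> {1..n j} \<Longrightarrow> g dvd l j u"
  unfolding g_def using dd_dvd[of u i] dd_dvd[of u j] dvd_trans gcd_dvd1 gcd_dvd2 by blast+

lemma g_pos: "g > 0"
proof -
  have "g dvd l i 1" using g_dvd(1) n_pos[OF i] by blast
  thus ?thesis using l_pos[OF i n_pos[OF i]] by (metis dvd_0_left_iff gr0I less_irrefl)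
qed

lemma U_power: "U ^ g = M i"
  unfolding U_def M_def prod_power_distrib power_mult[symmetric]
  by (intro prod.cong refl) (simp only: dvd_div_mult_self[OF g_dvd(1)])

lemma W_power: "W ^ g = M j"
  unfolding W_def M_def prod_power_distrib power_mult[symmetric]
  by (intro prod.cong refl) (simp only: dvd_div_mult_self[OF g_dvd(2)])

lemma Mk_mod: "M k - (- (U ^ g + W ^ g)) \<in> J"
proof -
  have "(\<Sum>t\<in>{0,1,2}. M t) = M i + (M j + M k)" unfolding ijk using ij ik jk by simp
  hence "M i + (M j + M k) \<in> J" using trinomial_in_J by simp
  moreover have "M k - (- (U ^ g + W ^ g)) = M i + (M j + M k)"
    unfolding U_power W_power by simp
  ultimately show ?thesis by (simp only:)
qed

lemma prod_I: "(\<Prod>v\<in>I. f v) = (\<Prod>u\<in>{1..n i}. f (i, u)) * (\<Prod>u\<in>{1..n j}. f (j, u)) * (\<Prod>u\<in>{1..n k}. f (k, u))"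
proof -
  have "(\<Prod>v\<in>I. f v) = (\<Prod>t\<in>{0,1,2}. \<Prod>u\<in>{1..n t}. f (t, u))"
    unfolding trinomial_index_def by (subst prod.Sigma) auto
  also have "\<dots> = (\<Prod>u\<in>{1..n i}. f (i, u)) * ((\<Prod>u\<in>{1..n j}. f (j, u)) * (\<Prod>u\<in>{1..n k}. f (k, u)))"
    unfolding ijk using ij ik jk by simp
  finally show ?thesis by (simp only: mult.assoc)
qed

lemma monomial_prod:
  assumes "Poly_Mapping.keys m \<subseteq> I"
  shows "Poly_Mapping.single m (1::'k) = (\<Prod>v\<in>I. Var v ^ Poly_Mapping.lookup m v)"
proof -
  have "m = (\<Sum>v\<in>Poly_Mapping.keys m. Poly_Mapping.single v (Poly_Mapping.lookup m v))"
    by (rule poly_mapping_sum_single)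
  also have "\<dots> = (\<Sum>v\<in>I. Poly_Mapping.single v (Poly_Mapping.lookup m v))"
    using assms finite_I by (intro sum.mono_neutral_left) (auto simp: in_keys_iff)
  finally have "Poly_Mapping.single m (1::'k) = Poly_Mapping.single (\<Sum>v\<in>I. Poly_Mapping.single v (Poly_Mapping.lookup m v)) 1"
    by (rule arg_cong)
  also have "\<dots> = (\<Prod>v\<in>I. Var v ^ Poly_Mapping.lookup m v)"
    unfolding Var_power by (rule prod_single[symmetric])
  finally show ?thesis .
qed

text \<open>In block \<open>t\<close> the difference is \<open>\<alpha> t\<close> times the
  exponents, with rational \<open>\<alpha> t\<close> of sum zero and
  \<open>\<alpha> t * dd t\<close> integral. Coprimality of \<open>dd k\<close> with
  \<open>dd i * dd j\<close> makes \<open>\<alpha> k\<close> integral; then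
  \<open>\<alpha> i\<close> becomes integral after multiplication by \<open>dd i\<close> and by
  \<open>dd j\<close>, hence by \<open>g\<close>, and likewise \<open>\<alpha> j\<close>.\<close>

lemma lattice:
  assumes same: "same m m'"
  shows "\<exists>A B C :: int.
    (\<forall>u\<in>{1..n i}. int (Poly_Mapping.lookup m (i, u)) - int (Poly_Mapping.lookup m' (i, u)) = A * int (l i u div g)) \<and>
    (\<forall>u\<in>{1..n j}. int (Poly_Mapping.lookup m (j, u)) - int (Poly_Mapping.lookup m' (j, u)) = B * int (l j u div g)) \<and>
    (\<forall>u\<in>{1..n k}. int (Poly_Mapping.lookup m (k, u)) - int (Poly_Mapping.lookup m' (k, u)) = C * int (l k u)) \<and>
    A + B + int g * C = 0"
proof -
  define df where "df t u = int (Poly_Mapping.lookup m (t, u)) - int (Poly_Mapping.lookup m' (t, u))" for t u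
  define \<alpha> :: "nat \<Rightarrow> rat" where "\<alpha> t = of_int (df t 1) / of_nat (l t 1)" for t
  have l1: "l t 1 > 0" if "t \<in> {0,1,2}" for t by (rule l_pos[OF that n_pos[OF that]])
  have \<alpha>: "\<alpha> t * of_nat (l t u) = of_int (df t u)" if t: "t \<in> {0,1,2}" and u: "u \<in> {1..n t}" for t u
  proof -
    have "df t 1 * int (l t u) = df t u * int (l t 1)"
      unfolding df_def by (rule same_mult_weight[OF same t n_pos[OF t] u])
    hence "of_int (df t 1) * of_nat (l t u) = (of_int (df t u) * of_nat (l t 1) :: rat)"
      by (metis of_int_mult of_int_of_nat_eq)
    thus ?thesis unfolding \<alpha>_def using l1[OF t] by (simp add: field_simps)
  qed
  have sum0: "\<alpha> 0 + \<alpha> 1 + \<alpha> 2 = 0"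
  proof -
    let ?a = "restrict (\<lambda>_. 1) {0,1,2} :: nat \<Rightarrow> nat"
    have "?a \<in> (\<Pi>\<^sub>E t\<in>{0,1,2}. {1..n t})" by (rule restrict_PiE_iff[THEN iffD2]) (use n_pos in blast)
    hence "wt (crs ?a) m = wt (crs ?a) m'" using crs_in_weights same unfolding same_def by blast
    hence "df 0 1 * (int (l 1 1) * int (l 2 1)) + df 1 1 * (int (l 0 1) * int (l 2 1)) + df 2 1 * (int (l 0 1) * int (l 1 1)) = 0"
      unfolding wt_crs df_def by (simp add: insert_Diff_if algebra_simps)
    hence "of_int (df 0 1) * (of_nat (l 1 1) * of_nat (l 2 1)) + of_int (df 1 1) * (of_nat (l 0 1) * of_nat (l 2 1))
      + of_int (df 2 1) * (of_nat (l 0 1) * of_nat (l 1 1)) = (0::rat)"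
      by (metis (mono_tags, lifting) of_int_0 of_int_add of_int_mult of_int_of_nat_eq)
    hence "(\<alpha> 0 + \<alpha> 1 + \<alpha> 2) * (of_nat (l 0 1) * of_nat (l 1 1) * of_nat (l 2 1)) = 0"
    proof -
      have "of_int (df t 1) = \<alpha> t * of_nat (l t 1)" if "t \<in> {0,1,2}" for t
        using \<alpha>[OF that n_pos[OF that]] by simp
      from this[of 0] this[of 1] this[of 2]
      have "of_int (df 0 1) = \<alpha> 0 * of_nat (l 0 1)" "of_int (df 1 1) = \<alpha> 1 * of_nat (l 1 1)"
        "of_int (df 2 1) = \<alpha> 2 * of_nat (l 2 1)" by simp_all
      moreover assume "of_int (df 0 1) * (of_nat (l 1 1) * of_nat (l 2 1)) + of_int (df 1 1) * (of_nat (l 0 1) * of_nat (l 2 1))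
        + of_int (df 2 1) * (of_nat (l 0 1) * of_nat (l 1 1)) = (0::rat)"
      ultimately show ?thesis by (simp add: algebra_simps)
    qed
    thus ?thesis using l1[of 0] l1[of 1] l1[of 2] by simp
  qed
  have "(\<Sum>t\<in>{0,1,2}. \<alpha> t) = 0" using sum0 by (simp add: add_ac)
  hence sum: "\<alpha> i + \<alpha> j + \<alpha> k = 0" unfolding ijk using ij ik jk by (simp add: add_ac)
  have int: "\<alpha> t * of_nat (dd t) \<in> \<int>" if t: "t \<in> {0,1,2}" for t
    unfolding dd_def
  proof (rule Ints_mult_Gcd)
    fix x assume "x \<in> l t ` {1..n t}"
    then obtain u where "u \<in> {1..n t}" "x = l t u" by blast
    thus "\<alpha> t * of_nat x \<in> \<int>" using \<alpha>[OF t, of u] by simp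
  qed
  have \<alpha>k: "\<alpha> k = - \<alpha> i - \<alpha> j" using sum by (simp add: algebra_simps eq_neg_iff_add_eq_0)
  have "\<alpha> k * of_nat (dd i * dd j) = - (\<alpha> i * of_nat (dd i)) * of_nat (dd j) - (\<alpha> j * of_nat (dd j)) * of_nat (dd i)"
    unfolding \<alpha>k by (simp add: algebra_simps)
  also have "\<dots> \<in> \<int>" by (rule Ints_diff[OF Ints_mult[OF Ints_minus[OF int[OF i]] Ints_of_nat] Ints_mult[OF int[OF j] Ints_of_nat]])
  finally have "\<alpha> k * of_nat (gcd (dd k) (dd i * dd j)) \<in> \<int>" using int[OF k] by (intro Ints_mult_gcd)
  moreover have "gcd (dd k) (dd i * dd j) = 1"
    using coprime_ki coprime_kj by (simp add: coprime_iff_gcd_eq_1[symmetric])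
  ultimately have C: "\<alpha> k \<in> \<int>" by simp
  have "\<alpha> i * of_nat (dd j) = - (\<alpha> j * of_nat (dd j)) - \<alpha> k * of_nat (dd j)" unfolding \<alpha>k by (simp add: algebra_simps)
  also have "\<dots> \<in> \<int>" by (rule Ints_diff[OF Ints_minus[OF int[OF j]] Ints_mult[OF C Ints_of_nat]])
  finally have A: "\<alpha> i * of_nat g \<in> \<int>" unfolding g_def using int[OF i] by (intro Ints_mult_gcd)
  have "\<alpha> j * of_nat (dd i) = - (\<alpha> i * of_nat (dd i)) - \<alpha> k * of_nat (dd i)" unfolding \<alpha>k by (simp add: algebra_simps)
  also have "\<dots> \<in> \<int>" by (rule Ints_diff[OF Ints_minus[OF int[OF i]] Ints_mult[OF C Ints_of_nat]])
  finally have B: "\<alpha> j * of_nat g \<in> \<int>" unfolding g_def using int[OF j] by (intro Ints_mult_gcd)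
  obtain a where a: "\<alpha> i * of_nat g = of_int a" using A by (rule Ints_cases)
  obtain b where b: "\<alpha> j * of_nat g = of_int b" using B by (rule Ints_cases)
  obtain c where c: "\<alpha> k = of_int c" using C by (rule Ints_cases)
  have part: "df t u = z * int (l t u div g)"
    if "t \<in> {0,1,2}" "u \<in> {1..n t}" "g dvd l t u" "\<alpha> t * of_nat g = of_int z" for t u z
  proof -
    have "l t u = g * (l t u div g)" using that(3) by simp
    hence "(of_nat (l t u) :: rat) = of_nat g * of_nat (l t u div g)" by (metis of_nat_mult)
    hence "(of_int (df t u) :: rat) = \<alpha> t * of_nat g * of_nat (l t u div g)"
      using \<alpha>[OF that(1,2)] by (simp add: mult.assoc)
    also have "\<dots> = of_int (z * int (l t u div g))" using that(4) by simp
    finally show ?thesis by (simp only: of_int_eq_iff)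
  qed
  have partk: "df k u = c * int (l k u)" if "u \<in> {1..n k}" for u
  proof -
    have "(of_int (df k u) :: rat) = of_int (c * int (l k u))" using \<alpha>[OF k that] c by simp
    thus ?thesis by (simp only: of_int_eq_iff)
  qed
  have "(of_int (a + b + int g * c) :: rat) = of_nat g * (\<alpha> i + \<alpha> j + \<alpha> k)"
    using a b c by (simp add: algebra_simps)
  hence "(of_int (a + b + int g * c) :: rat) = 0" using sum by simp
  hence "a + b + int g * c = 0" by (simp only: of_int_eq_0_iff)
  moreover have "\<forall>u\<in>{1..n i}. df i u = a * int (l i u div g)" using part[OF i _ g_dvd(1) a] by blast
  moreover have "\<forall>u\<in>{1..n j}. df j u = b * int (l j u div g)" using part[OF j _ g_dvd(2) b] by blast
  moreover have "\<forall>u\<in>{1..n k}. df k u = c * int (l k u)" using partk by blast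
  ultimately show ?thesis unfolding df_def by blast
qed

lemma block_shift:
  assumes "\<And>u. u \<in> {1..n t} \<Longrightarrow> int (Poly_Mapping.lookup m (t, u)) - int (Poly_Mapping.lookup m0 (t, u)) = z * int (e u)"
    and "\<And>u. u \<in> {1..n t} \<Longrightarrow> int (Poly_Mapping.lookup m' (t, u)) - int (Poly_Mapping.lookup m0 (t, u)) = z' * int (e u)"
    and "z' \<le> z"
  shows "(\<Prod>u\<in>{1..n t}. Var (t, u) ^ Poly_Mapping.lookup m (t, u)) =
    (\<Prod>u\<in>{1..n t}. Var (t, u) ^ Poly_Mapping.lookup m' (t, u)) * (\<Prod>u\<in>{1..n t}. Var (t, u) ^ e u) ^ nat (z - z')"
  unfolding prod_power_distrib prod.distrib[symmetric] power_mult[symmetric] power_add[symmetric]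
proof (intro prod.cong refl arg_cong2[where f = "(^)"])
  fix u assume u: "u \<in> {1..n t}"
  have "int (Poly_Mapping.lookup m (t, u)) = int (Poly_Mapping.lookup m' (t, u)) + (z - z') * int (e u)"
    using assms(1)[OF u] assms(2)[OF u] by (simp add: algebra_simps)
  also have "\<dots> = int (Poly_Mapping.lookup m' (t, u) + e u * nat (z - z'))"
    using assms(3) by simp
  finally show "Poly_Mapping.lookup m (t, u) = Poly_Mapping.lookup m' (t, u) + e u * nat (z - z')"
    by (simp only: of_nat_eq_iff)
qed

lemma finite_minimum:
  fixes f :: "'s \<Rightarrow> int"
  assumes "finite S" "S \<noteq> {}"
  obtains s where "s \<in> S" "\<And>t. t \<in> S \<Longrightarrow> f s \<le> f t"
proof -
  have "Min (f ` S) \<in> f ` S" using assms by (intro Min_in) auto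
  then obtain s where "s \<in> S" "Min (f ` S) = f s" by blast
  moreover have "Min (f ` S) \<le> f t" if "t \<in> S" for t using assms that by (intro Min_le) auto
  ultimately show thesis using that by metis
qed

text \<open>All monomials of one weight are a common monomial times binary forms of one degree in
  \<open>U\<close> and \<open>W\<close>; this is where the coprimality assumptions enter.\<close>

lemma forms_rep:
  assumes fin: "finite S" "S \<noteq> {}" and keys: "\<And>m. m \<in> S \<Longrightarrow> Poly_Mapping.keys m \<subseteq> I"
    and same: "\<And>m m'. m \<in> S \<Longrightarrow> m' \<in> S \<Longrightarrow> same m m'"
  shows "\<exists>e h. \<forall>p. Poly_Mapping.keys p \<subseteq> S \<longrightarrow>
    (\<exists>F. is_form U W h F \<and> p - (\<Prod>v\<in>I. Var v ^ e v) * F \<in> J)"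
proof -
  obtain m0 where m0: "m0 \<in> S" using fin by blast
  have "\<forall>m\<in>S. \<exists>A B C :: int.
    (\<forall>u\<in>{1..n i}. int (Poly_Mapping.lookup m (i, u)) - int (Poly_Mapping.lookup m0 (i, u)) = A * int (l i u div g)) \<and>
    (\<forall>u\<in>{1..n j}. int (Poly_Mapping.lookup m (j, u)) - int (Poly_Mapping.lookup m0 (j, u)) = B * int (l j u div g)) \<and>
    (\<forall>u\<in>{1..n k}. int (Poly_Mapping.lookup m (k, u)) - int (Poly_Mapping.lookup m0 (k, u)) = C * int (l k u)) \<and>
    A + B + int g * C = 0"
    using lattice same m0 by blast
  then obtain fA fB fC where f: "\<And>m. m \<in> S \<Longrightarrow>
    (\<forall>u\<in>{1..n i}. int (Poly_Mapping.lookup m (i, u)) - int (Poly_Mapping.lookup m0 (i, u)) = fA m * int (l i u div g)) \<and>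
    (\<forall>u\<in>{1..n j}. int (Poly_Mapping.lookup m (j, u)) - int (Poly_Mapping.lookup m0 (j, u)) = fB m * int (l j u div g)) \<and>
    (\<forall>u\<in>{1..n k}. int (Poly_Mapping.lookup m (k, u)) - int (Poly_Mapping.lookup m0 (k, u)) = fC m * int (l k u)) \<and>
    fA m + fB m + int g * fC m = 0" unfolding bchoice_iff by metis
  \<comment> \<open>The minimum is taken in each block separately, so the common factor with
    exponents \<open>e\<close> need not be a monomial of \<open>S\<close>.\<close>
  obtain mA where mA: "mA \<in> S" "\<And>m. m \<in> S \<Longrightarrow> fA mA \<le> fA m" using finite_minimum[OF fin] by metis
  obtain mB where mB: "mB \<in> S" "\<And>m. m \<in> S \<Longrightarrow> fB mB \<le> fB m" using finite_minimum[OF fin] by metis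
  obtain mC where mC: "mC \<in> S" "\<And>m. m \<in> S \<Longrightarrow> fC mC \<le> fC m" using finite_minimum[OF fin] by metis
  define e where "e v = (if fst v = i then Poly_Mapping.lookup mA v else if fst v = j then Poly_Mapping.lookup mB v
    else Poly_Mapping.lookup mC v)" for v
  \<comment> \<open>As \<open>fA + fB + g * fC\<close> is zero on every monomial of
    \<open>S\<close>, the degree \<open>a + b + g * c\<close> left after extracting the common
    factor is the same for all.\<close>
  define h where "h = nat (- (fA mA + fB mB + int g * fC mC))"
  define E :: "(nat \<times> nat, 'k) mpoly" where "E = (\<Prod>v\<in>I. Var v ^ e v)"
  have E: "E = (\<Prod>u\<in>{1..n i}. Var (i, u) ^ Poly_Mapping.lookup mA (i, u)) *
      (\<Prod>u\<in>{1..n j}. Var (j, u) ^ Poly_Mapping.lookup mB (j, u)) *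
      (\<Prod>u\<in>{1..n k}. Var (k, u) ^ Poly_Mapping.lookup mC (k, u))"
    unfolding E_def prod_I using ij ik jk by (simp add: e_def)
  have mono: "\<exists>F. is_form U W h F \<and> Poly_Mapping.single m 1 - E * F \<in> J" if m: "m \<in> S" for m
  proof -
    define a b c where "a = nat (fA m - fA mA)" and "b = nat (fB m - fB mB)" and "c = nat (fC m - fC mC)"
    have "int (a + b + g * c) = - (fA mA + fB mB + int g * fC mC)"
      using mA(2)[OF m] mB(2)[OF m] mC(2)[OF m] f[OF m] by (simp add: a_def b_def c_def algebra_simps)
    hence h: "a + b + g * c = h" unfolding h_def by (metis nat_int)
    have "Poly_Mapping.single m 1 = (\<Prod>v\<in>I. Var v ^ Poly_Mapping.lookup m v :: (nat \<times> nat, 'k) mpoly)"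
      by (rule monomial_prod[OF keys[OF m]])
    also have "\<dots> = (\<Prod>u\<in>{1..n i}. Var (i, u) ^ Poly_Mapping.lookup m (i, u)) *
      (\<Prod>u\<in>{1..n j}. Var (j, u) ^ Poly_Mapping.lookup m (j, u)) *
      (\<Prod>u\<in>{1..n k}. Var (k, u) ^ Poly_Mapping.lookup m (k, u))" by (rule prod_I)
    also have "(\<Prod>u\<in>{1..n i}. Var (i, u) ^ Poly_Mapping.lookup m (i, u)) =
      (\<Prod>u\<in>{1..n i}. Var (i, u) ^ Poly_Mapping.lookup mA (i, u)) * U ^ a"
      unfolding U_def a_def by (rule block_shift[where ?m0.0 = m0]) (use f[OF m] f[OF mA(1)] mA(2)[OF m] in blast)+
    also have "(\<Prod>u\<in>{1..n j}. Var (j, u) ^ Poly_Mapping.lookup m (j, u)) =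
      (\<Prod>u\<in>{1..n j}. Var (j, u) ^ Poly_Mapping.lookup mB (j, u)) * W ^ b"
      unfolding W_def b_def by (rule block_shift[where ?m0.0 = m0]) (use f[OF m] f[OF mB(1)] mB(2)[OF m] in blast)+
    also have "(\<Prod>u\<in>{1..n k}. Var (k, u) ^ Poly_Mapping.lookup m (k, u)) =
      (\<Prod>u\<in>{1..n k}. Var (k, u) ^ Poly_Mapping.lookup mC (k, u)) * M k ^ c"
      unfolding M_def c_def by (rule block_shift[where ?m0.0 = m0]) (use f[OF m] f[OF mC(1)] mC(2)[OF m] in blast)+
    finally have eq: "Poly_Mapping.single m 1 = E * (U ^ a * W ^ b * M k ^ c)" unfolding E by (simp only: mult_ac)
    have "E * (U ^ a * W ^ b) * (M k ^ c - (- (U ^ g + W ^ g)) ^ c) \<in> J"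
      by (rule J_rules(3)[OF J_power_diff[OF Mk_mod]])
    hence "Poly_Mapping.single m 1 - E * (U ^ a * W ^ b * (- (U ^ g + W ^ g)) ^ c) \<in> J"
      unfolding eq by (simp only: right_diff_distrib mult.assoc)
    moreover have "is_form U W h (U ^ a * W ^ b * (- (U ^ g + W ^ g)) ^ c)"
      using is_form_trinomial[of U W a b g c] h by simp
    ultimately show ?thesis by blast
  qed
  then obtain F where F: "\<And>m. m \<in> S \<Longrightarrow> is_form U W h (F m) \<and> Poly_Mapping.single m 1 - E * F m \<in> J" by metis
  have "\<exists>F. is_form U W h F \<and> p - E * F \<in> J" if p: "Poly_Mapping.keys p \<subseteq> S" for p
  proof (intro exI conjI)
    let ?c = "\<lambda>m. Cst (Poly_Mapping.lookup p m)"
    show "is_form U W h (\<Sum>m\<in>Poly_Mapping.keys p. ?c m * F m)"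
      using F p by (intro is_form_sum is_form_Cst_mult) blast
    have "p = (\<Sum>m\<in>Poly_Mapping.keys p. Poly_Mapping.single m (Poly_Mapping.lookup p m))" by (rule poly_mapping_sum_single)
    also have "\<dots> = (\<Sum>m\<in>Poly_Mapping.keys p. ?c m * Poly_Mapping.single m 1)"
      by (intro sum.cong refl) (rule single_eq_Cst_mult)
    finally have pe: "p = (\<Sum>m\<in>Poly_Mapping.keys p. ?c m * Poly_Mapping.single m 1)" .
    have "(\<Sum>m\<in>Poly_Mapping.keys p. ?c m * Poly_Mapping.single m 1) - E * (\<Sum>m\<in>Poly_Mapping.keys p. ?c m * F m)
      = (\<Sum>m\<in>Poly_Mapping.keys p. ?c m * (Poly_Mapping.single m 1 - E * F m))"
      unfolding sum_distrib_left sum_subtractf[symmetric] by (intro sum.cong refl) (simp only: right_diff_distrib mult_ac)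
    also have "\<dots> \<in> J" using F p by (intro poly_ideal_sum[OF J_ideal] J_rules(3)) blast
    finally show "p - E * (\<Sum>m\<in>Poly_Mapping.keys p. ?c m * F m) \<in> J" using pe by simp
  qed
  thus ?thesis unfolding E_def by blast
qed

end

text \<open>Along the orbit every member of the pencil is a combination of a pure power of a linear
  polynomial and a nonzero constant. If neither coefficient vanishes, it is a shifted power, all of
  whose roots are simple.\<close>

lemma pencil_simple_roots:
  fixes u v :: "'k::{alg_closed_field, field_char_0} poly"
  assumes ell: "smult \<alpha>0 u + smult \<beta>0 v = [:c0:]" "c0 \<noteq> 0"
    and pure: "smult \<gamma>0 u + smult d0 v = smult \<kappa> ([:s0, s1:] ^ e)" "\<kappa> \<noteq> 0" "s1 \<noteq> 0" "e > 0"
    and det: "\<gamma>0 * \<beta>0 \<noteq> d0 * \<alpha>0"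
    and ne: "\<gamma> * \<beta>0 \<noteq> d * \<alpha>0" "\<gamma> * d0 \<noteq> d * \<gamma>0"
  shows "\<exists>a. poly (smult \<gamma> u + smult d v) a = 0 \<and> poly (pderiv (smult \<gamma> u + smult d v)) a \<noteq> 0"
proof -
  define \<Delta> where "\<Delta> = \<gamma>0 * \<beta>0 - d0 * \<alpha>0"
  \<comment> \<open>Coordinates of \<open>(\<gamma>, d)\<close> with respect to the two given forms,
    by Cramer's rule.\<close>
  define x y where "x = (\<gamma> * \<beta>0 - d * \<alpha>0) / \<Delta>" and "y = (\<gamma>0 * d - d0 * \<gamma>) / \<Delta>"
  have \<Delta>: "\<Delta> \<noteq> 0" and x: "x \<noteq> 0" and y: "y \<noteq> 0"
    using det ne by (auto simp: \<Delta>_def x_def y_def mult.commute)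
  have "x * \<gamma>0 + y * \<alpha>0 = \<gamma> * \<Delta> / \<Delta>" "x * d0 + y * \<beta>0 = d * \<Delta> / \<Delta>"
    unfolding x_def y_def times_divide_eq_left add_divide_distrib[symmetric]
    by (simp_all add: \<Delta>_def algebra_simps)
  hence co: "x * \<gamma>0 + y * \<alpha>0 = \<gamma>" "x * d0 + y * \<beta>0 = d" using \<Delta> by simp_all
  have "smult \<gamma> u + smult d v = smult x (smult \<gamma>0 u + smult d0 v) + smult y (smult \<alpha>0 u + smult \<beta>0 v)"
    unfolding co[symmetric] by (simp add: smult_add_left smult_add_right)
  also have "\<dots> = smult (x * \<kappa>) ([:s0, s1:] ^ e) + [:y * c0:]" unfolding ell pure by simp
  finally have f: "smult \<gamma> u + smult d v = smult (x * \<kappa>) ([:s0, s1:] ^ e) + [:y * c0:]" .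
  \<comment> \<open>The value of the linear polynomial at a root; it is nonzero because
    \<open>y * c0\<close> is, so the derivative does not vanish there.\<close>
  obtain t where t: "t ^ e = - (y * c0) / (x * \<kappa>)" using nth_root_exists[OF pure(4)] by blast
  have t0: "t \<noteq> 0" using t y ell(2) x pure by (auto simp: power_0_left)
  define a where "a = (t - s0) / s1"
  have a: "s0 + a * s1 = t" using pure(3) by (simp add: a_def)
  have "poly (smult \<gamma> u + smult d v) a = x * \<kappa> * t ^ e + y * c0"
    unfolding f by (simp add: a)
  also have "\<dots> = 0" unfolding t using x pure(2) by simp
  finally have "poly (smult \<gamma> u + smult d v) a = 0" .
  moreover have "poly (pderiv (smult \<gamma> u + smult d v)) a = x * \<kappa> * (of_nat e * t ^ (e - 1) * s1)"
    unfolding f using pure(4) by (cases e) (simp_all add: pderiv_add pderiv_smult pderiv_power_Suc pderiv_pCons a algebra_simps del: power_Suc)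
  moreover have "x * \<kappa> * (of_nat e * t ^ (e - 1) * s1) \<noteq> 0" using x pure t0 by simp
  ultimately show ?thesis by auto
qed

text \<open>A base that vanishes at \<open>a\<close> still has exponent at least 1 in the product
  with lowered exponents, which divides the derivative.\<close>

lemma double_root:
  fixes t :: "'j \<Rightarrow> 'k::field_char_0 poly"
  assumes "finite B" "\<And>j. j \<in> B \<Longrightarrow> e j \<ge> 2" "poly (\<Prod>j\<in>B. t j ^ e j) a = 0"
  shows "poly (pderiv (\<Prod>j\<in>B. t j ^ e j)) a = 0"
proof -
  have "\<exists>j\<in>B. poly (t j) a ^ e j = 0" using assms(1,3) unfolding poly_prod poly_power by (simp add: prod_zero_iff)
  then obtain j where j: "j \<in> B" "poly (t j) a = 0" by auto
  have "poly (\<Prod>j\<in>B. t j ^ (e j - 1)) a = 0"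
    unfolding poly_prod poly_power
  proof (rule prod_zero[OF assms(1)])
    show "\<exists>j\<in>B. poly (t j) a ^ (e j - 1) = 0"
      by (rule bexI[OF _ j(1)]) (use j(2) assms(2)[OF j(1)] in \<open>simp add: power_0_left\<close>)
  qed
  moreover obtain r where "pderiv (\<Prod>j\<in>B. t j ^ e j) = (\<Prod>j\<in>B. t j ^ (e j - 1)) * r"
    using prod_power_pred_dvd(2)[OF assms(1), of t e] by (rule dvdE)
  ultimately show ?thesis by simp
qed

lemma wt_mult_keys:
  assumes "\<And>m. m \<in> Poly_Mapping.keys p \<Longrightarrow> wt w m = a" "\<And>m. m \<in> Poly_Mapping.keys q \<Longrightarrow> wt w m = b"
    and "m \<in> Poly_Mapping.keys (p * q)"
  shows "wt w m = a + b"
proof -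
  obtain x y where "m = x + y" "x \<in> Poly_Mapping.keys p" "y \<in> Poly_Mapping.keys q"
    using keys_mult[of p q] assms(3) by blast
  thus ?thesis using assms(1,2) by simp
qed

lemma wt_power_keys:
  fixes p :: "('v, 'k::comm_ring_1) mpoly"
  assumes "\<And>m. m \<in> Poly_Mapping.keys p \<Longrightarrow> wt w m = a" "m \<in> Poly_Mapping.keys (p ^ k)"
  shows "wt w m = int k * a"
  using assms(2)
proof (induction k arbitrary: m)
  case 0
  thus ?case by (auto split: if_splits)
next
  case (Suc k)
  have "wt w m = a + int k * a"
    by (rule wt_mult_keys[of p w a "p ^ k"]) (use assms(1) Suc in auto)
  thus ?case by (simp add: algebra_simps)
qed

section \<open>The kernel form, the pure power form and the exponents\<close>

context forms
begin

definition pU where "pU = (\<Sum>u\<in>{1..n i}. Poly_Mapping.single (i, u) (l i u div g))"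
definition pW where "pW = (\<Sum>u\<in>{1..n j}. Poly_Mapping.single (j, u) (l j u div g))"

lemma U_single: "U = Poly_Mapping.single pU 1" and W_single: "W = Poly_Mapping.single pW 1"
  unfolding U_def pU_def W_def pW_def Var_power by (rule prod_single)+

lemma wt_pU: "int g * wt w pU = wt w (mexp i)"
  unfolding pU_def wt_sum wt_mexp sum_distrib_left wt_single
proof (intro sum.cong refl)
  fix u assume "u \<in> {1..n i}"
  hence "int (l i u) = int g * int (l i u div g)" using g_dvd(1) by (metis dvd_mult_div_cancel of_nat_mult)
  thus "int g * (int (l i u div g) * w (i, u)) = int (l i u) * w (i, u)" by simp
qed

lemma wt_pW: "int g * wt w pW = wt w (mexp j)"
  unfolding pW_def wt_sum wt_mexp sum_distrib_left wt_single
proof (intro sum.cong refl)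
  fix u assume "u \<in> {1..n j}"
  hence "int (l j u) = int g * int (l j u div g)" using g_dvd(2) by (metis dvd_mult_div_cancel of_nat_mult)
  thus "int g * (int (l j u div g) * w (j, u)) = int (l j u) * w (j, u)" by simp
qed

lemma wt_pW_pU:
  assumes "w \<in> weights"
  shows "wt w pW = wt w pU"
proof -
  have "int g * wt w pW = int g * wt w pU" unfolding wt_pU wt_pW by (rule wt_mexp_eq[OF assms j i])
  thus ?thesis using g_pos by simp
qed

lemma U_polys_in: "U \<in> polys_in I" and W_polys_in: "W \<in> polys_in I"
proof -
  show "U \<in> polys_in I" unfolding U_def using i by (intro polys_in_prod polys_in_power) (simp add: I_iff)
  show "W \<in> polys_in I" unfolding W_def using j by (intro polys_in_prod polys_in_power) (simp add: I_iff)
qed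

lemma lin_polys_in: "lin U W \<alpha> \<beta> \<in> polys_in I"
  unfolding lin_def by (intro polys_in_add polys_in_mult polys_in_Cst U_polys_in W_polys_in)

lemma wt_lin:
  assumes "w \<in> weights" "m \<in> Poly_Mapping.keys (lin U W \<alpha> \<beta>)"
  shows "wt w m = wt w pU"
proof -
  have "m \<in> Poly_Mapping.keys (Cst \<alpha> * U) \<union> Poly_Mapping.keys (Cst \<beta> * W)"
    using assms(2) keys_add[of "Cst \<alpha> * U" "Cst \<beta> * W"] unfolding lin_def by blast
  hence "m = pU \<or> m = pW" by (auto simp: U_single W_single Cst_def mult_single split: if_splits)
  thus ?thesis using wt_pW_pU[OF assms(1)] by auto
qed

lemma DU: "D U \<notin> J" and DW: "D W \<notin> J"
proof -
  show "D U \<notin> J" using kernel_power[of U g] M_not_in_kernel[OF i] unfolding U_power by blast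
  show "D W \<notin> J" using kernel_power[of W g] M_not_in_kernel[OF j] unfolding W_power by blast
qed

lemma DCst_mult: "D (Cst c * p) \<in> J \<longleftrightarrow> c = 0 \<or> D p \<in> J"
proof -
  have "D (Cst c * p) = Cst c * D p" by simp
  thus ?thesis using J_mult_iff[of "Cst c" "D p"] by simp
qed

text \<open>Factorial closedness for a factorisation modulo \<open>J\<close>; \<open>E\<close> will
  be the extracted monomial and \<open>F\<close> the binary form.\<close>

lemma kernel_of_congruent:
  assumes "p \<notin> J" "D p \<in> J" "p - E * F \<in> J"
  shows "D E \<in> J" "D F \<in> J" "E \<notin> J" "F \<notin> J"
proof -
  have "E * F = p - (p - E * F)" by simp
  hence EF: "E * F \<notin> J" using assms(1) J_rules(2)[OF _ assms(3), of "E * F"] by auto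
  have "D (E * F) = D p - D (p - E * F)" by (simp del: mder_mult)
  hence DEF: "D (E * F) \<in> J" using J_rules(6)[OF assms(2) lnd_J[OF lnd assms(3)]] by simp
  show "D E \<in> J" by (rule kernel_factor[OF lnd EF DEF])
  show "D F \<in> J" by (rule kernel_factor[OF lnd, of F E]) (use EF DEF in \<open>simp_all only: mult.commute not_False_eq_True\<close>)
  show "E \<notin> J" "F \<notin> J" using EF J_mult_iff by auto
qed

text \<open>In each block a variable outside the kernel is chosen. A kernel element in the ideal of
  these three is a monomial times a binary form; the form is not constant, and by factorial
  closedness its linear factors lie in the kernel.\<close>

lemma exists_kernel_form: "\<exists>\<alpha> \<beta>. lin U W \<alpha> \<beta> \<notin> J \<and> D (lin U W \<alpha> \<beta>) \<in> J"
proof -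
  have "\<exists>u\<in>{1..n t}. D (Var (t, u)) \<notin> J" if "t \<in> {0,1,2}" for t
  proof (rule ccontr)
    assume "\<not> ?thesis"
    hence "D (M t) \<in> J" unfolding M_def by (intro kernel_prod kernel_power) blast
    thus False using M_not_in_kernel[OF that] by blast
  qed
  hence "\<forall>t\<in>{0,1,2}. \<exists>u. u \<in> {1..n t} \<and> D (Var (t, u)) \<notin> J" by (simp only: Bex_def) blast
  from bchoice[OF this] obtain a' where a': "\<forall>t\<in>{0,1,2}. a' t \<in> {1..n t} \<and> D (Var (t, a' t)) \<notin> J" ..
  define a where "a = restrict a' {0,1,2}"
  have aa: "a t = a' t" if "t \<in> {0,1,2}" for t unfolding a_def by (rule restrict_apply'[OF that])
  have aI: "a t \<in> {1..n t}" and aD: "D (Var (t, a t)) \<notin> J" if "t \<in> {0,1,2}" for t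
    unfolding aa[OF that] using bspec[OF a' that] by (rule conjunct1, rule conjunct2)
  have aPi: "a \<in> (\<Pi>\<^sub>E t\<in>{0,1,2}. {1..n t})"
    unfolding a_def restrict_PiE_iff
  proof
    fix t :: nat assume "t \<in> {0,1,2}"
    from conjunct1[OF bspec[OF a' this]] show "a' t \<in> {1..n t}" .
  qed
  obtain b m where b: "homog m b" "b \<notin> J" "D b \<in> J"
    "\<forall>m\<in>Poly_Mapping.keys b. \<exists>t\<in>{0,1,2}. Poly_Mapping.lookup m (t, a t) \<noteq> 0"
    using kernel_element_in_ideal[OF aPi] by blast
  have "\<exists>e h. \<forall>p. Poly_Mapping.keys p \<subseteq> Poly_Mapping.keys b \<longrightarrow>
    (\<exists>F. is_form U W h F \<and> p - (\<Prod>v\<in>I. Var v ^ e v) * F \<in> J)"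
  proof (rule forms_rep)
    show "Poly_Mapping.keys b \<noteq> {}" using notin_J_nonzero[OF b(2)] .
    show "Poly_Mapping.keys m' \<subseteq> I" if "m' \<in> Poly_Mapping.keys b" for m'
      using b(1) that unfolding homog_def polys_in_def by blast
    show "same m1 m2" if "m1 \<in> Poly_Mapping.keys b" "m2 \<in> Poly_Mapping.keys b" for m1 m2
      using b(1) that unfolding homog_def same_def by simp
  qed simp
  then obtain e h F where F: "is_form U W h F" "b - (\<Prod>v\<in>I. Var v ^ e v) * F \<in> J" by blast
  define E :: "(nat \<times> nat, 'k) mpoly" where "E = (\<Prod>v\<in>I. Var v ^ e v)"
  note EF = kernel_of_congruent[OF b(2,3) F(2), folded E_def]
  have "F \<noteq> 0" using EF(4) J_rules(1) by auto
  from is_form_splits[OF F(1) this] obtain c \<alpha> \<beta> where c: "c \<noteq> 0" "F = Cst c * (\<Prod>r<h. lin U W (\<alpha> r) (\<beta> r))"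
    by blast
  \<comment> \<open>For \<open>h = 0\<close> consider the point of \<open>V\<close> where the three
    chosen coordinates are 0 and the others 1. There \<open>b\<close> vanishes, but
    \<open>E * F\<close> does not: \<open>E\<close> is in the kernel and so contains none of the
    chosen variables.\<close>
  have "h \<noteq> 0"
  proof
    assume "h = 0"
    hence Fc: "F = Cst c" using c by simp
    have e0: "e (t, a t) = 0" if t: "t \<in> {0,1,2}" for t
    proof (rule ccontr)
      assume "e (t, a t) \<noteq> 0"
      then obtain r where r: "e (t, a t) = Suc r" by (cases "e (t, a t)") auto
      have "(t, a t) \<in> I" using t aI[OF t] by (simp add: I_iff)
      hence "E = Var (t, a t) ^ e (t, a t) * (\<Prod>v\<in>I - {(t, a t)}. Var v ^ e v)"
        unfolding E_def by (rule prod.remove[OF finite_I])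
      then obtain T where T: "E = Var (t, a t) * T" unfolding r power_Suc mult.assoc by blast
      have "D (Var (t, a t)) \<in> J" by (rule kernel_factor[OF lnd EF(3)[unfolded T] EF(1)[unfolded T]])
      thus False using aD[OF t] by blast
    qed
    define y where "y v = (if \<exists>t\<in>{0,1,2}. v = (t, a t) then 0 else if v \<in> I then 1 else (undefined :: 'k))" for v
    have y0: "y (t, a t) = 0" if "t \<in> {0,1,2}" for t using that unfolding y_def by auto
    have "eval_mpoly (M t) y = 0" if t: "t \<in> {0,1,2}" for t
      unfolding eval_M
    proof (rule prod_zero)
      show "\<exists>u\<in>{1..n t}. y (t, u) ^ l t u = 0"
        using y0[OF t] aI[OF t] l_pos[OF t aI[OF t]] by (intro bexI[of _ "a t"]) simp_all
    qed simp
    moreover have "y v = undefined" if "v \<notin> I" for v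
    proof -
      have "v \<noteq> (t, a t)" if "t \<in> {0,1,2}" for t using \<open>v \<notin> I\<close> aI[OF that] that by (auto simp: I_iff)
      thus ?thesis using that unfolding y_def by auto
    qed
    ultimately have yV: "y \<in> V" unfolding X_iff by (intro conjI allI impI sum.neutral) auto
    have "eval_mpoly b y = 0"
      by (rule eval_zero_if_keys) (use b(4) y0 in blast)
    moreover have "eval_mpoly E y = 1"
    proof -
      have "y v ^ e v = 1" if "v \<in> I" for v
      proof (cases "\<exists>t\<in>{0,1,2}. v = (t, a t)")
        case True
        then obtain t where t: "t \<in> {0,1,2}" "v = (t, a t)" ..
        show ?thesis unfolding t(2) e0[OF t(1)] by (rule power_0)
      next
        case False
        hence "y v = 1" unfolding y_def using that by (simp only: if_False if_True)
        thus ?thesis by simp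
      qed
      thus ?thesis unfolding E_def by (simp add: prod.neutral del: split_paired_All)
    qed
    moreover have "eval_mpoly (b - E * F) y = 0" using F(2) yV unfolding E_def J_def by blast
    ultimately show False using c(1) Fc by simp
  qed
  then obtain h' where "h = Suc h'" by (cases h) auto
  hence "F = lin U W (\<alpha> h') (\<beta> h') * (Cst c * (\<Prod>r<h'. lin U W (\<alpha> r) (\<beta> r)))"
    using c(2) by (simp add: mult_ac)
  hence "lin U W (\<alpha> h') (\<beta> h') \<notin> J \<and> D (lin U W (\<alpha> h') (\<beta> h')) \<in> J"
    using EF(2,4) kernel_factor[OF lnd, of "lin U W (\<alpha> h') (\<beta> h')" "Cst c * (\<Prod>r<h'. lin U W (\<alpha> r) (\<beta> r))"]
      J_mult_iff[of "lin U W (\<alpha> h') (\<beta> h')" "Cst c * (\<Prod>r<h'. lin U W (\<alpha> r) (\<beta> r))"] by (simp only: simp_thms de_Morgan_disj)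
  thus ?thesis by blast
qed

text \<open>Up to nonzero scalars and a multiple of the kernel form, every linear form not
  proportional to the latter is \<open>U\<close>, so its derivatives of positive order lie in
  \<open>J\<close> exactly when those of \<open>U\<close> do.\<close>

lemma isdeg_lin:
  assumes ell: "lin U W \<alpha>0 \<beta>0 \<notin> J" "D (lin U W \<alpha>0 \<beta>0) \<in> J" "\<alpha>0 \<noteq> 0" "\<beta>0 \<noteq> 0"
    and e: "isdeg \<delta> U e" and nz: "\<gamma> \<noteq> 0 \<or> d \<noteq> 0"
  shows "isdeg \<delta> (lin U W \<gamma> d) (if \<gamma> * \<beta>0 = d * \<alpha>0 then 0 else e)"
proof (cases "\<gamma> * \<beta>0 = d * \<alpha>0")
  case True
  have t: "\<gamma> = (\<gamma> / \<alpha>0) * \<alpha>0" "d = (\<gamma> / \<alpha>0) * \<beta>0" using ell True by (simp_all add: field_simps)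
  have t0: "\<gamma> / \<alpha>0 \<noteq> 0" using nz t(2) ell by auto
  have "lin U W \<gamma> d = Cst (\<gamma> / \<alpha>0) * lin U W \<alpha>0 \<beta>0"
    unfolding lin_def distrib_left mult.assoc[symmetric] Cst_mult[symmetric] t[symmetric] ..
  thus ?thesis using True t0 ell DCst_mult[of "\<gamma> / \<alpha>0" "lin U W \<alpha>0 \<beta>0"]
    by (simp add: isdeg_0_iff J_mult_iff)
next
  case False
  let ?ell = "lin U W \<alpha>0 \<beta>0"
  have eq: "Cst \<beta>0 * lin U W \<gamma> d = Cst (\<gamma> * \<beta>0 - d * \<alpha>0) * U + Cst d * ?ell"
    unfolding lin_def diff_conv_add_uminus Cst_add Cst_uminus Cst_mult by (simp add: algebra_simps)
  have e0: "e \<noteq> 0" using e DU by (cases e) (auto simp: isdeg_def)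
  have ellD: "(D ^^ m) ?ell \<in> J" if "m > 0" for m
    using lnd_funpow_le[OF lnd, of 1 ?ell m] ell(2) that by simp
  have pw: "Cst \<beta>0 * (D ^^ m) (lin U W \<gamma> d) = Cst (\<gamma> * \<beta>0 - d * \<alpha>0) * (D ^^ m) U + Cst d * (D ^^ m) ?ell" for m
    using arg_cong[OF eq, of "D ^^ m"] by (simp only: funpow_mder_add funpow_mder_Cst_mult)
  have "(D ^^ m) (lin U W \<gamma> d) \<in> J \<longleftrightarrow> (D ^^ m) U \<in> J" if m: "m > 0" for m
  proof -
    have ellc: "Cst d * (D ^^ m) ?ell \<in> J" by (rule J_rules(3)[OF ellD[OF m]])
    have "Cst \<beta>0 * (D ^^ m) (lin U W \<gamma> d) \<in> J \<longleftrightarrow> Cst (\<gamma> * \<beta>0 - d * \<alpha>0) * (D ^^ m) U \<in> J"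
      unfolding pw using J_rules(2)[OF _ ellc, of "Cst (\<gamma> * \<beta>0 - d * \<alpha>0) * (D ^^ m) U"]
        J_rules(6)[OF _ ellc, of "Cst (\<gamma> * \<beta>0 - d * \<alpha>0) * (D ^^ m) U + Cst d * (D ^^ m) ?ell"] by auto
    thus ?thesis using False ell(4) by (simp add: J_mult_iff)
  qed
  from this[of e] this[of "Suc e"] show ?thesis
    using False e e0 by (simp add: isdeg_def del: funpow.simps)
qed

text \<open>With \<open>s\<close> the last nonconstant derivative of \<open>U\<close> and \<open>c\<close> its derivative, \<open>s\<^sup>e\<close> and
  \<open>c\<^sup>e\<^sup>-\<^sup>1 \<ell>\<close> have the same weight, so \<open>s\<^sup>e\<close> is a kernel element times a single linear form.\<close>

lemma exists_pure_power_form: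
  assumes ell: "lin U W \<alpha>0 \<beta>0 \<notin> J" "D (lin U W \<alpha>0 \<beta>0) \<in> J" "\<alpha>0 \<noteq> 0" "\<beta>0 \<noteq> 0"
  shows "\<exists>x \<gamma> d \<kappa> s0 s1 e. x \<in> V \<and> eval_mpoly (lin U W \<alpha>0 \<beta>0) x \<noteq> 0 \<and>
    orb \<delta> x (lin U W \<gamma> d) = smult \<kappa> ([:s0, s1:] ^ e) \<and> \<kappa> \<noteq> 0 \<and> s1 \<noteq> 0 \<and> e > 0 \<and> \<gamma> * \<beta>0 \<noteq> d * \<alpha>0"
proof -
  let ?ell = "lin U W \<alpha>0 \<beta>0"
  have "U \<notin> J" using DU lnd_J[OF lnd] by blast
  then obtain e where e: "isdeg \<delta> U e" using isdeg_exists[OF lnd] by blast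
  have e0: "e > 0" using e DU by (cases e) (auto simp: isdeg_def)
  define s c where "s = (D ^^ (e - 1)) U" and "c = (D ^^ e) U"
  have Ds: "D s = c" using e0 by (cases e) (simp_all add: s_def c_def)
  have c: "c \<notin> J" "D c \<in> J" using e by (simp_all add: isdeg_def c_def)
  have s: "s \<notin> J" using lnd_J[OF lnd, of s] Ds c by auto
  have degs: "isdeg \<delta> s 1" using Ds c by (simp add: isdeg_def)
  define p1 p2 where "p1 = s ^ e" and "p2 = c ^ (e - 1) * ?ell"
  have p1: "p1 \<notin> J" using s by (simp add: p1_def power_in_J)
  have p2: "p2 \<notin> J" "D p2 \<in> J"
  proof -
    show "p2 \<notin> J" using c ell by (simp add: p2_def power_in_J J_mult_iff)
    show "D p2 \<in> J" unfolding p2_def by (intro kernel_mult kernel_power c ell)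
  qed
  have pin: "p1 \<in> polys_in I" "p2 \<in> polys_in I"
    unfolding p1_def p2_def s_def c_def
    by (intro polys_in_mult polys_in_power D_funpow_polys_in U_polys_in lin_polys_in)+
  have wU: "wt w m = wt w pU" if "m \<in> Poly_Mapping.keys U" for m w
    using that by (auto simp: U_single split: if_splits)
  have w1: "wt w m = int e * (wt w pU + int (e - 1) * eps w)" if "w \<in> weights" "m \<in> Poly_Mapping.keys p1" for w m
    using that(2) unfolding p1_def
    by (rule wt_power_keys[rotated]) (unfold s_def, rule wt_D_funpow[OF that(1) wU])
  have w2: "wt w m = int e * (wt w pU + int (e - 1) * eps w)" if "w \<in> weights" "m \<in> Poly_Mapping.keys p2" for w m
  proof -
    have "wt w m = int (e - 1) * (wt w pU + int e * eps w) + wt w pU"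
    proof (rule wt_mult_keys[OF _ _ that(2)[unfolded p2_def]])
      show "wt w m' = int (e - 1) * (wt w pU + int e * eps w)" if "m' \<in> Poly_Mapping.keys (c ^ (e - 1))" for m'
        using that by (rule wt_power_keys[rotated]) (unfold c_def, rule wt_D_funpow[OF \<open>w \<in> weights\<close> wU])
      show "wt w m' = wt w pU" if "m' \<in> Poly_Mapping.keys ?ell" for m'
        by (rule wt_lin[OF \<open>w \<in> weights\<close> that])
    qed
    thus ?thesis using e0 by (simp add: of_nat_diff algebra_simps)
  qed
  have "\<exists>ex h. \<forall>p. Poly_Mapping.keys p \<subseteq> Poly_Mapping.keys p1 \<union> Poly_Mapping.keys p2 \<longrightarrow>
    (\<exists>F. is_form U W h F \<and> p - (\<Prod>v\<in>I. Var v ^ ex v) * F \<in> J)"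
  proof (rule forms_rep)
    show "Poly_Mapping.keys p1 \<union> Poly_Mapping.keys p2 \<noteq> {}" using notin_J_nonzero[OF p1] by blast
    show "Poly_Mapping.keys m \<subseteq> I" if "m \<in> Poly_Mapping.keys p1 \<union> Poly_Mapping.keys p2" for m
      using pin that unfolding polys_in_def by blast
    show "same m m'" if "m \<in> Poly_Mapping.keys p1 \<union> Poly_Mapping.keys p2" "m' \<in> Poly_Mapping.keys p1 \<union> Poly_Mapping.keys p2" for m m'
      unfolding same_def using that w1 w2 by (metis UnE)
  qed simp
  then obtain ex h where rep: "\<And>p. Poly_Mapping.keys p \<subseteq> Poly_Mapping.keys p1 \<union> Poly_Mapping.keys p2 \<Longrightarrow>
    \<exists>F. is_form U W h F \<and> p - (\<Prod>v\<in>I. Var v ^ ex v) * F \<in> J" by blast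
  define E :: "(nat \<times> nat, 'k) mpoly" where "E = (\<Prod>v\<in>I. Var v ^ ex v)"
  obtain F where F: "is_form U W h F" "p1 - E * F \<in> J" using rep[of p1] unfolding E_def by blast
  obtain F' where F': "p2 - E * F' \<in> J" using rep[of p2] unfolding E_def by blast
  \<comment> \<open>This is the purpose of \<open>p2\<close>: the common monomial \<open>E\<close>
    divides a kernel element modulo \<open>J\<close>, so it is in the kernel itself.\<close>
  note E = kernel_of_congruent(1,3)[OF p2 F']
  have "F \<noteq> 0" using F(2) p1 by auto
  from is_form_splits[OF F(1) this] obtain \<kappa> \<alpha> \<beta> where \<kappa>: "\<kappa> \<noteq> 0" "\<forall>r<h. \<alpha> r \<noteq> 0 \<or> \<beta> r \<noteq> 0"
    "F = Cst \<kappa> * (\<Prod>r<h. lin U W (\<alpha> r) (\<beta> r))" by blast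
  define P where "P r \<longleftrightarrow> \<alpha> r * \<beta>0 = \<beta> r * \<alpha>0" for r
  have lindeg: "isdeg \<delta> (lin U W (\<alpha> r) (\<beta> r)) (if P r then 0 else e)" if "r < h" for r
    unfolding P_def by (rule isdeg_lin[OF ell e]) (use \<kappa>(2) that in blast)
  have "isdeg \<delta> (\<Prod>r<h. lin U W (\<alpha> r) (\<beta> r)) (\<Sum>r<h. if P r then 0 else e)"
    by (rule isdeg_prod[OF lnd]) (use lindeg in auto)
  hence "isdeg \<delta> (E * F) (0 + (0 + (\<Sum>r<h. if P r then 0 else e)))"
    unfolding \<kappa>(3) using E \<kappa>(1) by (intro isdeg_mult[OF lnd] isdeg_Cst) (simp_all add: isdeg_0_iff)
  moreover have "isdeg \<delta> (E * F) (e * 1)"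
    by (rule isdeg_mod[OF lnd F(2)]) (unfold p1_def, rule isdeg_power[OF lnd degs])
  \<comment> \<open>The degree of \<open>s^e\<close> is \<open>e\<close>, and each linear factor has
    degree 0 or \<open>e\<close>; so exactly one factor is not proportional to the kernel
    form.\<close>
  ultimately have sum_e: "(\<Sum>r<h. if P r then 0 else e) = e" using isdeg_unique[OF lnd] by fastforce
  have "(\<Sum>r<h. if P r then 0 else e) = (\<Sum>r\<in>{r\<in>{..<h}. \<not> P r}. e)"
    by (rule sum.mono_neutral_cong_right) auto
  also have "\<dots> = card {r\<in>{..<h}. \<not> P r} * e" by simp
  finally have "e = card {r\<in>{..<h}. \<not> P r} * e" unfolding sum_e .
  hence "card {r\<in>{..<h}. \<not> P r} = 1" using e0 by auto
  then obtain r0 where r0: "{r\<in>{..<h}. \<not> P r} = {r0}" by (auto simp: card_1_singleton_iff)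
  hence r0h: "r0 < h" "\<not> P r0" and Pr: "\<And>r. r \<in> {..<h} - {r0} \<Longrightarrow> P r" by auto
  define Q where "Q = (\<Prod>r\<in>{..<h} - {r0}. lin U W (\<alpha> r) (\<beta> r))"
  have linQ: "isdeg \<delta> (lin U W (\<alpha> r) (\<beta> r)) 0" if "r \<in> {..<h} - {r0}" for r
    using lindeg[of r] Pr[OF that] that by simp
  have DQ: "D Q \<in> J" unfolding Q_def by (rule kernel_prod) (use linQ in \<open>simp add: isdeg_0_iff\<close>)
  have QJ: "Q \<notin> J" unfolding Q_def by (rule prod_notin_J) (use linQ in \<open>simp_all add: isdeg_0_iff\<close>)
  have Feq: "F = Cst \<kappa> * (lin U W (\<alpha> r0) (\<beta> r0) * Q)"
    unfolding \<kappa>(3) Q_def using r0h(1) by (subst prod.remove[of _ r0]) auto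
  have "\<exists>x\<in>V. \<forall>p\<in>{c, ?ell, E, Q}. eval_mpoly p x \<noteq> 0"
    by (rule generic_point) (use c ell E QJ in auto)
  then obtain x where x: "x \<in> V" "eval_mpoly c x \<noteq> 0" "eval_mpoly ?ell x \<noteq> 0" "eval_mpoly E x \<noteq> 0" "eval_mpoly Q x \<noteq> 0"
    by auto
  note nil = lnd_nil_at[OF lnd x(1)]
  have orbs: "orb \<delta> x s = [:eval_mpoly s x, eval_mpoly c x:]"
  proof (rule poly_eqI)
    fix q
    have "(D ^^ Suc (Suc r)) s \<in> J" for r
      using lnd_funpow_J[OF lnd c(2), of r] by (simp add: funpow_swap1 Ds)
    hence "eval_mpoly ((D ^^ Suc (Suc r)) s) x = 0" for r using x(1) unfolding J_def by blast
    thus "coeff (orb \<delta> x s) q = coeff [:eval_mpoly s x, eval_mpoly c x:] q"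
    proof (cases q)
      case (Suc r)
      have "(D ^^ Suc 0) s = c" using Ds by simp
      thus ?thesis using Suc \<open>\<And>r. eval_mpoly ((D ^^ Suc (Suc r)) s) x = 0\<close>
        by (cases r) (simp_all add: coeff_orb[OF nil] coeff_pCons del: funpow.simps(2))
    qed (simp add: coeff_orb[OF nil])
  qed
  define K where "K = eval_mpoly E x * \<kappa> * eval_mpoly Q x"
  have K: "K \<noteq> 0" using x \<kappa>(1) by (simp add: K_def)
  have "orb \<delta> x p1 = orb \<delta> x (p1 - E * F) + orb \<delta> x (E * F)" by (simp flip: orb_add[OF nil])
  hence "orb \<delta> x s ^ e = orb \<delta> x (E * F)"
    using orb_mod_J[OF lnd x(1) F(2)] by (simp add: p1_def orb_power[OF nil])
  also have "\<dots> = [:eval_mpoly E x:] * ([:\<kappa>:] * (orb \<delta> x (lin U W (\<alpha> r0) (\<beta> r0)) * [:eval_mpoly Q x:]))"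
    unfolding Feq orb_mult[OF nil] orb_Cst[OF nil] orb_kernel[OF lnd x(1) E(1)] orb_kernel[OF lnd x(1) DQ] ..
  also have "\<dots> = smult K (orb \<delta> x (lin U W (\<alpha> r0) (\<beta> r0)))" by (simp add: K_def mult_ac)
  finally have "smult (1 / K) (orb \<delta> x s ^ e) = orb \<delta> x (lin U W (\<alpha> r0) (\<beta> r0))" using K by simp
  thus ?thesis using x(1,2,3) K e0 r0h(2) unfolding orbs P_def
    by (intro exI[of _ x] exI[of _ "\<alpha> r0"] exI[of _ "\<beta> r0"] exI[of _ "1 / K"] exI[of _ "eval_mpoly s x"]
      exI[of _ "eval_mpoly c x"] exI[of _ e]) simp
qed

lemma lin_zero: "lin U W 0 \<beta> = Cst \<beta> * W" "lin U W \<alpha> 0 = Cst \<alpha> * U"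
  by (simp_all add: lin_def)

lemma kernel_form_coefficients:
  assumes "lin U W \<alpha> \<beta> \<notin> J" "D (lin U W \<alpha> \<beta>) \<in> J"
  shows "\<alpha> \<noteq> 0" "\<beta> \<noteq> 0"
proof -
  show "\<alpha> \<noteq> 0"
  proof
    assume "\<alpha> = 0"
    from assms[unfolded this lin_zero] show False unfolding DCst_mult using DW by (auto simp: J_mult_iff)
  qed
  show "\<beta> \<noteq> 0"
  proof
    assume "\<beta> = 0"
    from assms[unfolded this lin_zero] show False unfolding DCst_mult using DU by (auto simp: J_mult_iff)
  qed
qed

lemma orb_Mk:
  assumes "x \<in> V"
  shows "orb \<delta> x (M k) = - (orb \<delta> x U ^ g + orb \<delta> x W ^ g)"
proof -
  note nil = lnd_nil_at[OF lnd assms]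
  have "M k + (U ^ g + W ^ g) \<in> J" using Mk_mod by (simp only: diff_minus_eq_add)
  hence "orb \<delta> x (M k + (U ^ g + W ^ g)) = 0" by (rule orb_mod_J[OF lnd assms])
  hence "orb \<delta> x (M k) + (orb \<delta> x U ^ g + orb \<delta> x W ^ g) = 0"
    by (simp only: orb_add[OF nil] orb_power[OF nil])
  thus ?thesis by (simp only: eq_neg_iff_add_eq_0)
qed

lemma double_root_Mk:
  assumes "x \<in> V" "poly (orb \<delta> x (M k)) a = 0"
  shows "poly (pderiv (orb \<delta> x (M k))) a = 0"
  using assms(2) unfolding orb_M[OF assms(1)]
  by (intro double_root[OF _ l2[OF k]]) simp_all

lemma exponent_div_g_ge_2:
  assumes "t \<in> {0,1,2}" "u \<in> {1..n t}" "g dvd l t u" "l t u \<noteq> g"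
  shows "l t u div g \<ge> 2"
proof -
  obtain q where q: "l t u = g * q" using assms(3) by (rule dvdE)
  have "l t u > 0" by (rule l_pos[OF assms(1,2)])
  hence "q \<noteq> 0" "q \<noteq> 1" using q assms(4) by auto
  thus ?thesis unfolding q using g_pos by simp
qed

text \<open>Without an exponent equal to \<open>g\<close>, all exponents of \<open>U\<close> are at
  least 2 and its roots along the orbit are multiple.\<close>

lemma simple_root_U:
  assumes "x \<in> V" "poly (orb \<delta> x U) a = 0" "poly (pderiv (orb \<delta> x U)) a \<noteq> 0"
  shows "\<exists>u\<in>{1..n i}. l i u = g"
proof (rule ccontr)
  assume "\<not> ?thesis"
  hence "l i u div g \<ge> 2" if "u \<in> {1..n i}" for u
    using exponent_div_g_ge_2[OF i that g_dvd(1)[OF that]] that by blast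
  moreover have "orb \<delta> x U = (\<Prod>u\<in>{1..n i}. orb \<delta> x (Var (i, u)) ^ (l i u div g))"
    unfolding U_def by (simp add: orb_prod[OF lnd_nil_at[OF lnd assms(1)]] orb_power[OF lnd_nil_at[OF lnd assms(1)]])
  ultimately show False
    using double_root[of "{1..n i}" "\<lambda>u. l i u div g" "\<lambda>u. orb \<delta> x (Var (i, u))" a] assms by simp
qed

lemma simple_root_W:
  assumes "x \<in> V" "poly (orb \<delta> x W) a = 0" "poly (pderiv (orb \<delta> x W)) a \<noteq> 0"
  shows "\<exists>u\<in>{1..n j}. l j u = g"
proof (rule ccontr)
  assume "\<not> ?thesis"
  hence "l j u div g \<ge> 2" if "u \<in> {1..n j}" for u
    using exponent_div_g_ge_2[OF j that g_dvd(2)[OF that]] that by blast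
  moreover have "orb \<delta> x W = (\<Prod>u\<in>{1..n j}. orb \<delta> x (Var (j, u)) ^ (l j u div g))"
    unfolding W_def by (simp add: orb_prod[OF lnd_nil_at[OF lnd assms(1)]] orb_power[OF lnd_nil_at[OF lnd assms(1)]])
  ultimately show False
    using double_root[of "{1..n j}" "\<lambda>u. l j u div g" "\<lambda>u. orb \<delta> x (Var (j, u))" a] assms by simp
qed

lemma exponents_two:
  "\<exists>a\<in>{1..n i}. \<exists>b\<in>{1..n j}. l i a = 2 \<and> l j b = 2 \<and>
    (\<forall>u\<in>{1..n i}. \<forall>v\<in>{1..n j}. even (l i u) \<and> even (l j v))"
proof -
  obtain \<alpha>0 \<beta>0 where ell: "lin U W \<alpha>0 \<beta>0 \<notin> J" "D (lin U W \<alpha>0 \<beta>0) \<in> J"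
    using exists_kernel_form by blast
  note nz = kernel_form_coefficients[OF ell]
  obtain x \<gamma>0 d0 \<kappa> s0 s1 e where x: "x \<in> V" "eval_mpoly (lin U W \<alpha>0 \<beta>0) x \<noteq> 0"
    and pure: "orb \<delta> x (lin U W \<gamma>0 d0) = smult \<kappa> ([:s0, s1:] ^ e)" "\<kappa> \<noteq> 0" "s1 \<noteq> 0" "e > 0"
    and det: "\<gamma>0 * \<beta>0 \<noteq> d0 * \<alpha>0"
    using exists_pure_power_form[OF ell nz] by blast
  note nil = lnd_nil_at[OF lnd x(1)]
  define u v c0 where "u = orb \<delta> x U" and "v = orb \<delta> x W" and "c0 = eval_mpoly (lin U W \<alpha>0 \<beta>0) x"
  have c0: "c0 \<noteq> 0" using x by (simp add: c0_def)
  have orb_lin: "orb \<delta> x (lin U W \<gamma> d) = smult \<gamma> u + smult d v" for \<gamma> d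
    unfolding lin_def u_def v_def by (simp only: orb_add[OF nil] orb_Cst_mult[OF nil])
  have ell_c0: "smult \<alpha>0 u + smult \<beta>0 v = [:c0:]"
    unfolding orb_lin[symmetric] c0_def by (rule orb_kernel[OF lnd x(1) ell(2)])
  note simple = pencil_simple_roots[OF ell_c0 c0 pure[unfolded orb_lin] det]
  \<comment> \<open>\<open>U - \<zeta> W\<close> is a linear factor of \<open>U^g + W^g\<close>. At
    a simple root \<open>a\<close> of \<open>u - \<zeta> v\<close> the value of \<open>v\<close> is
    nonzero, since the kernel form is a nonzero constant; so the derivative of
    \<open>u^g + v^g\<close> would not vanish, but \<open>M k\<close> has only multiple
    roots.\<close>
  have A: "\<beta>0 = - \<zeta> * \<alpha>0 \<or> d0 = - \<zeta> * \<gamma>0" if \<zeta>: "\<zeta> ^ g = - 1" for \<zeta>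
  proof (rule ccontr)
    assume "\<not> ?thesis"
    hence "1 * \<beta>0 \<noteq> - \<zeta> * \<alpha>0" "1 * d0 \<noteq> - \<zeta> * \<gamma>0" by simp_all
    from simple[OF this] obtain a where "poly (smult 1 u + smult (- \<zeta>) v) a = 0"
      "poly (pderiv (smult 1 u + smult (- \<zeta>) v)) a \<noteq> 0" by blast
    hence a: "poly u a = \<zeta> * poly v a" "poly (pderiv u) a \<noteq> \<zeta> * poly (pderiv v) a"
      by (simp_all add: pderiv_add pderiv_smult pderiv_minus pderiv_diff)
    have va: "poly v a \<noteq> 0"
    proof
      assume "poly v a = 0"
      hence "poly [:c0:] a = 0" unfolding ell_c0[symmetric] using a(1) by simp
      thus False using c0 by simp
    qed
    have "poly (orb \<delta> x (M k)) a = 0"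
      unfolding orb_Mk[OF x(1)] u_def[symmetric] v_def[symmetric] using a(1) \<zeta> by (simp add: power_mult_distrib)
    hence "poly (pderiv (orb \<delta> x (M k))) a = 0" by (rule double_root_Mk[OF x(1)])
    hence "of_nat g * (poly u a ^ (g - 1) * poly (pderiv u) a) + of_nat g * (poly v a ^ (g - 1) * poly (pderiv v) a) = 0"
      unfolding orb_Mk[OF x(1)] u_def[symmetric] v_def[symmetric]
      by (simp add: pderiv_minus pderiv_add pderiv_power neg_eq_iff_add_eq_0 mult.assoc flip: poly_power del: minus_add_distrib)
    hence "of_nat g * (poly v a ^ (g - 1) * (\<zeta> ^ (g - 1) * poly (pderiv u) a + poly (pderiv v) a)) = 0"
      unfolding a(1) power_mult_distrib by (simp only: ring_distribs mult_ac)
    hence 0: "\<zeta> ^ (g - 1) * poly (pderiv u) a + poly (pderiv v) a = 0" using va g_pos by simp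
    have "\<zeta> * \<zeta> ^ (g - 1) = - 1" using \<zeta> g_pos by (simp flip: power_Suc)
    moreover have "\<zeta> * \<zeta> ^ (g - 1) * poly (pderiv u) a + \<zeta> * poly (pderiv v) a = 0"
      using 0 by (metis distrib_left mult.assoc mult_zero_right)
    ultimately show False using a(2) by simp
  qed
  \<comment> \<open>If the pure power form is a multiple of \<open>U\<close> or \<open>W\<close>, it
    matches no factor \<open>U - \<zeta> W\<close>, so all factors must be proportional to the
    kernel form.\<close>
  have roots_bound: "g \<le> 1" if "\<gamma>0 = 0 \<or> d0 = 0"
  proof -
    have "poly [:\<beta>0, \<alpha>0:] \<zeta> = 0" if "\<zeta> ^ g = - 1" for \<zeta>
    proof -
      have "\<zeta> \<noteq> 0" using that g_pos by (auto simp: power_0_left)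
      hence "d0 \<noteq> - \<zeta> * \<gamma>0" using \<open>\<gamma>0 = 0 \<or> d0 = 0\<close> det by auto
      thus ?thesis using A[OF that] by simp
    qed
    hence "degree [:\<beta>0, \<alpha>0:] \<ge> g" using nz g_pos by (intro root_power_roots[of _ g "-1"]) auto
    thus ?thesis using nz by simp
  qed
  \<comment> \<open>The two linear polynomials in \<open>\<zeta>\<close> encode the alternatives of
    \<open>A\<close>; their product vanishes at all \<open>g\<close> solutions of
    \<open>\<zeta>^g = -1\<close>.\<close>
  have g2: "g \<le> 2"
  proof -
    let ?q = "[:\<beta>0, \<alpha>0:] * [:d0, \<gamma>0:]"
    have "?q \<noteq> 0" using nz det by auto
    moreover have "poly ?q \<zeta> = 0" if "\<zeta> ^ g = - 1" for \<zeta> using A[OF that] unfolding poly_mult by auto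
    ultimately have "degree ?q \<ge> g" using g_pos by (intro root_power_roots[of _ g "-1"]) auto
    moreover have "degree ?q \<le> degree [:\<beta>0, \<alpha>0:] + degree [:d0, \<gamma>0:]" by (rule degree_mult_le)
    moreover have "degree [:\<beta>0, \<alpha>0:] \<le> 1" "degree [:d0, \<gamma>0:] \<le> 1" by simp_all
    ultimately show ?thesis by linarith
  qed
  \<comment> \<open>\<open>U\<close> is not proportional to the kernel form as
    \<open>\<beta>0\<close> is nonzero, nor to the pure power form when \<open>d0\<close> is
    nonzero; hence it has a simple root.\<close>
  have BU: "\<exists>a\<in>{1..n i}. l i a = g" if "d0 \<noteq> 0"
  proof -
    have "\<exists>a. poly (smult 1 u + smult 0 v) a = 0 \<and> poly (pderiv (smult 1 u + smult 0 v)) a \<noteq> 0"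
      by (rule simple) (use nz that in simp_all)
    thus ?thesis using simple_root_U[OF x(1)] unfolding u_def by auto
  qed
  have BW: "\<exists>b\<in>{1..n j}. l j b = g" if "\<gamma>0 \<noteq> 0"
  proof -
    have "\<exists>a. poly (smult 0 u + smult 1 v) a = 0 \<and> poly (pderiv (smult 0 u + smult 1 v)) a \<noteq> 0"
      by (rule simple) (use nz that in simp_all)
    thus ?thesis using simple_root_W[OF x(1)] unfolding v_def by auto
  qed
  \<comment> \<open>For \<open>g = 1\<close> the only factor is \<open>U + W\<close>, congruent to
    \<open>- M k\<close> and thus not in the kernel. So it is proportional to the pure power form,
    \<open>U\<close> has a simple root, and an exponent 1 appears.\<close>
  have "g \<noteq> 1"
  proof
    assume g1: "g = 1"
    have "\<beta>0 \<noteq> \<alpha>0"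
    proof
      assume "\<beta>0 = \<alpha>0"
      hence "lin U W \<alpha>0 \<beta>0 = Cst \<alpha>0 * (U + W)" unfolding lin_def by (simp only: distrib_left)
      hence "D (U + W) \<in> J" using ell(2) nz(1) DCst_mult[of \<alpha>0 "U + W"] by (simp only: simp_thms)
      moreover have Mk: "M k + (U + W) \<in> J" using Mk_mod unfolding g1 by (simp only: diff_minus_eq_add power_one_right)
      have "D (M k) + D (U + W) \<in> J" using lnd_J[OF lnd Mk] by (simp only: mder_add)
      ultimately have "D (M k) + D (U + W) - D (U + W) \<in> J" by (intro J_rules(6))
      thus False using M_not_in_kernel[OF k] by (simp only: add_diff_cancel_right')
    qed
    hence "d0 = \<gamma>0" using A[of "- 1"] g1 by simp
    hence "d0 \<noteq> 0" using det by auto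
    from BU[OF this] obtain a where a: "a \<in> {1..n i}" "l i a = 1" unfolding g1 ..
    show False using l2[OF i a(1)] a(2) by simp
  qed
  hence g: "g = 2" using g2 g_pos by linarith
  hence "\<gamma>0 \<noteq> 0" "d0 \<noteq> 0" using roots_bound by auto
  then obtain a b where ab: "a \<in> {1..n i}" "l i a = 2" "b \<in> {1..n j}" "l j b = 2"
    using BU BW unfolding g by blast
  have ev: "even (l i w)" if "w \<in> {1..n i}" for w using g_dvd(1)[OF that] unfolding g .
  have ev': "even (l j w)" if "w \<in> {1..n j}" for w using g_dvd(2)[OF that] unfolding g .
  show ?thesis
    by (rule bexI[OF bexI[OF _ ab(3)] ab(1)]) (intro conjI ballI ab(2) ab(4) ev ev')
qed

end

section \<open>Conclusion\<close>

context homogeneous_lnd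
begin

lemma quadratic_exponents:
  "\<exists>i\<in>{0,1,2}. \<exists>j\<in>{0,1,2}. i \<noteq> j \<and> (\<exists>a\<in>{1..n i}. \<exists>b\<in>{1..n j}. l i a = 2 \<and> l j b = 2 \<and>
    (\<forall>u\<in>{1..n i}. \<forall>v\<in>{1..n j}. even (l i u) \<and> even (l j v)))"
proof -
  define \<mu> where "\<mu> t = Min (l t ` {1..n t})" for t
  have ne: "{1..n t} \<noteq> {}" if "t \<in> {0,1,2}" for t using that n0_pos n1 n2 by auto
  have \<mu>_in: "\<mu> t \<in> l t ` {1..n t}" if "t \<in> {0,1,2}" for t
    unfolding \<mu>_def by (rule Min_in) (use ne[OF that] in simp_all)
  have \<mu>_le: "\<mu> t \<le> l t u" if "u \<in> {1..n t}" for t u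
    unfolding \<mu>_def by (rule Min_le) (use that in simp_all)
  have two: "\<mu> t \<ge> 2" if t: "t \<in> {0,1,2}" for t
  proof -
    obtain u where u: "u \<in> {1..n t}" "\<mu> t = l t u" using \<mu>_in[OF t] by (elim imageE)
    show ?thesis unfolding u(2) by (rule l2[OF t u(1)])
  qed
  have dvd: "dd t dvd \<mu> t" if t: "t \<in> {0,1,2}" for t
  proof -
    obtain u where u: "u \<in> {1..n t}" "\<mu> t = l t u" using \<mu>_in[OF t] by (elim imageE)
    show ?thesis unfolding u(2) by (rule dd_dvd[OF u(1)])
  qed
  have "\<mu> 0 * \<mu> 1 * \<mu> 2 < \<mu> 1 * \<mu> 2 + \<mu> 0 * \<mu> 2 + \<mu> 0 * \<mu> 1 \<or> \<mu> 0 * \<mu> 1 * \<mu> 2 = 0"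
    by (rule platonic) (rule \<mu>_le)
  moreover have "\<mu> 0 * \<mu> 1 * \<mu> 2 \<noteq> 0" using two[of 0] two[of 1] two[of 2] by simp
  ultimately have "\<mu> 0 * \<mu> 1 * \<mu> 2 < \<mu> 1 * \<mu> 2 + \<mu> 0 * \<mu> 2 + \<mu> 0 * \<mu> 1" by (simp only: simp_thms)
  hence "(\<exists>i\<in>{0,1,2}. \<exists>j\<in>{0,1,2}. i \<noteq> j \<and> dd i = 2 \<and> \<mu> i = 2 \<and> dd j = 2 \<and> \<mu> j = 2) \<or>
    (\<exists>k\<in>{0,1,2}. \<exists>i\<in>{0,1,2}. \<exists>j\<in>{0,1,2}. i \<noteq> j \<and> i \<noteq> k \<and> j \<noteq> k \<and> coprime (dd k) (dd i) \<and> coprime (dd k) (dd j))"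
    by (rule platonic_coprime[OF dvd two, rotated 2])
  thus ?thesis
  proof (elim disjE bexE conjE)
    fix i j assume i: "i \<in> {0,1,2}" and j: "j \<in> {0,1,2}" and ij: "i \<noteq> j"
      and d: "dd i = 2" "\<mu> i = 2" "dd j = 2" "\<mu> j = 2"
    obtain a where a: "a \<in> {1..n i}" "l i a = 2" using \<mu>_in[OF i] unfolding d(2) by (elim imageE) simp
    obtain b where b: "b \<in> {1..n j}" "l j b = 2" using \<mu>_in[OF j] unfolding d(4) by (elim imageE) simp
    have ev: "even (l i w)" if "w \<in> {1..n i}" for w using dd_dvd[OF that] unfolding d(1) .
    have ev': "even (l j w)" if "w \<in> {1..n j}" for w using dd_dvd[OF that] unfolding d(3) .
    have "\<exists>a\<in>{1..n i}. \<exists>b\<in>{1..n j}. l i a = 2 \<and> l j b = 2 \<and>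
        (\<forall>u\<in>{1..n i}. \<forall>v\<in>{1..n j}. even (l i u) \<and> even (l j v))"
      by (rule bexI[OF bexI[OF _ b(1)] a(1)]) (intro conjI ballI a(2) b(2) ev ev')
    thus ?thesis by (intro bexI[OF bexI[OF _ j] i] conjI ij)
  next
    fix k i j assume k: "k \<in> {0,1,2}" and i: "i \<in> {0,1,2}" and j: "j \<in> {0,1,2}"
      and "i \<noteq> j" "i \<noteq> k" "j \<noteq> k" "coprime (dd k) (dd i)" "coprime (dd k) (dd j)"
    then interpret forms n l V \<delta> v0 i j k by unfold_locales
    show ?thesis by (intro bexI[OF bexI[OF _ j] i] conjI ij exponents_two)
  qed
qed

end

theorem theorem2:
  fixes n :: "nat \<Rightarrow> nat" and l :: "nat \<Rightarrow> nat \<Rightarrow> nat"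
  assumes "n 1 \<ge> 1" and "n 2 \<ge> 1"
    and "\<forall>i\<in>{0, 1, 2}. \<forall>j\<in>{1..n i}. l i j > 0"
  shows "\<not> rigid (trinomial_index n)
             (trinomial_hypersurface n l :: (nat \<times> nat \<Rightarrow> 'k::{alg_closed_field, field_char_0}) set)
    \<longleftrightarrow>
      (\<exists>i\<in>{0, 1, 2}. \<exists>a\<in>{1..n i}. l i a = 1) \<or>
      (n 0 \<noteq> 0 \<and>
       (\<exists>i\<in>{0, 1, 2}. \<exists>j\<in>{0, 1, 2}. i \<noteq> j \<and>
          (\<exists>a\<in>{1..n i}. \<exists>b\<in>{1..n j}.
             l i a = 2 \<and> l j b = 2 \<and>
             (\<forall>u\<in>{1..n i}. \<forall>v\<in>{1..n j}. even (l i u) \<and> even (l j v)))))"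
    (is "?nonrigid \<longleftrightarrow> ?linear \<or> ?quadratic")
proof -
  define V :: "(nat \<times> nat \<Rightarrow> 'k) set" where "V = trinomial_hypersurface n l"
  interpret trinomial n l V
    by (rule trinomial.intro[OF assms(1,2) bspec[OF bspec[OF assms(3)]] V_def])
  show ?thesis unfolding V_def[symmetric]
  proof
    assume nr: "\<not> rigid I V"
    show "?linear \<or> ?quadratic"
    proof (cases ?linear)
      case no: False
      have l2: "l i j \<ge> 2" if "i \<in> {0,1,2}" "j \<in> {1..n i}" for i j
      proof -
        have "l i j \<noteq> 1" using no that by blast
        thus ?thesis using l_pos[OF that] by linarith
      qed
      obtain \<delta>0 v where \<delta>0: "lnd \<delta>0" "v \<in> I" "\<delta>0 v \<notin> J" using lnd_if_not_rigid[OF nr] .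
      have "\<exists>\<delta> v0. lnd \<delta> \<and> v0 \<in> I \<and> \<delta> v0 \<notin> J \<and> (\<forall>w\<in>weights. hom \<delta> w)"
        by (rule homogenize[OF finite_weights admissible_weights \<delta>0])
      then obtain \<delta> v0 where \<delta>: "lnd \<delta>" "v0 \<in> I" "\<delta> v0 \<notin> J" "\<forall>w\<in>weights. hom \<delta> w" by (elim exE conjE)
      interpret homogeneous_lnd n l V \<delta> v0
        by (intro homogeneous_lnd.intro homogeneous_lnd_axioms.intro trinomial_axioms l2 \<delta>(1,2,3) bspec[OF \<delta>(4)])
      \<comment> \<open>With all exponents at least 2, a nonzero derivation already excludes an
        empty block 0; this yields the first half of the second condition.\<close>
      show ?thesis by (rule disjI2[OF conjI[OF n0_pos quadratic_exponents]])
    qed (rule disjI1)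
  next
    assume "?linear \<or> ?quadratic"
    thus "\<not> rigid I V"
    proof
      assume ?linear
      then obtain i a where "i \<in> {0,1,2}" "a \<in> {1..n i}" "l i a = 1" by (elim bexE)
      thus ?thesis by (rule not_rigid_linear)
    next
      assume ?quadratic
      then obtain i j a b where "n 0 \<noteq> 0" "i \<in> {0,1,2}" "j \<in> {0,1,2}" "i \<noteq> j"
        and ab: "a \<in> {1..n i}" "b \<in> {1..n j}" "l i a = 2" "l j b = 2"
        and ev: "\<forall>u\<in>{1..n i}. \<forall>v\<in>{1..n j}. even (l i u) \<and> even (l j v)" by (elim conjE bexE)
      note * = this
      show ?thesis
        by (rule not_rigid_quadratic[OF *(1-8)]) (use ev ab in blast)+
    qed
  qed
qed

end
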